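(* For every integer $m \geq 1$, the Brin--Thompson group $mV$ is $\frac{3}{2}$-generated.
   Context: A group $G$ is $\frac{3}{2}$-generated if $G$ can be generated by two elements and, moreover, for every nontrivial $g \in G$ there exists $h \in G$ such that $\langle g, h\rangle = G$. Definition of $mV$. Let $\mathfrak{C} = \{0,1\}^{\mathbb{N}}$ be the set of infinite binary sequences and $X = \{0,1\}^*$ the set of finite binary words. Fix $m \geq 1$. For $u = (u_1,\dots,u_m) \in X^m$ and $w = (w_1,\dots,w_m)$ in $X^m$ or in $\mathfrak{C}^m$, write $uw = (u_1w_1,\dots,u_mw_m)$ (componentwise concatenation), and write $u\mathfrak{C}^m = \{uw \mid w \in \mathfrak{C}^m\}$. A finite set $A \subseteq X^m$ is a basis of $\mathfrak{C}^m$ if $\{u\mathfrak{C}^m \mid u \in A\}$ is a partition of $\mathfrak{C}^m$. The Brin--Thompson group $mV$ is the group of bijections $g \in \mathrm{Sym}(\mathfrak{C}^m)$ (acting on the right) for which there exist bases $A$ and $B$ of $\mathfrak{C}^m$ and a bijection $\sigma\colon A \to B$ such that $(uw)g = (u\sigma)w$ for all $u \in A$ and all $w \in \mathfrak{C}^m$. *)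

theory Defs
  imports
    "HOL-Algebra.Generated_Groups"
    "HOL-Combinatorics.Permutations"
    "HOL-Library.Disjoint_Sets"
    "HOL-Library.Stream"
begin

text \<open>
  Infinite binary sequences are streams of booleans and finite binary words are lists of booleans.
  An \<open>m\<close>-tuple is a list of length \<open>m\<close>.
\<close>

definition cantor_power :: "nat \<Rightarrow> bool stream list set" where
  "cantor_power m = {w. length w = m}"

definition word_power :: "nat \<Rightarrow> bool list list set" where
  "word_power m = {u. length u = m}"

definition tuple_shift :: "bool list list \<Rightarrow> bool stream list \<Rightarrow> bool stream list"
    (infixr \<open>\<frown>\<close> 65) where
  "u \<frown> w = map2 (@-) u w"

definition cone :: "nat \<Rightarrow> bool list list \<Rightarrow> bool stream list set" where
  "cone m u = {u \<frown> w | w. w \<in> cantor_power m}"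

definition is_basis :: "nat \<Rightarrow> bool list list set \<Rightarrow> bool" where
  "is_basis m A \<longleftrightarrow>
     finite A \<and> A \<subseteq> word_power m \<and> partition_on (cantor_power m) (cone m ` A)"

text \<open>
  A permutation of \<open>cantor_power m\<close> is represented, via \<open>permutes\<close>, by its extension with
  the identity to all lists of streams. Permutations act on the right, so the product of \<open>g\<close>
  and \<open>h\<close> applies \<open>g\<close> first.
\<close>

definition brin_thompson :: "nat \<Rightarrow> (bool stream list \<Rightarrow> bool stream list) monoid" where
  "brin_thompson m =
    \<lparr>carrier = {g. g permutes cantor_power m \<and>
       (\<exists>A B \<sigma>. is_basis m A \<and> is_basis m B \<and> bij_betw \<sigma> A B \<and>
          (\<forall>u\<in>A. \<forall>w\<in>cantor_power m. g (u \<frown> w) = \<sigma> u \<frown> w))},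
     monoid.mult = (\<lambda>g h. h \<circ> g),
     one = id\<rparr>"

definition three_halves_generated :: "('a, 'b) monoid_scheme \<Rightarrow> bool" where
  "three_halves_generated G \<longleftrightarrow>
     group G \<and>
     (\<exists>a\<in>carrier G. \<exists>b\<in>carrier G. generate G {a, b} = carrier G) \<and>
     (\<forall>g\<in>carrier G. g \<noteq> \<one>\<^bsub>G\<^esub> \<longrightarrow> (\<exists>h\<in>carrier G. generate G {g, h} = carrier G))"

end

theory Submission
  imports Defs
begin

text \<open>
  Let \<open>g\<close> be nontrivial. It maps the cone of some \<open>u\<close> onto the cone of some \<open>v\<close> by prefix
  replacement, where the two cones are disjoint and do not cover the space. Divide the complement
  of the cone of \<open>u\<close> into cells \<open>c\<^sub>0, \<dots>, c\<^sub>N\<^sub>-\<^sub>1\<close> with \<open>N \<equiv> 1\<close> modulo 6, the first \<open>4m + 3\<close> of which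
  divide the cone of \<open>v\<close>. Let \<open>h = ab\<close>, where \<open>b\<close> permutes the cells cyclically and \<open>a\<close> has order 6
  and is supported in the cone of \<open>u\<close>. Then \<open>h\<^sup>N = a\<close>, so \<open>a\<close>, \<open>b\<close> and \<open>a' = g a g\<^sup>-\<^sup>1\<close>, which is supported
  in the cone of \<open>v\<close>, lie in the subgroup \<open>K\<close> generated by \<open>g\<close> and \<open>h\<close>. The element \<open>a\<close> is chosen such that the
  fourth power of \<open>a'\<close> is the three-cycle of \<open>c\<^sub>0, c\<^sub>1, c\<^sub>2\<close>, so that \<open>K\<close> contains the alternating group
  of the cells, and such that its third power exchanges, for each coordinate and each digit, one cell with the
  part of another cell given by appending the digit in that coordinate. Conjugation makes all
  three-cycles of small cones available, first outside \<open>u\<close> and then, using \<open>g\<close> once more, everywhere.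
  These yield all swaps of two disjoint cones.

  Swaps generate the whole group: modulo swaps, the class of a baker map (which moves a digit from
  one coordinate to another) does not depend on the cone, and it is twice itself, hence trivial.
  Therefore two divisions of the space obtained by successive halvings into the same number of
  cells are related by a product of swaps, and every element of the group maps one such division to another.
\<close>

section \<open>Cones and prefix replacement\<close>

definition tuple_append :: "bool list list \<Rightarrow> bool list list \<Rightarrow> bool list list" (infixr \<open>\<odot>\<close> 66) where
  "u \<odot> v = map2 (@) u v"

abbreviation pinv :: "('a \<Rightarrow> 'a) \<Rightarrow> 'a \<Rightarrow> 'a" where
  "pinv \<equiv> inv_into UNIV"

locale cantor =
  fixes m :: nat
begin

abbreviation "C \<equiv> cantor_power m"
abbreviation "W \<equiv> word_power m"

text \<open>For a coordinate outside the range the update has no effect and the tuple is empty, so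
  \<open>letter l b\<close> lies in \<open>W\<close> without a bound on \<open>l\<close>.\<close>

definition letter :: "nat \<Rightarrow> bool \<Rightarrow> bool list list" where
  "letter l b = (replicate m [])[l := [b]]"

definition disj :: "bool list list \<Rightarrow> bool list list \<Rightarrow> bool" where
  "disj u v \<longleftrightarrow> cone m u \<inter> cone m v = {}"

definition replaces :: "(bool stream list \<Rightarrow> bool stream list) \<Rightarrow> bool list list \<Rightarrow> bool list list \<Rightarrow> bool" where
  "replaces f u v \<longleftrightarrow> (\<forall>w\<in>C. f (u \<frown> w) = v \<frown> w)"

lemma W_iff: "u \<in> W \<longleftrightarrow> length u = m" by (simp add: word_power_def)
lemma C_iff: "u \<in> C \<longleftrightarrow> length u = m" by (simp add: cantor_power_def)

lemma nth_frown: "u \<in> W \<Longrightarrow> w \<in> C \<Longrightarrow> l < m \<Longrightarrow> (u \<frown> w) ! l = u ! l @- w ! l"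
  by (simp add: tuple_shift_def W_iff C_iff)

lemma nth_tuple_append: "u \<in> W \<Longrightarrow> v \<in> W \<Longrightarrow> l < m \<Longrightarrow> (u \<odot> v) ! l = u ! l @ v ! l"
  by (simp add: tuple_append_def W_iff)

lemma frown_C [simp, intro]: "u \<in> W \<Longrightarrow> w \<in> C \<Longrightarrow> u \<frown> w \<in> C"
  by (simp add: tuple_shift_def W_iff C_iff)

lemma append_W [simp, intro]: "u \<in> W \<Longrightarrow> v \<in> W \<Longrightarrow> u \<odot> v \<in> W"
  by (simp add: tuple_append_def W_iff)

lemma C_eqI: "x \<in> C \<Longrightarrow> y \<in> C \<Longrightarrow> (\<And>l. l < m \<Longrightarrow> x ! l = y ! l) \<Longrightarrow> x = y"
  by (auto simp: C_iff intro: nth_equalityI)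

lemma W_eqI: "x \<in> W \<Longrightarrow> y \<in> W \<Longrightarrow> (\<And>l. l < m \<Longrightarrow> x ! l = y ! l) \<Longrightarrow> x = y"
  by (auto simp: W_iff intro: nth_equalityI)

lemma append_frown [simp]: "u \<in> W \<Longrightarrow> v \<in> W \<Longrightarrow> w \<in> C \<Longrightarrow> (u \<odot> v) \<frown> w = u \<frown> v \<frown> w"
  by (rule C_eqI) (auto simp: nth_frown nth_tuple_append)

lemma tuple_append_assoc: "u \<in> W \<Longrightarrow> v \<in> W \<Longrightarrow> w \<in> W \<Longrightarrow> (u \<odot> v) \<odot> w = u \<odot> v \<odot> w"
  by (rule W_eqI) (auto simp: nth_tuple_append)

lemma letter_W [simp, intro]: "letter l b \<in> W"
  by (simp add: letter_def W_iff)

lemma nth_letter: "k < m \<Longrightarrow> letter l b ! k = (if k = l then [b] else [])"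
  by (auto simp: letter_def)

lemma letter_commute: "i \<noteq> j \<Longrightarrow> letter i b \<odot> letter j c = letter j c \<odot> letter i b"
  by (rule W_eqI) (auto simp: nth_tuple_append nth_letter)

lemma append_letter_commute: "i \<noteq> j \<Longrightarrow> u \<in> W \<Longrightarrow>
    (u \<odot> letter i b) \<odot> letter j c = (u \<odot> letter j c) \<odot> letter i b"
  by (simp add: tuple_append_assoc letter_commute)

definition eps :: "bool list list" where "eps = replicate m []"

lemma eps_W [simp, intro]: "eps \<in> W" by (simp add: eps_def W_iff)
lemma nth_eps [simp]: "l < m \<Longrightarrow> eps ! l = []" by (simp add: eps_def)
lemma append_eps [simp]: "u \<in> W \<Longrightarrow> u \<odot> eps = u"
  by (rule W_eqI) (auto simp: nth_tuple_append)
lemma eps_append [simp]: "u \<in> W \<Longrightarrow> eps \<odot> u = u"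
  by (rule W_eqI) (auto simp: nth_tuple_append)
lemma eps_frown [simp]: "w \<in> C \<Longrightarrow> eps \<frown> w = w"
  by (rule C_eqI) (auto simp: nth_frown)

lemma C_nonempty: "replicate m (sconst True) \<in> C" by (simp add: C_iff)

lemma cone_sub [simp]: "u \<in> W \<Longrightarrow> cone m u \<subseteq> C"
  by (auto simp: cone_def)

lemma cone_C: "x \<in> cone m u \<Longrightarrow> u \<in> W \<Longrightarrow> x \<in> C"
  using cone_sub by blast

lemma coneI [intro]: "w \<in> C \<Longrightarrow> u \<frown> w \<in> cone m u"
  by (auto simp: cone_def)

lemma cone_ne: "cone m u \<noteq> {}"
  using C_nonempty by (auto simp: cone_def)

lemma cone_eps [simp]: "cone m eps = C"
  by (force simp: cone_def)

lemma cone_append: "u \<in> W \<Longrightarrow> v \<in> W \<Longrightarrow> cone m (u \<odot> v) = (\<lambda>x. u \<frown> x) ` cone m v"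
  by (force simp: cone_def)

lemma cone_append_sub: "u \<in> W \<Longrightarrow> v \<in> W \<Longrightarrow> cone m (u \<odot> v) \<subseteq> cone m u"
  by (auto simp: cone_append cone_def)

lemma mem_cone_iff:
  assumes "u \<in> W"
  shows "x \<in> cone m u \<longleftrightarrow> x \<in> C \<and> (\<forall>l<m. stake (length (u ! l)) (x ! l) = u ! l)"
proof
  assume "x \<in> cone m u"
  then show "x \<in> C \<and> (\<forall>l<m. stake (length (u ! l)) (x ! l) = u ! l)"
    using assms by (auto simp: cone_def nth_frown stake_shift)
next
  assume x: "x \<in> C \<and> (\<forall>l<m. stake (length (u ! l)) (x ! l) = u ! l)"
  define w where "w = map2 (\<lambda>a s. sdrop (length a) s) u x"
  have w: "w \<in> C" using x assms by (simp add: w_def C_iff W_iff)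
  have "x = u \<frown> w"
  proof (rule C_eqI)
    fix l assume l: "l < m"
    have "w ! l = sdrop (length (u ! l)) (x ! l)"
      using l x assms by (simp add: w_def C_iff W_iff)
    then show "x ! l = (u \<frown> w) ! l"
      using l x w assms by (metis nth_frown stake_sdrop)
  qed (use x w assms in auto)
  with w show "x \<in> cone m u" by auto
qed

lemma frown_inj: "u \<in> W \<Longrightarrow> w \<in> C \<Longrightarrow> w' \<in> C \<Longrightarrow> u \<frown> w = u \<frown> w' \<longleftrightarrow> w = w'"
proof
  assume a: "u \<in> W" "w \<in> C" "w' \<in> C" "u \<frown> w = u \<frown> w'"
  show "w = w'"
  proof (rule C_eqI)
    fix l assume l: "l < m"
    have "u ! l @- w ! l = u ! l @- w' ! l" using a l by (metis nth_frown)
    then show "w ! l = w' ! l" by simp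
  qed (use a in auto)
qed auto

text \<open>The first digit in coordinate \<open>l\<close> divides the whole space in two; prefixing
  with \<open>u\<close> transports this to the cone of \<open>u\<close>.\<close>

lemma cone_split:
  assumes "u \<in> W" "l < m"
  shows "cone m u = cone m (u \<odot> letter l False) \<union> cone m (u \<odot> letter l True)"
proof -
  have "C \<subseteq> cone m (letter l False) \<union> cone m (letter l True)"
  proof
    fix x assume "x \<in> C"
    then show "x \<in> cone m (letter l False) \<union> cone m (letter l True)"
      using assms by (cases "shd (x ! l)") (auto simp: mem_cone_iff nth_letter)
  qed
  moreover have "cone m (letter l False) \<union> cone m (letter l True) \<subseteq> C" by simp
  ultimately have "C = cone m (letter l False) \<union> cone m (letter l True)" by auto
  then have "(\<lambda>x. u \<frown> x) ` C = (\<lambda>x. u \<frown> x) ` cone m (letter l False) \<union> (\<lambda>x. u \<frown> x) ` cone m (letter l True)"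
    by (metis image_Un)
  moreover have "(\<lambda>x. u \<frown> x) ` C = cone m u" by (auto simp: cone_def)
  ultimately show ?thesis using assms by (simp add: cone_append)
qed

lemma disj_sym: "disj u v \<Longrightarrow> disj v u" by (auto simp: disj_def)

lemma disj_letter: "l < m \<Longrightarrow> b \<noteq> c \<Longrightarrow> disj (letter l b) (letter l c)"
  by (force simp: disj_def mem_cone_iff nth_letter)

lemma disj_append: "u \<in> W \<Longrightarrow> x \<in> W \<Longrightarrow> y \<in> W \<Longrightarrow> disj (u \<odot> x) (u \<odot> y) \<longleftrightarrow> disj x y"
  unfolding disj_def cone_append
  using cone_sub[of x] cone_sub[of y] by (auto simp: frown_inj subset_iff)

lemma disj_append_letter: "u \<in> W \<Longrightarrow> l < m \<Longrightarrow> b \<noteq> c \<Longrightarrow> disj (u \<odot> letter l b) (u \<odot> letter l c)"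
  by (simp add: disj_append disj_letter)

lemma disj_extend_l: "disj u v \<Longrightarrow> u \<in> W \<Longrightarrow> x \<in> W \<Longrightarrow> disj (u \<odot> x) v"
  using cone_append_sub[of u x] by (auto simp: disj_def)

lemma disj_extend_r: "disj u v \<Longrightarrow> v \<in> W \<Longrightarrow> x \<in> W \<Longrightarrow> disj u (v \<odot> x)"
  using disj_extend_l disj_sym by blast

lemma disj_extend: "disj u v \<Longrightarrow> u \<in> W \<Longrightarrow> v \<in> W \<Longrightarrow> x \<in> W \<Longrightarrow> y \<in> W \<Longrightarrow> disj (u \<odot> x) (v \<odot> y)"
  by (intro disj_extend_l disj_extend_r)

lemma disj_irrefl: "\<not> disj u u" using cone_ne by (auto simp: disj_def)

text \<open>A common point of the cones has both words as prefixes in every coordinate, and of two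
  prefixes of one stream the shorter is a prefix of the longer. This is how a deep word is located
  inside a coarser cell.\<close>

lemma deep_cone:
  assumes "u \<in> W" "d \<in> W" "\<And>l. l < m \<Longrightarrow> length (u ! l) \<le> length (d ! l)" "\<not> disj d u"
  obtains y where "y \<in> W" "d = u \<odot> y" "\<And>l. l < m \<Longrightarrow> length (y ! l) = length (d ! l) - length (u ! l)"
proof -
  define y where "y = map2 (\<lambda>a s. drop (length a) s) u d"
  have y: "y \<in> W" using assms by (simp add: y_def W_iff)
  have yl: "y ! l = drop (length (u ! l)) (d ! l)" if "l < m" for l
    using that assms by (simp add: y_def W_iff)
  from assms(4) obtain x where x: "x \<in> cone m d" "x \<in> cone m u" by (auto simp: disj_def)
  have "d = u \<odot> y"
  proof (rule W_eqI)
    fix l assume l: "l < m"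
    have "stake (length (u ! l)) (x ! l) = u ! l" "stake (length (d ! l)) (x ! l) = d ! l"
      using x l assms by (auto simp: mem_cone_iff)
    then have "take (length (u ! l)) (d ! l) = u ! l"
      using assms(3)[OF l] by (metis min.absorb1 take_stake)
    then show "d ! l = (u \<odot> y) ! l"
      using l y assms yl by (metis append_take_drop_id nth_tuple_append)
  qed (use y assms in auto)
  then show ?thesis using that y yl by auto
qed

section \<open>Uniform grids and divisions of the space into cones\<close>

definition grid :: "nat \<Rightarrow> bool list list set" where
  "grid n = {u \<in> W. \<forall>l<m. length (u ! l) = n}"

lemma finite_grid: "finite (grid n)"
proof -
  have "grid n \<subseteq> {u. set u \<subseteq> {v. set v \<subseteq> UNIV \<and> length v = n} \<and> length u = m}"
    by (auto simp: grid_def W_iff in_set_conv_nth)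
  moreover have "finite {u. set u \<subseteq> {v::bool list. set v \<subseteq> UNIV \<and> length v = n} \<and> length u = m}"
    by (intro finite_lists_length_eq) auto
  ultimately show ?thesis by (rule finite_subset)
qed

lemma grid_W: "u \<in> grid n \<Longrightarrow> u \<in> W" by (simp add: grid_def)

definition trunc :: "nat \<Rightarrow> bool stream list \<Rightarrow> bool list list" where
  "trunc n x = map (stake n) x"

lemma trunc_grid: "x \<in> C \<Longrightarrow> trunc n x \<in> grid n"
  by (auto simp: trunc_def grid_def W_iff C_iff)

lemma trunc_cone: "x \<in> C \<Longrightarrow> x \<in> cone m (trunc n x)"
  by (auto simp: trunc_def W_iff C_iff mem_cone_iff)

lemma cone_grid_iff:
  assumes "u \<in> grid n"
  shows "x \<in> cone m u \<longleftrightarrow> x \<in> C \<and> u = trunc n x"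
proof
  assume x: "x \<in> cone m u"
  have u: "u \<in> W" using assms by (rule grid_W)
  with x have xC: "x \<in> C" using cone_sub by blast
  have "u = trunc n x"
  proof (rule W_eqI)
    show "trunc n x \<in> W" using xC trunc_grid grid_W by blast
    fix l assume l: "l < m"
    then have "stake (length (u ! l)) (x ! l) = u ! l" "length (u ! l) = n"
      using x u assms by (auto simp: mem_cone_iff grid_def)
    then show "u ! l = trunc n x ! l" using l xC by (simp add: trunc_def C_iff)
  qed (rule u)
  with xC show "x \<in> C \<and> u = trunc n x" by simp
qed (metis trunc_cone)

lemma grid_disj: "u \<in> grid n \<Longrightarrow> v \<in> grid n \<Longrightarrow> u \<noteq> v \<Longrightarrow> disj u v"
  unfolding disj_def by (metis cone_grid_iff disjoint_iff)

text \<open>Working form of \<open>is_basis\<close>: disjointness is stated for pairs of words, so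
  that it applies to individual cells, and covering is an inclusion.\<close>

definition tiling :: "bool list list set \<Rightarrow> bool" where
  "tiling P \<longleftrightarrow> finite P \<and> P \<subseteq> W \<and> (\<forall>u\<in>P. \<forall>v\<in>P. u \<noteq> v \<longrightarrow> disj u v) \<and> C \<subseteq> (\<Union>u\<in>P. cone m u)"

lemma tiling_grid: "tiling (grid n)"
  unfolding tiling_def
proof (intro conjI ballI impI)
  show "C \<subseteq> (\<Union>u\<in>grid n. cone m u)"
    using trunc_grid trunc_cone by (meson UN_I subsetI)
qed (auto simp: finite_grid grid_W intro: grid_disj)

lemma tiling_is_basis:
  assumes "tiling P"
  shows "is_basis m P"
  unfolding is_basis_def partition_on_def
proof (intro conjI)
  have W: "P \<subseteq> W" using assms by (simp add: tiling_def)
  then show "\<Union> (cone m ` P) = C"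
    using assms cone_C by (fastforce simp: tiling_def)
  show "disjoint (cone m ` P)"
  proof (rule disjointI)
    fix a b assume "a \<in> cone m ` P" "b \<in> cone m ` P" "a \<noteq> b"
    then obtain u v where "u \<in> P" "v \<in> P" "u \<noteq> v" "a = cone m u" "b = cone m v" by blast
    then show "a \<inter> b = {}" using assms by (simp add: tiling_def disj_def)
  qed
  show "{} \<notin> cone m ` P" using cone_ne by auto
qed (use assms in \<open>auto simp: tiling_def\<close>)

lemma preD: "replaces f u v \<Longrightarrow> w \<in> C \<Longrightarrow> f (u \<frown> w) = v \<frown> w" by (simp add: replaces_def)

lemma replaces_append: "replaces f u v \<Longrightarrow> u \<in> W \<Longrightarrow> v \<in> W \<Longrightarrow> x \<in> W \<Longrightarrow> replaces f (u \<odot> x) (v \<odot> x)"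
  by (auto simp: replaces_def)

lemma replaces_comp: "replaces f u v \<Longrightarrow> replaces g v w \<Longrightarrow> v \<in> W \<Longrightarrow> replaces (g \<circ> f) u w"
  by (auto simp: replaces_def)

lemma replaces_image:
  assumes "replaces f u v"
  shows "f ` cone m u = cone m v"
proof -
  have "cone m u = (\<lambda>w. u \<frown> w) ` C" for u by (auto simp: cone_def)
  then show ?thesis using assms by (simp add: image_image replaces_def)
qed

lemma replaces_inv: "inj f \<Longrightarrow> replaces f u v \<Longrightarrow> replaces (pinv f) v u"
  by (auto simp: replaces_def inv_f_eq)

lemma replaces_disj:
  assumes "inj f" "replaces f u v" "replaces f u' v'"
  shows "disj u u' \<longleftrightarrow> disj v v'"
proof -
  have "f ` (cone m u \<inter> cone m u') = cone m v \<inter> cone m v'"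
    using assms by (simp add: image_Int replaces_image)
  then show ?thesis unfolding disj_def by (metis image_is_empty)
qed

lemma replaces_ext:
  assumes "C \<subseteq> (\<Union>u\<in>P. cone m u)" "f permutes C" "g permutes C"
    "\<And>u. u \<in> P \<Longrightarrow> \<exists>v. replaces f u v \<and> replaces g u v"
  shows "f = g"
proof
  fix x
  show "f x = g x"
  proof (cases "x \<in> C")
    case True
    with assms(1) obtain u w where "u \<in> P" "w \<in> C" "x = u \<frown> w" by (auto simp: cone_def)
    with assms(4)[of u] show ?thesis by (auto simp: replaces_def)
  qed (use assms in \<open>simp add: permutes_not_in\<close>)
qed

section \<open>The group structure of \<open>mV\<close>\<close>

abbreviation "G \<equiv> brin_thompson m"

text \<open>Injectivity keeps the image cones disjoint and surjectivity keeps them covering. The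
  action on one tiling thus supplies the second basis and the bijection that membership in the group
  demands.\<close>

lemma tiling_image:
  assumes g: "g permutes C" and A: "tiling A"
    and s: "\<And>u. u \<in> A \<Longrightarrow> \<sigma> u \<in> W \<and> replaces g u (\<sigma> u)"
  shows "inj_on \<sigma> A" "tiling (\<sigma> ` A)"
proof -
  have inj: "inj g" using g by (simp add: permutes_inj)
  have im: "g ` cone m u = cone m (\<sigma> u)" if "u \<in> A" for u
    using replaces_image s that by blast
  show "inj_on \<sigma> A"
  proof (rule inj_onI, rule ccontr)
    fix u v assume "u \<in> A" "v \<in> A" "\<sigma> u = \<sigma> v" "u \<noteq> v"
    moreover from this have "disj u v" using A by (simp add: tiling_def)
    ultimately show False using replaces_disj[OF inj, of u "\<sigma> u" v "\<sigma> u"] s disj_irrefl by metis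
  qed
  show "tiling (\<sigma> ` A)"
    unfolding tiling_def
  proof (intro conjI ballI impI)
    show "finite (\<sigma> ` A)" using A by (simp add: tiling_def)
    show "\<sigma> ` A \<subseteq> W" using s by auto
    show "disj u v" if uv: "u \<in> \<sigma> ` A" "v \<in> \<sigma> ` A" "u \<noteq> v" for u v
    proof -
      obtain a b where ab: "a \<in> A" "b \<in> A" "a \<noteq> b" "u = \<sigma> a" "v = \<sigma> b" using uv by blast
      then have "disj a b" using A by (simp add: tiling_def)
      then show ?thesis using replaces_disj[OF inj, of a u b v] s ab by simp
    qed
    have "C = g ` C" using g by (simp add: permutes_image)
    also have "\<dots> \<subseteq> g ` (\<Union>u\<in>A. cone m u)" using A by (auto simp: tiling_def)
    also have "\<dots> = (\<Union>u\<in>A. g ` cone m u)" by auto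
    also have "\<dots> = (\<Union>u\<in>\<sigma> ` A. cone m u)" using im by simp
    finally show "C \<subseteq> (\<Union>u\<in>\<sigma> ` A. cone m u)" .
  qed
qed

lemma carrierI:
  assumes g: "g permutes C" and A: "tiling A"
    and "\<And>u. u \<in> A \<Longrightarrow> \<exists>v\<in>W. replaces g u v"
  shows "g \<in> carrier G"
proof -
  obtain \<sigma> where s: "\<And>u. u \<in> A \<Longrightarrow> \<sigma> u \<in> W \<and> replaces g u (\<sigma> u)" using assms(3) by metis
  have "\<exists>A B \<sigma>. is_basis m A \<and> is_basis m B \<and> bij_betw \<sigma> A B \<and>
          (\<forall>u\<in>A. \<forall>w\<in>C. g (u \<frown> w) = \<sigma> u \<frown> w)"
    using tiling_is_basis[OF A] tiling_is_basis[OF tiling_image(2)[OF g A s]]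
      tiling_image(1)[OF g A s] s unfolding bij_betw_def replaces_def by blast
  then show ?thesis using g by (simp add: brin_thompson_def)
qed

lemma finite_lengths:
  assumes "finite (A :: bool list list set)"
  obtains n where "\<And>u l. u \<in> A \<Longrightarrow> l < m \<Longrightarrow> length (u ! l) \<le> n"
proof -
  have "finite ((\<lambda>(u, l). length (u ! l)) ` (A \<times> {..<m}))" using assms by simp
  then obtain n where "\<forall>k\<in>(\<lambda>(u, l). length (u ! l)) ` (A \<times> {..<m}). k \<le> n"
    using finite_nat_set_iff_bounded_le by blast
  then have "length (u ! l) \<le> n" if "u \<in> A" "l < m" for u l using that by force
  then show ?thesis by (rule that)
qed

text \<open>Some cell meets the cone of \<open>d\<close>, and by \<open>deep_cone\<close> that cell
  is a prefix of \<open>d\<close>.\<close>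

lemma deep_cover:
  assumes cov: "C \<subseteq> (\<Union>u\<in>A. cone m u)" and A: "A \<subseteq> W" and d: "d \<in> W"
    and len: "\<And>u l. u \<in> A \<Longrightarrow> l < m \<Longrightarrow> length (u ! l) \<le> length (d ! l)"
  obtains u y where "u \<in> A" "y \<in> W" "d = u \<odot> y"
proof -
  obtain x where "x \<in> cone m d" using cone_ne by auto
  moreover from this have "x \<in> C" using cone_sub d by blast
  ultimately obtain u where u: "u \<in> A" "\<not> disj d u" using cov by (auto simp: disj_def)
  from u have "u \<in> W" using A by blast
  from deep_cone[OF this d len[OF u(1)] u(2)] obtain y where "y \<in> W" "d = u \<odot> y" by metis
  with u show ?thesis using that by simp
qed

text \<open>A grid at least as deep as the longest word of the basis can replace the basis, since
  each of its cells extends a basis cell.\<close>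

lemma carrierD:
  assumes "g \<in> carrier G"
  shows "g permutes C" "\<exists>n. \<forall>u\<in>grid n. \<exists>v\<in>W. replaces g u v"
proof -
  show "g permutes C" using assms by (simp add: brin_thompson_def)
  obtain A B \<sigma> where A: "is_basis m A" "is_basis m B" "bij_betw \<sigma> A B"
    "\<And>u. u \<in> A \<Longrightarrow> replaces g u (\<sigma> u)"
    using assms by (auto simp: brin_thompson_def replaces_def)
  have AW: "A \<subseteq> W" "finite A" "C \<subseteq> (\<Union>u\<in>A. cone m u)" "\<And>u. u \<in> A \<Longrightarrow> \<sigma> u \<in> W"
    using A by (auto simp: is_basis_def partition_on_def bij_betw_def)
  obtain n where n: "\<And>u l. u \<in> A \<Longrightarrow> l < m \<Longrightarrow> length (u ! l) \<le> n"
    using finite_lengths AW(2) by blast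
  have "\<exists>v\<in>W. replaces g d v" if d: "d \<in> grid n" for d
  proof -
    obtain u y where "u \<in> A" "y \<in> W" "d = u \<odot> y"
      by (rule deep_cover[of A d]) (use AW d n in \<open>auto simp: grid_def\<close>)
    moreover from this have "u \<in> W" "\<sigma> u \<in> W" using AW by auto
    ultimately show ?thesis using replaces_append[OF A(4)] append_W by blast
  qed
  then show "\<exists>n. \<forall>u\<in>grid n. \<exists>v\<in>W. replaces g u v" by blast
qed

lemma carrier_deep:
  assumes "g \<in> carrier G"
  shows "\<exists>n. \<forall>u\<in>W. (\<forall>l<m. n \<le> length (u ! l)) \<longrightarrow> (\<exists>v\<in>W. replaces g u v)"
proof -
  obtain n where n: "\<And>u. u \<in> grid n \<Longrightarrow> \<exists>v\<in>W. replaces g u v" using carrierD(2)[OF assms] by blast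
  have "\<exists>v\<in>W. replaces g d v" if d: "d \<in> W" "\<forall>l<m. n \<le> length (d ! l)" for d
  proof -
    obtain u y where "u \<in> grid n" "y \<in> W" "d = u \<odot> y"
      by (rule deep_cover[of "grid n" d]) (use d tiling_grid[of n] in \<open>auto simp: grid_def tiling_def\<close>)
    then show ?thesis using n replaces_append grid_W by blast
  qed
  then show ?thesis by blast
qed

lemma comp_carrier:
  assumes "f \<in> carrier G" "g \<in> carrier G"
  shows "f \<circ> g \<in> carrier G"
proof -
  obtain n where n: "\<And>u. u \<in> grid n \<Longrightarrow> \<exists>v\<in>W. replaces g u v" using carrierD(2)[OF assms(2)] by blast
  obtain k where k: "\<And>u. u \<in> W \<Longrightarrow> (\<forall>l<m. k \<le> length (u ! l)) \<Longrightarrow> \<exists>v\<in>W. replaces f u v"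
    using carrier_deep[OF assms(1)] by blast
  \<comment> \<open>The first \<open>n\<close> letters are consumed by \<open>g\<close>; the other
    \<open>k\<close> survive as a suffix of the image, which is therefore deep enough for
    \<open>f\<close>.\<close>
  have "\<exists>v\<in>W. replaces (f \<circ> g) d v" if d: "d \<in> grid (n + k)" for d
  proof -
    obtain u where u: "u \<in> grid n" "\<not> disj d u"
    proof -
      obtain x where x: "x \<in> cone m d" using cone_ne by auto
      then have "x \<in> C" using cone_sub d grid_W by blast
      then show ?thesis using x that trunc_grid[of x n] trunc_cone[of x n] by (auto simp: disj_def)
    qed
    obtain y where y: "y \<in> W" "d = u \<odot> y" "\<And>l. l < m \<Longrightarrow> length (y ! l) = k"
      by (rule deep_cone[of u d]) (use u d in \<open>auto simp: grid_def\<close>)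
    obtain v where v: "v \<in> W" "replaces g u v" using n u by blast
    obtain w where "w \<in> W" "replaces f (v \<odot> y) w" using k[of "v \<odot> y"] v y by (auto simp: nth_tuple_append)
    then show ?thesis using v y u replaces_comp[of g d "v \<odot> y" f w] replaces_append grid_W by blast
  qed
  moreover have "(f \<circ> g) permutes C" using assms carrierD(1) permutes_compose by blast
  ultimately show ?thesis using carrierI[OF _ tiling_grid] by blast
qed

text \<open>The images of the grid cells under \<open>g\<close> cover the space, and the inverse
  replaces each image by its grid cell. A grid at least as deep as all these images therefore serves
  as a tiling for the inverse.\<close>

lemma inv_carrier:
  assumes "g \<in> carrier G"
  shows "pinv g \<in> carrier G"
proof -
  have p: "g permutes C" using carrierD assms by blast
  have inj: "inj g" using p by (simp add: permutes_inj)
  obtain n where "\<And>u. u \<in> grid n \<Longrightarrow> \<exists>v\<in>W. replaces g u v" using carrierD(2)[OF assms] by blast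
  then obtain \<sigma> where s: "\<And>u. u \<in> grid n \<Longrightarrow> \<sigma> u \<in> W \<and> replaces g u (\<sigma> u)" by metis
  have im: "g ` cone m u = cone m (\<sigma> u)" if "u \<in> grid n" for u
    using replaces_image s that by blast
  obtain k where k: "\<And>u l. u \<in> \<sigma> ` grid n \<Longrightarrow> l < m \<Longrightarrow> length (u ! l) \<le> k"
    using finite_lengths finite_grid by (metis finite_imageI)
  have "C \<subseteq> (\<Union>u\<in>grid n. cone m u)" using tiling_grid by (simp add: tiling_def)
  then have "g ` C \<subseteq> (\<Union>u\<in>grid n. g ` cone m u)" by (metis image_UN image_mono)
  then have cov: "C \<subseteq> (\<Union>u\<in>\<sigma> ` grid n. cone m u)"
    using p im by (simp add: permutes_image)
  have "\<exists>v\<in>W. replaces (pinv g) d v" if d: "d \<in> grid k" for d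
  proof -
    obtain u y where "u \<in> \<sigma> ` grid n" "y \<in> W" "d = u \<odot> y"
      by (rule deep_cover[OF cov, of d]) (use s d k in \<open>auto simp: grid_def\<close>)
    then show ?thesis using s replaces_inv[OF inj] replaces_append grid_W by (metis imageE append_W)
  qed
  moreover have "pinv g permutes C" using p permutes_inv by blast
  ultimately show ?thesis using carrierI[OF _ tiling_grid] by blast
qed

lemma id_carrier: "id \<in> carrier G"
  by (rule carrierI[OF permutes_id tiling_grid[of 0]]) (auto simp: replaces_def grid_W)

lemma mult_G [simp]: "x \<otimes>\<^bsub>G\<^esub> y = y \<circ> x" by (simp add: brin_thompson_def)
lemma one_G [simp]: "\<one>\<^bsub>G\<^esub> = id" by (simp add: brin_thompson_def)

lemma group_G: "group G"
proof (rule groupI)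
  fix x y assume "x \<in> carrier G" "y \<in> carrier G"
  then show "x \<otimes>\<^bsub>G\<^esub> y \<in> carrier G" unfolding mult_G by (intro comp_carrier)
next
  show "\<one>\<^bsub>G\<^esub> \<in> carrier G" unfolding one_G by (rule id_carrier)
next
  fix x y z
  show "x \<otimes>\<^bsub>G\<^esub> y \<otimes>\<^bsub>G\<^esub> z = x \<otimes>\<^bsub>G\<^esub> (y \<otimes>\<^bsub>G\<^esub> z)" unfolding mult_G by (rule comp_assoc[symmetric])
next
  fix x
  show "\<one>\<^bsub>G\<^esub> \<otimes>\<^bsub>G\<^esub> x = x" unfolding mult_G one_G by (rule comp_id)
next
  fix x assume x: "x \<in> carrier G"
  show "\<exists>y\<in>carrier G. y \<otimes>\<^bsub>G\<^esub> x = \<one>\<^bsub>G\<^esub>"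
    unfolding mult_G one_G using permutes_inv_o(1)[OF carrierD(1)[OF x]] inv_carrier[OF x] by (rule bexI)
qed

lemma inv_G:
  assumes x: "x \<in> carrier G"
  shows "inv\<^bsub>G\<^esub> x = pinv x"
proof (rule group.inv_equality[OF group_G _ x inv_carrier[OF x]])
  show "pinv x \<otimes>\<^bsub>G\<^esub> x = \<one>\<^bsub>G\<^esub>"
    unfolding mult_G one_G by (rule permutes_inv_o(1)[OF carrierD(1)[OF x]])
qed

section \<open>Permutations of cells\<close>

definition cells :: "bool list list list \<Rightarrow> bool" where
  "cells es \<longleftrightarrow> (\<forall>i<length es. es ! i \<in> W) \<and>
     (\<forall>i<length es. \<forall>j<length es. i \<noteq> j \<longrightarrow> disj (es ! i) (es ! j))"

text \<open>Describing elements by index permutations turns calculations in the group into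
  calculations with indices. For disjoint cells the choice is unique, as the proof of
  \<open>cell_perm_pre\<close> shows.\<close>

definition cell_perm :: "bool list list list \<Rightarrow> (nat \<Rightarrow> nat) \<Rightarrow> bool stream list \<Rightarrow> bool stream list" where
  "cell_perm es \<pi> x = (if \<exists>i<length es. x \<in> cone m (es ! i)
     then (SOME y. \<exists>i w. i < length es \<and> w \<in> C \<and> x = es ! i \<frown> w \<and> y = es ! \<pi> i \<frown> w) else x)"

definition off :: "bool list list list \<Rightarrow> bool stream list \<Rightarrow> bool" where
  "off es x \<longleftrightarrow> (\<forall>i<length es. x \<notin> cone m (es ! i))"

lemma cellsD: "cells es \<Longrightarrow> i < length es \<Longrightarrow> es ! i \<in> W"
  by (simp add: cells_def)

lemma cells_disj: "cells es \<Longrightarrow> i < length es \<Longrightarrow> j < length es \<Longrightarrow> i \<noteq> j \<Longrightarrow> disj (es ! i) (es ! j)"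
  by (simp add: cells_def)

lemma cell_perm_pre:
  assumes "cells es" "i < length es"
  shows "replaces (cell_perm es \<pi>) (es ! i) (es ! \<pi> i)"
  unfolding replaces_def
proof
  fix w assume w: "w \<in> C"
  let ?P = "\<lambda>y. \<exists>k w'. k < length es \<and> w' \<in> C \<and> es ! i \<frown> w = es ! k \<frown> w' \<and> y = es ! \<pi> k \<frown> w'"
  have eq: "y = es ! \<pi> i \<frown> w" if Py: "?P y" for y
  proof -
    obtain k w' where k: "k < length es" "w' \<in> C" "es ! i \<frown> w = es ! k \<frown> w'" "y = es ! \<pi> k \<frown> w'"
      using Py by blast
    have "k = i"
    proof (rule ccontr)
      assume "k \<noteq> i"
      then have "disj (es ! i) (es ! k)" using cells_disj[OF assms(1), of i k] assms k by blast
      moreover have "es ! i \<frown> w \<in> cone m (es ! i)" "es ! i \<frown> w \<in> cone m (es ! k)"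
        using w k(2) coneI[of w' "es ! k"] by (auto simp: k(3)[symmetric])
      ultimately show False by (auto simp: disj_def)
    qed
    then show ?thesis using k frown_inj[OF cellsD[OF assms] w k(2)] by simp
  qed
  have "?P (es ! \<pi> i \<frown> w)" using assms(2) w by blast
  then have "(SOME y. ?P y) = es ! \<pi> i \<frown> w" using someI[of ?P] eq by blast
  moreover have "\<exists>k<length es. es ! i \<frown> w \<in> cone m (es ! k)" using assms(2) w by blast
  ultimately show "cell_perm es \<pi> (es ! i \<frown> w) = es ! \<pi> i \<frown> w" by (simp add: cell_perm_def)
qed

lemma cell_perm_off: "off es x \<Longrightarrow> cell_perm es \<pi> x = x"
  unfolding cell_perm_def off_def by (intro if_not_P) blast

lemma on_or_off: obtains (on) i w where "i < length es" "w \<in> C" "x = es ! i \<frown> w" | (off) "off es x"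
  by (auto simp: off_def cone_def)

lemma cell_perm_eqI:
  assumes es: "cells es" and on: "\<And>i. i < length es \<Longrightarrow> replaces f (es ! i) (es ! \<pi> i)"
    and off: "\<And>x. off es x \<Longrightarrow> f x = x"
  shows "f = cell_perm es \<pi>"
proof
  fix x
  show "f x = cell_perm es \<pi> x"
    by (cases x rule: on_or_off[of es])
      (use on off cell_perm_pre[OF es] cell_perm_off in \<open>auto simp: replaces_def\<close>)
qed

lemma cell_perm_id: "cells es \<Longrightarrow> (\<And>i. i < length es \<Longrightarrow> \<pi> i = i) \<Longrightarrow> cell_perm es \<pi> = id"
  by (rule cell_perm_eqI[symmetric]) (auto simp: replaces_def)

lemma cell_perm_comp:
  assumes "cells es" "\<And>i. i < length es \<Longrightarrow> \<pi> i < length es" 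
  shows "cell_perm es \<rho> \<circ> cell_perm es \<pi> = cell_perm es (\<rho> \<circ> \<pi>)"
proof (rule cell_perm_eqI[OF assms(1)])
  fix i assume i: "i < length es"
  show "replaces (cell_perm es \<rho> \<circ> cell_perm es \<pi>) (es ! i) (es ! (\<rho> \<circ> \<pi>) i)"
    using replaces_comp[OF cell_perm_pre[OF assms(1) i, of \<pi>] cell_perm_pre[OF assms(1) assms(2)[OF i], of \<rho>]]
      cellsD[OF assms(1) assms(2)[OF i]] by simp
qed (simp add: cell_perm_off)

lemma cell_perm_funpow:
  assumes "cells es" "\<And>i. i < length es \<Longrightarrow> \<pi> i < length es"
  shows "cell_perm es \<pi> ^^ n = cell_perm es (\<pi> ^^ n)"
proof (induction n)
  case (Suc n)
  have "(\<pi> ^^ n) i < length es" if "i < length es" for i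
    using that assms(2) by (induction n) auto
  then show ?case using Suc cell_perm_comp[OF assms(1), of "\<pi> ^^ n" \<pi>] by (simp add: comp_def)
qed (use cell_perm_id[OF assms(1)] in simp)

lemma cell_perm_bij:
  assumes "cells es" "bij_betw \<pi> {..<length es} {..<length es}"
  shows "cell_perm es \<pi> permutes C" "pinv (cell_perm es \<pi>) = cell_perm es (inv_into {..<length es} \<pi>)"
proof -
  let ?r = "inv_into {..<length es} \<pi>"
  have r: "bij_betw ?r {..<length es} {..<length es}" using assms(2) by (rule bij_betw_inv_into)
  have lt: "\<pi> i < length es" "?r i < length es" if "i < length es" for i
    using that bij_betw_apply[OF assms(2)] bij_betw_apply[OF r] by auto
  have 1: "cell_perm es ?r \<circ> cell_perm es \<pi> = id"
    unfolding cell_perm_comp[OF assms(1), of \<pi> ?r, OF lt(1), simplified]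
    by (rule cell_perm_id[OF assms(1)]) (use assms(2) in \<open>simp add: bij_betw_inv_into_left\<close>)
  have 2: "cell_perm es \<pi> \<circ> cell_perm es ?r = id"
    unfolding cell_perm_comp[OF assms(1), of ?r \<pi>, OF lt(2), simplified]
    by (rule cell_perm_id[OF assms(1)]) (use assms(2) in \<open>simp add: bij_betw_inv_into_right\<close>)
  have "bij (cell_perm es \<pi>)" using 1 2 o_bij by blast
  moreover have "cell_perm es \<pi> x = x" if "x \<notin> C" for x
    using that cone_C cellsD[OF assms(1)] by (intro cell_perm_off) (auto simp: off_def)
  ultimately show "cell_perm es \<pi> permutes C" by (simp add: permutes_def bij_iff)
  show "pinv (cell_perm es \<pi>) = cell_perm es ?r" using 1 2 by (metis inv_unique_comp)
qed

lemma cell_perm_carrier: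
  assumes "cells es" "bij_betw \<pi> {..<length es} {..<length es}"
  shows "cell_perm es \<pi> \<in> carrier G"
proof -
  have p: "cell_perm es \<pi> permutes C" using cell_perm_bij assms by blast
  \<comment> \<open>On a grid at least as deep as all cells, a grid cell either lies inside one cell
    and moves along with it, or misses all of them and is fixed.\<close>
  obtain n where n: "\<And>u l. u \<in> set es \<Longrightarrow> l < m \<Longrightarrow> length (u ! l) \<le> n"
    using finite_lengths by blast
  have "\<exists>v\<in>W. replaces (cell_perm es \<pi>) d v" if d: "d \<in> grid n" for d
  proof (cases "\<exists>i<length es. \<not> disj d (es ! i)")
    case True
    then obtain i where i: "i < length es" "\<not> disj d (es ! i)" by blast
    have "length (es ! i ! l) \<le> length (d ! l)" if "l < m" for l
      using n[of "es ! i" l] i(1) d that by (simp add: grid_def)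
    then obtain y where y: "y \<in> W" "d = es ! i \<odot> y"
      using deep_cone[OF cellsD[OF assms(1) i(1)] grid_W[OF d] _ i(2)] by metis
    have "\<pi> i < length es" using i bij_betw_apply[OF assms(2), of i] by simp
    then have "es ! \<pi> i \<in> W" using cellsD assms by blast
    then show ?thesis
      using y replaces_append[OF cell_perm_pre[OF assms(1) i(1), of \<pi>] cellsD[OF assms(1) i(1)]] by blast
  next
    case False
    have "replaces (cell_perm es \<pi>) d d"
      unfolding replaces_def
    proof
      fix w assume "w \<in> C"
      then have "d \<frown> w \<in> cone m d" by blast
      then have "off es (d \<frown> w)" using False by (auto simp: off_def disj_def)
      then show "cell_perm es \<pi> (d \<frown> w) = d \<frown> w" by (rule cell_perm_off)
    qed
    then show ?thesis using d grid_W by blast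
  qed
  then show ?thesis using carrierI[OF p tiling_grid] by blast
qed

text \<open>Conjugation only relabels the cells and keeps the index permutation. The transport of
  three-cycles rests on this.\<close>

lemma cell_perm_conj:
  assumes "cells es" "cells es'" "length es' = length es" "bij_betw \<pi> {..<length es} {..<length es}"
    and f: "bij f" "\<And>i. i < length es \<Longrightarrow> replaces f (es ! i) (es' ! i)"
  shows "f \<circ> cell_perm es \<pi> \<circ> pinv f = cell_perm es' \<pi>"
proof (rule cell_perm_eqI[OF assms(2)])
  have inj: "inj f" using f(1) by (rule bij_is_inj)
  fix i assume "i < length es'"
  then have i: "i < length es" using assms by simp
  have pi: "\<pi> i < length es" using i bij_betw_apply[OF assms(4), of i] by simp
  have "replaces (pinv f) (es' ! i) (es ! i)" using replaces_inv[OF inj f(2)[OF i]] .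
  then show "replaces (f \<circ> cell_perm es \<pi> \<circ> pinv f) (es' ! i) (es' ! \<pi> i)"
    using cell_perm_pre[OF assms(1) i, of \<pi>] f(2)[OF pi] by (auto simp: replaces_def)
next
  have inj: "inj f" using f(1) by (rule bij_is_inj)
  fix x assume x: "off es' x"
  have "off es (pinv f x)"
    unfolding off_def
  proof (intro allI impI)
    fix i assume i: "i < length es"
    have "x \<notin> f ` cone m (es ! i)"
      unfolding replaces_image[OF f(2)[OF i]] using x i assms(3) by (simp add: off_def)
    moreover have "f (pinv f x) = x" using f(1) by (simp add: bij_is_surj surj_f_inv_f)
    ultimately show "pinv f x \<notin> cone m (es ! i)"
      using imageI[of "pinv f x" "cone m (es ! i)" f] by auto
  qed
  then show "(f \<circ> cell_perm es \<pi> \<circ> pinv f) x = x"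
    using f(1) by (simp add: cell_perm_off bij_is_surj surj_f_inv_f)
qed

section \<open>Swaps of two cones and three-cycles of three cones\<close>

definition rot2 :: "nat \<Rightarrow> nat" where
  "rot2 i = (if i = 0 then 1 else 0)"

definition rot3 :: "nat \<Rightarrow> nat" where
  "rot3 i = (if i = 0 then 1 else if i = 1 then 2 else 0)"

lemma rot2_simps [simp]: "rot2 0 = 1" "rot2 (Suc 0) = 0"
  by (simp_all add: rot2_def)

lemma rot3_simps [simp]: "rot3 0 = 1" "rot3 (Suc 0) = 2" "rot3 2 = 0" "rot3 (Suc (Suc 0)) = 0"
  by (simp_all add: rot3_def)

definition cone_swap :: "bool list list \<Rightarrow> bool list list \<Rightarrow> bool stream list \<Rightarrow> bool stream list" where
  "cone_swap p q = cell_perm [p, q] rot2"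

definition cone_cycle :: "bool list list \<Rightarrow> bool list list \<Rightarrow> bool list list \<Rightarrow> bool stream list \<Rightarrow> bool stream list" where
  "cone_cycle p q r = cell_perm [p, q, r] rot3"

lemma bij_sw: "bij_betw rot2 {..<length [p, q]} {..<length [p, q]}"
  by (auto simp: bij_betw_def inj_on_def lessThan_Suc)

lemma bij_tri: "bij_betw rot3
    {..<length [p, q, r]} {..<length [p, q, r]}"
  by (auto simp: bij_betw_def inj_on_def lessThan_Suc)

lemma cells2: "cells [p, q] \<longleftrightarrow> p \<in> W \<and> q \<in> W \<and> disj p q"
  by (auto simp: cells_def All_less_Suc numeral_2_eq_2 dest: disj_sym)

lemma cells3: "cells [p, q, r] \<longleftrightarrow> p \<in> W \<and> q \<in> W \<and> r \<in> W \<and> disj p q \<and> disj p r \<and> disj q r"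
  by (auto simp: cells_def All_less_Suc numeral_2_eq_2 dest: disj_sym)

lemma cone_swap_pre:
  assumes "p \<in> W" "q \<in> W" "disj p q"
  shows "replaces (cone_swap p q) p q" "replaces (cone_swap p q) q p"
  using cell_perm_pre[of "[p, q]" 0 rot2] cell_perm_pre[of "[p, q]" 1 rot2] assms by (simp_all add: cone_swap_def cells2)

lemma cone_swap_off: "x \<notin> cone m p \<Longrightarrow> x \<notin> cone m q \<Longrightarrow> cone_swap p q x = x"
  unfolding cone_swap_def by (rule cell_perm_off) (auto simp: off_def less_Suc_eq)

lemma disj_off: "disj p r \<Longrightarrow> w \<in> C \<Longrightarrow> r \<frown> w \<notin> cone m p"
  using coneI[of w r] by (auto simp: disj_def)

lemma cone_swap_pre_off: "disj p r \<Longrightarrow> disj q r \<Longrightarrow> replaces (cone_swap p q) r r"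
  by (auto simp: replaces_def cone_swap_off disj_off)

lemma cone_swap_carrier: "p \<in> W \<Longrightarrow> q \<in> W \<Longrightarrow> disj p q \<Longrightarrow> cone_swap p q \<in> carrier G"
  unfolding cone_swap_def by (intro cell_perm_carrier bij_sw) (simp add: cells2)

lemma cone_cycle_pre:
  assumes "cells [p, q, r]"
  shows "replaces (cone_cycle p q r) p q" "replaces (cone_cycle p q r) q r" "replaces (cone_cycle p q r) r p"
  using cell_perm_pre[of "[p, q, r]" 0 rot3] cell_perm_pre[of "[p, q, r]" 1 rot3] cell_perm_pre[of "[p, q, r]" 2 rot3] assms
  by (simp_all add: cone_cycle_def)

lemma cone_cycle_off: "x \<notin> cone m p \<Longrightarrow> x \<notin> cone m q \<Longrightarrow> x \<notin> cone m r \<Longrightarrow> cone_cycle p q r x = x"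
  unfolding cone_cycle_def by (rule cell_perm_off) (auto simp: off_def less_Suc_eq numeral_2_eq_2)

lemma cone_cycle_pre_off: "disj p s \<Longrightarrow> disj q s \<Longrightarrow> disj r s \<Longrightarrow> replaces (cone_cycle p q r) s s"
  by (auto simp: replaces_def cone_cycle_off disj_off)

lemma cone_cycle_carrier: "cells [p, q, r] \<Longrightarrow> cone_cycle p q r \<in> carrier G"
  unfolding cone_cycle_def by (intro cell_perm_carrier bij_tri)

lemma cone_cycle_conj:
  assumes "cells [p, q, r]" "cells [p', q', r']" "bij f" "replaces f p p'" "replaces f q q'" "replaces f r r'"
  shows "f \<circ> cone_cycle p q r \<circ> pinv f = cone_cycle p' q' r'"
  unfolding cone_cycle_def
  by (rule cell_perm_conj) (use assms in \<open>auto simp: bij_betw_def inj_on_def lessThan_Suc less_Suc_eq numeral_2_eq_2\<close>)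

lemma cone_cycle_rotate:
  assumes "cells [p, q, r]"
  shows "cone_cycle q r p = cone_cycle p q r"
  unfolding cone_cycle_def[of p q r]
proof (rule cell_perm_eqI[OF assms])
  have c: "cells [q, r, p]" using assms by (auto simp: cells3 dest: disj_sym)
  fix i assume "i < length [p, q, r]"
  then show "replaces (cone_cycle q r p) ([p, q, r] ! i) ([p, q, r] ! rot3 i)"
    using cone_cycle_pre[OF c] by (auto simp: less_Suc_eq numeral_2_eq_2)
qed (auto simp: off_def less_Suc_eq numeral_2_eq_2 all_conj_distrib intro!: cone_cycle_off)

lemma cone_cycle_inv:
  assumes "cells [p, q, r]"
  shows "cone_cycle p r q = pinv (cone_cycle p q r)"
proof -
  have c: "cells [p, r, q]" using assms by (auto simp: cells3 dest: disj_sym)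
  have b: "bij (cone_cycle p q r)" using cone_cycle_carrier[OF assms] carrierD(1) permutes_bij by blast
  have "pinv (cone_cycle p q r) = cell_perm [p, r, q] rot3"
  proof (rule cell_perm_eqI[OF c])
    fix i assume "i < length [p, r, q]"
    then show "replaces (pinv (cone_cycle p q r)) ([p, r, q] ! i) ([p, r, q] ! rot3 i)"
      using cone_cycle_pre[OF assms] replaces_inv[OF bij_is_inj[OF b]] by (auto simp: less_Suc_eq numeral_2_eq_2)
  next
    fix x assume "off [p, r, q] x"
    then have "cone_cycle p q r x = x"
      by (auto simp: off_def less_Suc_eq numeral_2_eq_2 all_conj_distrib intro!: cone_cycle_off)
    then show "pinv (cone_cycle p q r) x = x" using b by (metis bij_inv_eq_iff)
  qed
  then show ?thesis by (simp add: cone_cycle_def)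
qed

section \<open>Closure of subgroups, in terms of composition of functions\<close>

lemma carrier_bij: "f \<in> carrier G \<Longrightarrow> bij f" 
  using carrierD(1) permutes_bij by blast

lemma subgroup_comp: "subgroup K G \<Longrightarrow> f \<in> K \<Longrightarrow> g \<in> K \<Longrightarrow> f \<circ> g \<in> K"
  using subgroup.m_closed[of K G g f] by simp

lemma subgroup_carrier: "subgroup K G \<Longrightarrow> f \<in> K \<Longrightarrow> f \<in> carrier G"
  using subgroup.subset by blast

lemma subgroup_pinv: "subgroup K G \<Longrightarrow> f \<in> K \<Longrightarrow> pinv f \<in> K"
  using subgroup.m_inv_closed[of K G f] inv_G[OF subgroup_carrier] by simp

lemma subgroup_id: "subgroup K G \<Longrightarrow> id \<in> K"
  using subgroup.one_closed[of K G] by simp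

lemma subgroup_funpow: "subgroup K G \<Longrightarrow> f \<in> K \<Longrightarrow> f ^^ n \<in> K"
  by (induction n) (auto intro: subgroup_comp subgroup_id)

lemma subgroup_conj: "subgroup K G \<Longrightarrow> f \<in> K \<Longrightarrow> g \<in> K \<Longrightarrow> f \<circ> g \<circ> pinv f \<in> K"
  by (intro subgroup_comp subgroup_pinv)

lemma subgroup_conj':
  assumes "subgroup K G" "f \<in> K" "f \<circ> g \<circ> pinv f \<in> K"
  shows "g \<in> K"
proof -
  have b: "bij f" using carrier_bij[OF subgroup_carrier[OF assms(1,2)]] .
  have "pinv f \<circ> (f \<circ> g \<circ> pinv f) \<circ> f \<in> K"
    using subgroup_comp[OF assms(1) subgroup_comp[OF assms(1) subgroup_pinv[OF assms(1,2)] assms(3)] assms(2)] .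
  also have "pinv f \<circ> (f \<circ> g \<circ> pinv f) \<circ> f = (pinv f \<circ> f) \<circ> g \<circ> (pinv f \<circ> f)"
    by (simp only: comp_assoc)
  also have "\<dots> = g" using b by (simp add: bij_is_inj)
  finally show "g \<in> K" .
qed

section \<open>Swaps generate the group\<close>

abbreviation ext :: "bool list list \<Rightarrow> nat \<Rightarrow> bool \<Rightarrow> bool list list" where
  "ext u l b \<equiv> u \<odot> letter l b"

lemma replaces_id: "replaces id u u" by (simp add: replaces_def)

lemma replaces_comp3: "replaces f u v \<Longrightarrow> replaces g v w \<Longrightarrow> replaces h w z \<Longrightarrow> v \<in> W \<Longrightarrow> w \<in> W \<Longrightarrow> replaces (h \<circ> g \<circ> f) u z"
  by (auto simp: replaces_def)

lemma disj_ext: "u \<in> W \<Longrightarrow> l < m \<Longrightarrow> disj (ext u l False) (ext u l True)" 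
  "u \<in> W \<Longrightarrow> l < m \<Longrightarrow> disj (ext u l True) (ext u l False)"
  by (simp_all add: disj_append_letter)

text \<open>
  A baker map on the cone of \<open>u\<close> moves a digit from coordinate \<open>i\<close> to coordinate \<open>j\<close>. The map below
  is the product of the baker map on \<open>u\<close> and the inverse of the baker map on \<open>w\<close>.
\<close>

definition baker2 :: "nat \<Rightarrow> nat \<Rightarrow> bool list list \<Rightarrow> bool list list \<Rightarrow> bool stream list \<Rightarrow> bool stream list" where
  "baker2 i j u w = cone_swap (ext w i True) (ext u j True) \<circ> cone_swap (ext w i False) (ext u j False) \<circ> cone_swap u w"

text \<open>The first swap carries the halves of \<open>u\<close> in direction \<open>i\<close> to
  halves of \<open>w\<close>, and the other two swaps bring them back as halves in direction
  \<open>j\<close>. Each half is affected only by the later swap with its own digit, hence the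
  conditionals in the proof.\<close>

lemma baker2_pre:
  assumes W: "u \<in> W" "w \<in> W" and d: "disj u w" and ij: "i < m" "j < m"
  shows "replaces (baker2 i j u w) (ext u i b) (ext u j b)" "replaces (baker2 i j u w) (ext w j b) (ext w i b)"
proof -
  have d': "disj w u" using d by (rule disj_sym)
  have dd: "disj (ext u k b) (ext w l c)" "disj (ext w k b) (ext u l c)" for k l b c
    using disj_extend[OF d] disj_extend[OF d'] W by simp_all
  have s: "replaces (cone_swap u w) (ext u i b) (ext w i b)" "replaces (cone_swap u w) (ext w j b) (ext u j b)"
    using cone_swap_pre[OF W d] replaces_append W by simp_all
  have f: "replaces (cone_swap (ext w i False) (ext u j False)) (ext w i b) (if b then ext w i b else ext u j b)"
    "replaces (cone_swap (ext w i False) (ext u j False)) (ext u j b) (if b then ext u j b else ext w i b)"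
    using cone_swap_pre[of "ext w i False" "ext u j False"] W dd
    by (auto intro!: cone_swap_pre_off simp: disj_ext ij)
  have t: "replaces (cone_swap (ext w i True) (ext u j True)) (if b then ext w i b else ext u j b) (ext u j b)"
    "replaces (cone_swap (ext w i True) (ext u j True)) (if b then ext u j b else ext w i b) (ext w i b)"
    using cone_swap_pre[of "ext w i True" "ext u j True"] W dd
    by (auto intro!: cone_swap_pre_off simp: disj_ext ij)
  show "replaces (baker2 i j u w) (ext u i b) (ext u j b)"
    unfolding baker2_def by (rule replaces_comp3[OF s(1) f(1) t(1)]) (use W in auto)
  show "replaces (baker2 i j u w) (ext w j b) (ext w i b)"
    unfolding baker2_def by (rule replaces_comp3[OF s(2) f(2) t(2)]) (use W in auto)
qed

lemma baker2_off:
  assumes W: "u \<in> W" "w \<in> W" and x: "x \<notin> cone m u" "x \<notin> cone m w"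
  shows "baker2 i j u w x = x"
proof -
  have "x \<notin> cone m (ext u l b)" "x \<notin> cone m (ext w l b)" for l b
    using x cone_append_sub W letter_W by blast+
  then show ?thesis using x by (simp add: baker2_def cone_swap_off)
qed

text \<open>The index counts the cells. Starting from two halves instead of the whole space ensures
  that every cell has another one disjoint from it, which \<open>baker_in\<close> requires as room
  to work in.\<close>

inductive guillotine :: "nat \<Rightarrow> bool list list set \<Rightarrow> bool" where
  base: "guillotine 2 {letter 0 False, letter 0 True}"
| split: "guillotine k P \<Longrightarrow> u \<in> P \<Longrightarrow> l < m \<Longrightarrow>
    guillotine (Suc k) (insert (ext u l False) (insert (ext u l True) (P - {u})))"

lemma tiling_split:
  assumes P: "tiling P" and u: "u \<in> P" and l: "l < m"
  defines "Q \<equiv> insert (ext u l False) (insert (ext u l True) (P - {u}))"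
  shows "tiling Q" "card Q = Suc (card P)" "ext u l b \<notin> P - {u}"
proof -
  have W: "P \<subseteq> W" "u \<in> W" using P u by (auto simp: tiling_def)
  have d: "disj (ext u l b) v" "disj v (ext u l b)" if "v \<in> P - {u}" for v b
  proof -
    have "disj u v" using P u that by (auto simp: tiling_def)
    then show "disj (ext u l b) v" using disj_extend_l W letter_W by blast
    then show "disj v (ext u l b)" by (rule disj_sym)
  qed
  then show n: "ext u l b \<notin> P - {u}" for b using disj_irrefl by blast
  have ne: "ext u l False \<noteq> ext u l True" using disj_ext[OF W(2) l] disj_irrefl by metis
  have fin: "finite P" using P by (simp add: tiling_def)
  then show "card Q = Suc (card P)"
    using n ne card_Suc_Diff1[OF fin u] by (simp add: Q_def del: card_Diff_insert)
  show "tiling Q"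
    unfolding tiling_def
  proof (intro conjI ballI impI)
    show "finite Q" using fin by (simp add: Q_def)
    show "Q \<subseteq> W" using W by (auto simp: Q_def)
    fix a b assume "a \<in> Q" "b \<in> Q" "a \<noteq> b"
    then show "disj a b"
      using d disj_ext[OF W(2) l] P unfolding Q_def tiling_def by auto
  next
    show "C \<subseteq> (\<Union>v\<in>Q. cone m v)"
    proof
      fix x assume "x \<in> C"
      then obtain v where v: "v \<in> P" "x \<in> cone m v" using P by (auto simp: tiling_def)
      show "x \<in> (\<Union>v\<in>Q. cone m v)"
      proof (cases "v = u")
        case True
        then show ?thesis using v cone_split[OF W(2) l] by (auto simp: Q_def)
      next
        case False
        then show ?thesis using v by (auto simp: Q_def)
      qed
    qed
  qed
qed

lemma tiling_halves: "0 < m \<Longrightarrow> tiling {letter 0 False, letter 0 True}"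
  using cone_split[OF eps_W, of 0] disj_letter[of 0 False True] disj_letter[of 0 True False]
  by (auto simp: tiling_def)

lemma guillotine_tiling:
  assumes "0 < m" "guillotine k P"
  shows "tiling P \<and> card P = k \<and> 2 \<le> k"
  using assms(2)
proof induction
  case base
  have "letter 0 False \<noteq> letter 0 True" using disj_letter[of 0 False True] disj_irrefl assms(1) by metis
  then show ?case using tiling_halves[OF assms(1)] by simp
next
  case (split k P u l)
  then show ?case using tiling_split[of P u l] by simp
qed

text \<open>A cell of \<open>Q\<close> meets some cell of \<open>P\<close> because \<open>P\<close>
  covers; both belong to \<open>Q\<close>, so they coincide.\<close>

lemma tiling_subset:
  assumes "tiling P" "tiling Q" "P \<subseteq> Q"
  shows "P = Q"
proof
  show "Q \<subseteq> P"
  proof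
    fix q assume q: "q \<in> Q"
    obtain x where x: "x \<in> cone m q" using cone_ne by blast
    then have "x \<in> C" using q assms(2) cone_C by (auto simp: tiling_def)
    then obtain p where p: "p \<in> P" "x \<in> cone m p" using assms(1) by (auto simp: tiling_def)
    then have "\<not> disj p q" using x by (auto simp: disj_def)
    then show "q \<in> P" using p q assms(2,3) by (auto simp: tiling_def)
  qed
qed (use assms in auto)

text \<open>The result of \<open>s l\<close> halvings in each coordinate \<open>l\<close>, described
  independently of their order.\<close>

definition refine :: "bool list list \<Rightarrow> (nat \<Rightarrow> nat) \<Rightarrow> bool list list set" where
  "refine u s = {u \<odot> x | x. x \<in> W \<and> (\<forall>l<m. length (x ! l) = s l)}"

lemma refine_zero:
  assumes "u \<in> W" "\<And>l. l < m \<Longrightarrow> s l = 0"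
  shows "refine u s = {u}"
proof -
  have "x = eps" if "x \<in> W" "\<forall>l<m. length (x ! l) = s l" for x
    using that assms(2) by (intro W_eqI) auto
  moreover have "\<forall>l<m. length (eps ! l) = s l" using assms(2) by simp
  ultimately have "{x \<in> W. \<forall>l<m. length (x ! l) = s l} = {eps}" by blast
  moreover have "refine u s = (\<lambda>x. u \<odot> x) ` {x \<in> W. \<forall>l<m. length (x ! l) = s l}"
    by (auto simp: refine_def)
  ultimately show ?thesis using assms(1) by simp
qed

lemma refine_step:
  assumes u: "u \<in> W" and l: "l < m" "0 < s l"
  shows "refine u s = refine (ext u l False) (s(l := s l - 1)) \<union> refine (ext u l True) (s(l := s l - 1))"
    (is "_ = ?R False \<union> ?R True")
proof -
  have "y \<in> ?R False \<union> ?R True" if y: "y \<in> refine u s" for y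
  proof -
    obtain x where x: "y = u \<odot> x" "x \<in> W" "\<forall>k<m. length (x ! k) = s k" using y by (auto simp: refine_def)
    define z where "z = x[l := tl (x ! l)]"
    have z: "z \<in> W" using x by (simp add: z_def W_iff)
    have zl: "z ! k = (if k = l then tl (x ! l) else x ! k)" if "k < m" for k
      using that x l by (simp add: z_def W_iff)
    have "x ! l \<noteq> []" using x l by auto
    then have "x = letter l (hd (x ! l)) \<odot> z"
      by (intro W_eqI) (use x z zl in \<open>auto simp: nth_tuple_append nth_letter\<close>)
    then have "y = ext u l (hd (x ! l)) \<odot> z" using x z u by (simp add: tuple_append_assoc)
    moreover have "\<forall>k<m. length (z ! k) = (s(l := s l - 1)) k" using x zl by auto
    ultimately have "y \<in> ?R (hd (x ! l))" using z by (auto simp: refine_def)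
    then show ?thesis by (cases "hd (x ! l)") auto
  qed
  moreover have "y \<in> refine u s" if "y \<in> ?R b" for y b
  proof -
    obtain z where z: "y = ext u l b \<odot> z" "z \<in> W" "\<forall>k<m. length (z ! k) = (s(l := s l - 1)) k"
      using \<open>y \<in> ?R b\<close> by (auto simp: refine_def)
    then have "y = u \<odot> (letter l b \<odot> z)" "\<forall>k<m. length ((letter l b \<odot> z) ! k) = s k"
      using u l by (auto simp: tuple_append_assoc nth_tuple_append nth_letter)
    then show ?thesis using z by (auto simp: refine_def)
  qed
  ultimately show ?thesis by blast
qed

lemma refine_disj:
  assumes "disj u v" "u \<in> W" "v \<in> W" "x \<in> refine u s"
  shows "disj x v"
  using assms disj_extend_l by (auto simp: refine_def)

text \<open>Induction on the number of halvings still to be made: cut \<open>u\<close> once in a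
  coordinate that needs it, then refine the two halves one after the other.\<close>

lemma guillotine_refine:
  assumes m: "0 < m"
  shows "guillotine k P \<Longrightarrow> u \<in> P \<Longrightarrow> \<exists>k'. guillotine k' (P - {u} \<union> refine u s)"
proof (induction "\<Sum>l<m. s l" arbitrary: s k P u)
  case 0
  have "u \<in> W" using 0 guillotine_tiling[OF m] unfolding tiling_def by blast
  then have "refine u s = {u}" using 0 by (intro refine_zero) auto
  then have "P - {u} \<union> refine u s = P" using 0(3) by auto
  then show ?case using 0(2) by (intro exI[of _ k]) simp
next
  case (Suc n)
  obtain l where l: "l < m" "0 < s l"
  proof -
    have "\<exists>l\<in>{..<m}. s l \<noteq> 0" using Suc(2) by (metis nat.distinct(1) sum.neutral)
    then show ?thesis using that by auto
  qed
  let ?s = "s(l := s l - 1)" and ?u = "ext u l"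
  have "sum s {..<m} = s l + sum s ({..<m} - {l})" using l by (simp add: sum.remove)
  moreover have "sum ?s {..<m} = ?s l + sum ?s ({..<m} - {l})" using l by (subst sum.remove[of _ l]) auto
  moreover have "sum ?s ({..<m} - {l}) = sum s ({..<m} - {l})" by (rule sum.cong) auto
  ultimately have n: "n = sum ?s {..<m}" using Suc(2) l by simp
  have P: "tiling P" using Suc guillotine_tiling[OF m] by blast
  then have uW: "u \<in> W" using Suc by (auto simp: tiling_def)
  note uF = tiling_split(3)[OF P Suc.prems(2) l(1)]
  have ne: "?u False \<noteq> ?u True" using disj_ext[OF uW l(1)] disj_irrefl by metis
  let ?Q = "insert (?u False) (insert (?u True) (P - {u}))"
  have "guillotine (Suc k) ?Q" using Suc l by (intro guillotine.split)
  then obtain k1 where "guillotine k1 (?Q - {?u False} \<union> refine (?u False) ?s)"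
    using Suc(1)[OF n] by blast
  moreover have Q1: "?Q - {?u False} = insert (?u True) (P - {u})" using ne uF by blast
  ultimately obtain k2 where
    k2: "guillotine k2 ((insert (?u True) (P - {u}) \<union> refine (?u False) ?s) - {?u True} \<union> refine (?u True) ?s)"
    using Suc(1)[OF n, of k1 "insert (?u True) (P - {u}) \<union> refine (?u False) ?s" "?u True"] by auto
  \<comment> \<open>Removing the second half must not take away a piece of the first half, which is
    already refined.\<close>
  have "?u True \<notin> refine (?u False) ?s"
    using refine_disj[OF disj_ext(1)[OF uW l(1)]] uW letter_W append_W disj_irrefl by blast
  then have "(insert (?u True) (P - {u}) \<union> refine (?u False) ?s) - {?u True} \<union> refine (?u True) ?s
      = P - {u} \<union> refine u s"
    unfolding refine_step[of u l s, OF uW l] using uF by blast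
  then show ?case using k2 by auto
qed

lemma guillotine_refine_all:
  assumes m: "0 < m" and P: "guillotine k P"
  shows "\<exists>k'. guillotine k' (\<Union>d\<in>P. refine d (s d))"
proof -
  have t: "tiling P" using guillotine_tiling[OF m P] by blast
  have "\<exists>k'. guillotine k' (P - S \<union> (\<Union>d\<in>S. refine d (s d)))" if "finite S" "S \<subseteq> P" for S
    using that
  proof (induction S)
    case empty
    then show ?case using P by auto
  next
    case (insert a S)
    then obtain k' where k': "guillotine k' (P - S \<union> (\<Union>d\<in>S. refine d (s d)))" by auto
    have "a \<in> P - S \<union> (\<Union>d\<in>S. refine d (s d))" using insert by blast
    from guillotine_refine[OF m k' this] obtain k'' where
      k'': "guillotine k'' (P - S \<union> (\<Union>d\<in>S. refine d (s d)) - {a} \<union> refine a (s a))" by blast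
    \<comment> \<open>A member not yet refined is no piece of another member, so removing
      \<open>a\<close> leaves the earlier pieces intact.\<close>
    have "a \<notin> refine d (s d)" if "d \<in> S" for d
    proof
      assume a: "a \<in> refine d (s d)"
      have "d \<in> P" "a \<in> P" "d \<noteq> a" using that insert(2,4) by auto
      then have "disj d a" "d \<in> W" "a \<in> W" using t by (auto simp: tiling_def)
      then show False using refine_disj[OF _ _ _ a] disj_irrefl by blast
    qed
    then have "P - S \<union> (\<Union>d\<in>S. refine d (s d)) - {a} \<union> refine a (s a) =
        P - insert a S \<union> (\<Union>d\<in>insert a S. refine d (s d))" by blast
    then show ?case using k'' by auto
  qed
  from this[of P] show ?thesis using t by (auto simp: tiling_def)
qed

lemma guillotine_grid:
  assumes m: "0 < m" and n: "0 < n"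
  shows "\<exists>k. guillotine k (grid n)"
proof -
  \<comment> \<open>The initial two halves have already used one letter in coordinate 0.\<close>
  let ?s = "(\<lambda>_. n)(0 := n - 1)"
  have "grid n = refine eps (\<lambda>_. n)"
    unfolding refine_def grid_def by (metis (no_types, lifting) eps_append)
  also have "\<dots> = refine (letter 0 False) ?s \<union> refine (letter 0 True) ?s"
    using refine_step[OF eps_W m, of "\<lambda>_. n"] n by simp
  finally show ?thesis using guillotine_refine_all[OF m guillotine.base, of "\<lambda>_. ?s"] by auto
qed

end

section \<open>A subgroup containing all swaps is the whole group\<close>

locale cantor_subgroup = cantor +
  fixes K
  assumes m_pos: "0 < m"
    and K: "subgroup K (brin_thompson m)"

locale swap_subgroup = cantor_subgroup +
  assumes sw_K: "\<And>p q. p \<in> W \<Longrightarrow> q \<in> W \<Longrightarrow> disj p q \<Longrightarrow> cone_swap p q \<in> K"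
begin

lemma baker2_K:
  assumes W: "u \<in> W" "w \<in> W" and d: "disj u w" and ij: "i < m" "j < m"
  shows "baker2 i j u w \<in> K"
  unfolding baker2_def using disj_extend[OF disj_sym[OF d]] W d
  by (intro subgroup_comp[OF K] sw_K) auto

text \<open>
  Modulo the subgroup, the baker maps on disjoint cones agree, and the baker map on \<open>u\<close> is the
  product of the baker maps on its two halves in coordinate \<open>i\<close>; hence they are trivial.
\<close>

lemma baker_half_in:
  assumes W: "u \<in> W" "w \<in> W" and d: "disj u w" and ij: "i < m" "j < m" "i \<noteq> j"
  defines "v \<equiv> ext u i True"
  shows "\<exists>f\<in>K. (\<forall>b. replaces f (ext v i b) (ext v j b)) \<and> (\<forall>x. x \<notin> cone m v \<longrightarrow> f x = x)"
proof -
  define v' where "v' = ext u i False"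
  have vW: "v \<in> W" "v' \<in> W" using W by (auto simp: v_def v'_def)
  have vd: "disj v' w" "disj v w" "disj v' v" using disj_extend_l[OF d] W disj_ext[OF W(1) ij(1)]
    by (auto simp: v_def v'_def)
  define s where "s = baker2 i j u w"
  define p where "p = cone_swap (ext v j False) (ext v' j True)"
  define r where "r = baker2 i j v' w"
  have dq: "disj (ext v j False) (ext v' j True)" 
    using disj_extend[OF disj_sym[OF vd(3)]] vW by auto
  have K3: "s \<in> K" "p \<in> K" "r \<in> K"
    unfolding s_def p_def r_def using baker2_K sw_K W d ij vW vd dq by auto
  have rinj: "inj r" using K3 subgroup_carrier[OF K] carrier_bij bij_is_inj by blast
  \<comment> \<open>The map \<open>s\<close> sends the four quarters of \<open>u\<close> in
    direction \<open>i\<close> to the quarters cut in directions \<open>i\<close> and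
    \<open>j\<close>, two of them in the wrong half. After \<open>p\<close> exchanges these two, the
    baker map acts on \<open>v\<close> and on \<open>v'\<close> separately. The inverse of
    \<open>r\<close> undoes it on \<open>v'\<close> and also cancels the effect of \<open>s\<close>
    on \<open>w\<close>.\<close>
  define f where "f = pinv r \<circ> p \<circ> s"
  have comm: "ext (ext u i b) j c = ext (ext u j c) i b" for b c
    using append_letter_commute[OF ij(3) W(1)] .
  have s: "replaces s (ext (ext u i b) l c) (ext (ext u j b) l c)" for b l c
    unfolding s_def using replaces_append[OF baker2_pre(1)[OF W d ij(1,2)]] W by blast
  have s1: "replaces s (ext v i b) (ext (ext u i b) j True)" for b
    using s[of True i b] by (simp add: v_def comm)
  have s0: "replaces s (ext v' i b) (ext (ext u i b) j False)" for b
    using s[of False i b] by (simp add: v'_def comm)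
  have p: "replaces p (ext v j False) (ext v' j True)" "replaces p (ext v' j True) (ext v j False)"
    unfolding p_def using cone_swap_pre[OF _ _ dq] vW by auto
  have pv: "replaces p (ext v j True) (ext v j True)" "replaces p (ext v' j False) (ext v' j False)"
    unfolding p_def using vW ij vd disj_ext disj_extend disj_sym by (auto intro!: cone_swap_pre_off)
  have r: "replaces (pinv r) (ext v' j b) (ext v' i b)" "replaces (pinv r) (ext w i b) (ext w j b)" for b
    using replaces_inv[OF rinj] baker2_pre[OF vW(2) W(2) vd(1) ij(1,2)] unfolding r_def by blast+
  have roff: "pinv r x = x" if "x \<notin> cone m v'" "x \<notin> cone m w" for x
    using baker2_off[OF vW(2) W(2) that] rinj unfolding r_def by (metis inv_f_f)
  have rv: "replaces (pinv r) (ext v j b) (ext v j b)" for b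
    unfolding replaces_def
  proof (intro ballI roff)
    fix x assume "x \<in> C"
    then have "ext v j b \<frown> x \<in> cone m v" using vW coneI[of "letter j b \<frown> x" v] by auto
    then show "ext v j b \<frown> x \<notin> cone m v'" "ext v j b \<frown> x \<notin> cone m w"
      using vd by (auto simp: disj_def)
  qed
  have "replaces f (ext v i b) (ext v j b)" for b
  proof (cases b)
    case True
    then show ?thesis unfolding f_def
      using replaces_comp3[OF s1[of True] _ rv[of True], of p] pv(1) vW by (auto simp: v_def)
  next
    case False
    then show ?thesis unfolding f_def
      using replaces_comp3[OF s1[of False] _ rv[of False], of p] p(2) vW W by (auto simp: v'_def)
  qed
  moreover have "f x = x" if x: "x \<notin> cone m v" for x
  proof -
    have fix': "replaces f (ext v' i b) (ext v' i b)" for b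
    proof (cases b)
      case True
      then show ?thesis unfolding f_def
        using replaces_comp3[OF s0[of True] _ r(1)[of True], of p] p(1) vW W by (auto simp: v_def)
    next
      case False
      then show ?thesis unfolding f_def
        using replaces_comp3[OF s0[of False] _ r(1)[of False], of p] pv(2) vW W by (auto simp: v'_def)
    qed
    have dw: "disj (ext v j False) (ext w i b)" "disj (ext v' j True) (ext w i b)" for b
      using disj_extend vd vW W by auto
    have fixw: "replaces f (ext w j b) (ext w j b)" for b
      unfolding f_def
    proof (rule replaces_comp3[OF _ _ r(2)])
      show "replaces s (ext w j b) (ext w i b)" unfolding s_def by (rule baker2_pre(2)[OF W d ij(1,2)])
      show "replaces p (ext w i b) (ext w i b)" unfolding p_def by (rule cone_swap_pre_off[OF dw])
    qed (use W in auto)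
    consider "x \<in> cone m v'" | "x \<in> cone m w" | "x \<notin> cone m u" "x \<notin> cone m w"
      using x cone_split[OF W(1) ij(1)] by (auto simp: v_def v'_def)
    then show ?thesis
    proof cases
      case 1
      then obtain b where "x \<in> cone m (ext v' i b)" using cone_split[OF vW(2) ij(1)] by auto
      then show ?thesis using fix'[of b] by (auto simp: replaces_def cone_def)
    next
      case 2
      then obtain b where "x \<in> cone m (ext w j b)" using cone_split[OF W(2) ij(2)] by auto
      then show ?thesis using fixw[of b] by (auto simp: replaces_def cone_def)
    next
      case 3
      have nv: "x \<notin> cone m v" "x \<notin> cone m v'"
        using 3 cone_split[OF W(1) ij(1)] by (auto simp: v_def v'_def)
      have "x \<notin> cone m (ext v j False)" "x \<notin> cone m (ext v' j True)"
        using nv cone_append_sub[OF vW(1)] cone_append_sub[OF vW(2)] letter_W by blast+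
      then have "p x = x" by (simp add: p_def cone_swap_off)
      moreover have "s x = x" unfolding s_def by (rule baker2_off[OF W 3])
      ultimately show ?thesis using roff[OF nv(2) 3(2)] by (simp add: f_def)
    qed
  qed
  moreover have "f \<in> K" unfolding f_def using K3 by (intro subgroup_comp[OF K] subgroup_pinv[OF K])
  ultimately show ?thesis by blast
qed

text \<open>The disjoint cone \<open>v\<close> contains a half \<open>q\<close> of the kind treated
  in \<open>baker_half_in\<close>; conjugating by the swap of \<open>r\<close> and \<open>q\<close>
  moves that baker map to \<open>r\<close>.\<close>

lemma baker_in:
  assumes W: "r \<in> W" "v \<in> W" and d: "disj r v" and ij: "i < m" "j < m" "i \<noteq> j"
  shows "\<exists>f\<in>K. (\<forall>b. replaces f (ext r i b) (ext r j b)) \<and> (\<forall>x. x \<notin> cone m r \<longrightarrow> f x = x)"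
proof -
  let ?u = "ext v 0 False" and ?w = "ext v 0 True"
  have uw: "disj ?u ?w" using disj_ext W m_pos by blast
  define q where "q = ext ?u i True"
  have qW: "q \<in> W" using W by (auto simp: q_def)
  have dr: "disj r q" unfolding q_def using d W by (intro disj_extend_r append_W letter_W)
  obtain f where f: "f \<in> K" "\<And>b. replaces f (ext q i b) (ext q j b)" "\<And>x. x \<notin> cone m q \<Longrightarrow> f x = x"
    using baker_half_in[of ?u ?w i j] uw W ij unfolding q_def by blast
  define c where "c = cone_swap r q"
  have c: "c \<in> K" "replaces c r q" "replaces c q r"
    unfolding c_def using sw_K cone_swap_pre dr W qW by auto
  have cinj: "inj c" using c subgroup_carrier[OF K] carrier_bij bij_is_inj by blast
  have cc: "c (c x) = x" for x
  proof -
    consider w where "w \<in> C" "x = r \<frown> w" | w where "w \<in> C" "x = q \<frown> w" | "x \<notin> cone m r" "x \<notin> cone m q"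
      by (auto simp: cone_def)
    then show ?thesis using c(2,3) by cases (auto simp: replaces_def c_def cone_swap_off)
  qed
  define h where "h = c \<circ> f \<circ> c"
  have "replaces h (ext r i b) (ext r j b)" for b
    unfolding h_def using replaces_comp3[OF replaces_append[OF c(2)] f(2)[of b] replaces_append[OF c(3)]] W qW by auto
  moreover have "h x = x" if x: "x \<notin> cone m r" for x
  proof -
    have "c x \<notin> cone m q"
    proof
      assume "c x \<in> cone m q"
      then have "c (c x) \<in> c ` cone m q" by (rule imageI)
      then show False using x cc replaces_image[OF c(3)] by simp
    qed
    then show ?thesis by (simp add: h_def f(3) cc)
  qed
  moreover have "h \<in> K" unfolding h_def using c f by (intro subgroup_comp[OF K])
  ultimately show ?thesis by blast
qed

text \<open>Any two cells of \<open>Q\<close> can be swapped within \<open>K\<close>, so the images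
  are corrected one at a time. Correcting \<open>a\<close> exchanges its image with the desired one;
  the images already correct differ from both and stay fixed.\<close>

lemma rearrange:
  assumes P: "tiling P" and Q: "tiling Q" and tau: "bij_betw \<tau> P Q"
    and t: "t \<in> K" "\<And>u. u \<in> P \<Longrightarrow> \<exists>v\<in>Q. replaces t u v"
  shows "\<exists>t'\<in>K. \<forall>u\<in>P. replaces t' u (\<tau> u)"
proof -
  have W: "P \<subseteq> W" "Q \<subseteq> W" using P Q by (auto simp: tiling_def)
  have "\<exists>f\<in>K. (\<forall>u\<in>P. \<exists>v\<in>Q. replaces f u v) \<and> (\<forall>u\<in>S. replaces f u (\<tau> u))" if "finite S" "S \<subseteq> P" for S
    using that
  proof (induction S)
    case empty
    then show ?case using t by auto
  next
    case (insert a S)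
    then obtain f where f: "f \<in> K" "\<And>u. u \<in> P \<Longrightarrow> \<exists>v\<in>Q. replaces f u v" "\<And>u. u \<in> S \<Longrightarrow> replaces f u (\<tau> u)"
      by auto
    have a: "a \<in> P" using insert by auto
    then obtain v where v: "v \<in> Q" "replaces f a v" using f by blast
    have w: "\<tau> a \<in> Q" using bij_betw_apply[OF tau a] .
    show ?case
    proof (cases "v = \<tau> a")
      case True
      then show ?thesis using f v by (intro bexI[of _ f]) auto
    next
      case False
      then have d: "disj v (\<tau> a)" using v w Q by (auto simp: tiling_def)
      have vW: "v \<in> W" "\<tau> a \<in> W" using v w W by auto
      define g where "g = cone_swap v (\<tau> a)"
      have g: "g \<in> K" "replaces g v (\<tau> a)" "replaces g (\<tau> a) v" unfolding g_def using sw_K cone_swap_pre vW d by auto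
      have goff: "replaces g z z" if "z \<in> Q" "z \<noteq> v" "z \<noteq> \<tau> a" for z
        unfolding g_def by (rule cone_swap_pre_off) (use that v w Q in \<open>auto simp: tiling_def\<close>)
      have finj: "inj f" using f(1) subgroup_carrier[OF K] carrier_bij bij_is_inj by blast
      have 1: "\<exists>z\<in>Q. replaces (g \<circ> f) u z" if u: "u \<in> P" for u
      proof -
        obtain z where z: "z \<in> Q" "replaces f u z" using f(2)[OF u] by blast
        obtain z' where "z' \<in> Q" "replaces g z z'"
          using g(2,3) goff[OF z(1)] z(1) v(1) w by (cases "z = v"; cases "z = \<tau> a") auto
        then show ?thesis using replaces_comp[OF z(2)] z(1) W by blast
      qed
      have 2: "replaces (g \<circ> f) u (\<tau> u)" if u: "u \<in> insert a S" for u
      proof (cases "u = a")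
        case True
        then show ?thesis using replaces_comp[OF v(2) g(2)] vW by simp
      next
        case False
        then have uS: "u \<in> S" "u \<in> P" using u insert by auto
        have "disj u a" using False uS a P by (auto simp: tiling_def)
        then have "disj (\<tau> u) v" using replaces_disj[OF finj f(3)[OF uS(1)] v(2)] by simp
        then have "\<tau> u \<noteq> v" using disj_irrefl by blast
        moreover have "\<tau> u \<noteq> \<tau> a" using False uS a bij_betw_imp_inj_on[OF tau] by (simp add: inj_on_eq_iff)
        moreover have "\<tau> u \<in> Q" using bij_betw_apply[OF tau uS(2)] .
        ultimately show ?thesis using replaces_comp[OF f(3)[OF uS(1)] goff] W by blast
      qed
      have "g \<circ> f \<in> K" using subgroup_comp[OF K g(1) f(1)] .
      then show ?thesis using 1 2 by blast
    qed
  qed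
  from this[of P] show ?thesis using P by (auto simp: tiling_def)
qed

text \<open>The image of \<open>P\<close> is a tiling contained in \<open>Q\<close>, hence equal to
  \<open>Q\<close> by \<open>tiling_subset\<close>.\<close>

lemma carries_bij:
  assumes "t \<in> K" "tiling P" "tiling Q" "\<And>u. u \<in> P \<Longrightarrow> \<sigma> u \<in> Q \<and> replaces t u (\<sigma> u)"
  shows "bij_betw \<sigma> P Q"
proof -
  have p: "t permutes C" using assms(1) subgroup_carrier[OF K] carrierD(1) by blast
  have s: "\<sigma> u \<in> W \<and> replaces t u (\<sigma> u)" if "u \<in> P" for u
    using that assms by (auto simp: tiling_def)
  note ti = tiling_image[OF p assms(2) s]
  have "\<sigma> ` P = Q" by (rule tiling_subset[OF ti(2) assms(3)]) (use assms(4) in auto)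
  then show ?thesis using ti(1) by (simp add: bij_betw_def)
qed

text \<open>Induction on the halvings. The last cuts of the two divisions concern cells
  \<open>u\<close> and \<open>v\<close>: the inductive map is rearranged to carry \<open>u\<close>
  to \<open>v\<close>, and a baker map on \<open>v\<close> reconciles the two directions of
  cutting.\<close>

lemma guillotine_equiv:
  "guillotine k P \<Longrightarrow> guillotine k Q \<Longrightarrow> \<exists>t\<in>K. \<forall>u\<in>P. \<exists>v\<in>Q. replaces t u v"
proof (induction arbitrary: Q rule: guillotine.induct)
  case base
  from base show ?case
  proof (cases rule: guillotine.cases)
    case base
    then show ?thesis using subgroup_id[OF K] replaces_id by blast
  next
    case (split k P u l)
    \<comment> \<open>Two cells cannot be \<open>k + 1\<close> cells, because \<open>k\<close> is at
      least 2.\<close>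
    then show ?thesis using guillotine_tiling[OF m_pos] by fastforce
  qed
next
  case (split k P u l)
  note P = split.hyps
  from split.prems show ?case
  proof (cases rule: guillotine.cases)
    case base
    then show ?thesis using guillotine_tiling[OF m_pos P(1)] by simp
  next
    case (split Q0 v l')
    note Q = split(2-4)
    obtain t where t: "t \<in> K" "\<And>x. x \<in> P \<Longrightarrow> \<exists>y\<in>Q0. replaces t x y"
      using \<open>\<And>Q. guillotine k Q \<Longrightarrow> \<exists>t\<in>K. \<forall>u\<in>P. \<exists>v\<in>Q. replaces t u v\<close>[OF Q(1)] by blast
    obtain \<sigma> where s: "\<And>x. x \<in> P \<Longrightarrow> \<sigma> x \<in> Q0 \<and> replaces t x (\<sigma> x)" using t(2) by metis
    have tP: "tiling P" "tiling Q0" "card Q0 = k" "2 \<le> k"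
      using guillotine_tiling[OF m_pos] P(1) Q(1) by blast+
    have sb: "bij_betw \<sigma> P Q0" by (rule carries_bij[OF t(1) tP(1,2) s])
    \<comment> \<open>The bijection is altered by one transposition so that it takes the cell
      \<open>u\<close> cut last in \<open>P\<close> to the cell \<open>v\<close> cut last in
      \<open>Q0\<close>.\<close>
    define \<tau> where "\<tau> = transpose (\<sigma> u) v \<circ> \<sigma>"
    have "transpose (\<sigma> u) v permutes Q0"
      using s P(2) Q(2) by (intro permutes_swap_id) auto
    then have tb: "bij_betw \<tau> P Q0"
      unfolding \<tau>_def using bij_betw_trans[OF sb permutes_imp_bij] by blast
    have tu: "\<tau> u = v" by (simp add: \<tau>_def)
    obtain t' where t': "t' \<in> K" "\<And>x. x \<in> P \<Longrightarrow> replaces t' x (\<tau> x)"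
      using rearrange[OF tP(1,2) tb t] by blast
    have W: "P \<subseteq> W" "Q0 \<subseteq> W" using tP by (auto simp: tiling_def)
    then have uv: "u \<in> W" "v \<in> W" using P Q by auto
    \<comment> \<open>The identity serves if the directions agree. Otherwise a second cell
      \<open>v'\<close> of \<open>Q0\<close> gives the room for a baker map on
      \<open>v\<close>.\<close>
    obtain f where f: "f \<in> K" "\<And>b. replaces f (ext v l b) (ext v l' b)" "\<And>x. x \<notin> cone m v \<Longrightarrow> f x = x"
    proof (cases "l = l'")
      case True
      then show ?thesis using that[of id] subgroup_id[OF K] replaces_id by auto
    next
      case False
      have "Q0 \<noteq> {v}" using tP by auto
      then obtain v' where v': "v' \<in> Q0" "v' \<noteq> v" using Q(2) by auto
      then have "disj v v'" "v' \<in> W" using tP Q(2) by (auto simp: tiling_def)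
      then show ?thesis using baker_in[OF uv(2) _ _ P(3) Q(3) False, of v'] that by blast
    qed
    have foff: "replaces f y y" if "y \<in> Q0" "y \<noteq> v" for y
      unfolding replaces_def
    proof (intro ballI f(3))
      fix w assume "w \<in> C"
      moreover have "disj v y" using that tP Q by (auto simp: tiling_def)
      ultimately show "y \<frown> w \<notin> cone m v" using disj_off by blast
    qed
    have "\<exists>y\<in>Q. replaces (f \<circ> t') x y" if x: "x \<in> insert (ext u l False) (insert (ext u l True) (P - {u}))" for x
    proof -
      consider b where "x = ext u l b" | "x \<in> P" "x \<noteq> u" using x by blast
      then show ?thesis
      proof cases
        case 1
        have "replaces t' (ext u l b) (ext v l b)" using replaces_append[OF t'(2)[OF P(2)]] uv tu by auto
        then have "replaces (f \<circ> t') x (ext v l' b)" using replaces_comp[OF _ f(2)] 1 uv by blast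
        moreover have "ext v l' b \<in> Q" unfolding split(1) by (cases b) auto
        ultimately show ?thesis by blast
      next
        case 2
        have ty: "\<tau> x \<in> Q0" "\<tau> x \<noteq> v"
          using 2 P(2) bij_betw_apply[OF tb] bij_betw_imp_inj_on[OF tb] unfolding tu[symmetric]
          by (simp_all add: inj_on_eq_iff)
        then have "replaces (f \<circ> t') x (\<tau> x)" using replaces_comp[OF t'(2)[OF 2(1)] foff] W by blast
        moreover have "\<tau> x \<in> Q" using ty unfolding split(1) by blast
        ultimately show ?thesis by blast
      qed
    qed
    then show ?thesis using subgroup_comp[OF K f(1) t'(1)] by blast
  qed
qed

text \<open>An element \<open>g\<close> carries some division by halvings onto a grid, which is
  another such division with equally many cells. By \<open>guillotine_equiv\<close> and
  \<open>rearrange\<close>, a member of \<open>K\<close> does the same cell by cell, and therefore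
  equals \<open>g\<close>.\<close>

theorem carrier_subset: "carrier G \<subseteq> K"
proof
  fix g assume g: "g \<in> carrier G"
  have p: "g permutes C" using carrierD(1)[OF g] .
  obtain n where n: "\<And>u. u \<in> W \<Longrightarrow> (\<And>l. l < m \<Longrightarrow> n \<le> length (u ! l)) \<Longrightarrow> \<exists>v\<in>W. replaces g u v"
    using carrier_deep[OF g] by blast
  \<comment> \<open>Positive depth, as \<open>guillotine_grid\<close> requires.\<close>
  let ?D = "grid (Suc n)"
  have "\<exists>v\<in>W. replaces g u v" if "u \<in> ?D" for u using that by (intro n) (auto simp: grid_def)
  then obtain \<sigma> where s: "\<And>u. u \<in> ?D \<Longrightarrow> \<sigma> u \<in> W \<and> replaces g u (\<sigma> u)" by metis
  obtain N where N: "\<And>u l. u \<in> \<sigma> ` ?D \<Longrightarrow> l < m \<Longrightarrow> length (u ! l) \<le> N"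
    using finite_lengths finite_imageI[OF finite_grid] by metis
  let ?N = "Suc N"
  \<comment> \<open>Each grid cell is refined by exactly the lengths that its image lacks, so that
    all images of the pieces have depth \<open>?N\<close>.\<close>
  define A where "A = (\<Union>d\<in>?D. refine d (\<lambda>l. ?N - length (\<sigma> d ! l)))"
  obtain k0 where "guillotine k0 ?D" using guillotine_grid[OF m_pos] by blast
  from guillotine_refine_all[OF m_pos this, of "\<lambda>d l. ?N - length (\<sigma> d ! l)"] obtain k where k: "guillotine k A" unfolding A_def by blast
  obtain k' where k': "guillotine k' (grid ?N)" using guillotine_grid[OF m_pos] by blast
  have tA: "tiling A" "card A = k" using guillotine_tiling[OF m_pos k] by auto
  have "\<exists>v\<in>grid ?N. replaces g u v" if u: "u \<in> A" for u
  proof -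
    obtain d x where d: "d \<in> ?D" "u = d \<odot> x" "x \<in> W" "\<And>l. l < m \<Longrightarrow> length (x ! l) = ?N - length (\<sigma> d ! l)"
      using u by (auto simp: A_def refine_def)
    have dW: "d \<in> W" "\<sigma> d \<in> W" using d s grid_W by auto
    have "length (\<sigma> d ! l) \<le> N" if "l < m" for l using N d that by blast
    then have "\<sigma> d \<odot> x \<in> grid ?N"
      using d dW by (fastforce simp: grid_def nth_tuple_append)
    moreover have "replaces g u (\<sigma> d \<odot> x)" using replaces_append s d dW by blast
    ultimately show ?thesis by blast
  qed
  then obtain \<tau> where tau: "\<And>u. u \<in> A \<Longrightarrow> \<tau> u \<in> grid ?N \<and> replaces g u (\<tau> u)" by metis
  then have tW: "\<tau> u \<in> W \<and> replaces g u (\<tau> u)" if "u \<in> A" for u using that grid_W by blast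
  note ti = tiling_image[OF p tA(1) tW]
  have "\<tau> ` A = grid ?N" by (rule tiling_subset[OF ti(2) tiling_grid]) (use tau in auto)
  then have b: "bij_betw \<tau> A (grid ?N)" using ti(1) by (simp add: bij_betw_def)
  then have "k = k'" using guillotine_tiling[OF m_pos k'] tA(2) bij_betw_same_card by metis
  then obtain t where "t \<in> K" "\<And>u. u \<in> A \<Longrightarrow> \<exists>v\<in>grid ?N. replaces t u v"
    using guillotine_equiv k k' by blast
  from rearrange[OF tA(1) tiling_grid b this] obtain t' where t': "t' \<in> K" "\<And>u. u \<in> A \<Longrightarrow> replaces t' u (\<tau> u)"
    by blast
  have "t' = g"
    using tA(1) t' tau p carrierD(1)[OF subgroup_carrier[OF K t'(1)]]
    by (intro replaces_ext[of A]) (auto simp: tiling_def)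
  then show "g \<in> K" using t' by simp
qed

end

section \<open>Three-cycles of small cones\<close>

context cantor
begin

text \<open>The double transposition (0 1)(2 3); being even, it is a product of
  three-cycles.\<close>

definition rot22 :: "nat \<Rightarrow> nat" where
  "rot22 i = (if i = 0 then 1 else if i = 1 then 0 else if i = 2 then 3 else 2)"

lemma cells_iff: "cells es \<longleftrightarrow> set es \<subseteq> W \<and> sorted_wrt disj es"
proof -
  have "(\<forall>i<length es. \<forall>j<length es. i \<noteq> j \<longrightarrow> disj (es ! i) (es ! j)) \<longleftrightarrow> sorted_wrt disj es"
    (is "?L \<longleftrightarrow> ?R")
  proof
    assume R: ?R
    show ?L
    proof (intro allI impI)
      fix i j assume "i < length es" "j < length es" "i \<noteq> j"
      then consider "i < j" "j < length es" | "j < i" "i < length es" by linarith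
      then show "disj (es ! i) (es ! j)"
        by cases (use R in \<open>auto simp: sorted_wrt_iff_nth_less intro: disj_sym\<close>)
    qed
  qed (auto simp: sorted_wrt_iff_nth_less)
  moreover have "(\<forall>i<length es. es ! i \<in> W) \<longleftrightarrow> set es \<subseteq> W"
    using all_set_conv_all_nth[of es "\<lambda>x. x \<in> W"] by blast
  ultimately show ?thesis by (simp add: cells_def)
qed

lemma cell_perm_rot22I:
  assumes "cells [a, b, c, d]" "replaces f a b" "replaces f b a" "replaces f c d" "replaces f d c"
    "\<And>x. x \<notin> cone m a \<Longrightarrow> x \<notin> cone m b \<Longrightarrow> x \<notin> cone m c \<Longrightarrow> x \<notin> cone m d \<Longrightarrow> f x = x"
  shows "f = cell_perm [a, b, c, d] rot22"
proof (rule cell_perm_eqI[OF assms(1)])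
  fix i assume "i < length [a, b, c, d]"
  then consider "i = 0" | "i = 1" | "i = 2" | "i = 3" by fastforce
  then show "replaces f ([a, b, c, d] ! i) ([a, b, c, d] ! rot22 i)"
    by cases (use assms in \<open>simp_all add: rot22_def numeral_2_eq_2 numeral_3_eq_3\<close>)
next
  fix x assume "off [a, b, c, d] x"
  then have "x \<notin> cone m ([a, b, c, d] ! 0)" "x \<notin> cone m ([a, b, c, d] ! 1)"
    "x \<notin> cone m ([a, b, c, d] ! 2)" "x \<notin> cone m ([a, b, c, d] ! 3)"
    unfolding off_def by fastforce+
  then show "f x = x" using assms(6) by simp
qed

text \<open>After halving both cones, the swap is a double transposition of four cells. This factors
  into two three-cycles, or into two swaps of the smaller cones.\<close>

lemma cone_swap_split_tri:
  assumes W: "p \<in> W" "q \<in> W" and d: "disj p q" and l: "l < m"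
  defines "a \<equiv> ext p l False" and "b \<equiv> ext q l False" and "c \<equiv> ext p l True" and "e \<equiv> ext q l True"
  shows "cells [a, b, c]" "cells [c, a, e]"
    "cone_swap p q = cone_cycle c a e \<circ> cone_cycle a b c" "cone_swap p q = cone_swap c e \<circ> cone_swap a b"
proof -
  have W4: "a \<in> W" "b \<in> W" "c \<in> W" "e \<in> W" using W by (auto simp: a_def b_def c_def e_def)
  have d': "disj q p" using d by (rule disj_sym)
  have dd: "disj a b" "disj a c" "disj a e" "disj b c" "disj b e" "disj c e"
    "disj b a" "disj c a" "disj e a" "disj c b" "disj e b" "disj e c"
    unfolding a_def b_def c_def e_def
    using disj_extend[OF d] disj_extend[OF d'] W disj_ext[OF W(1) l] disj_ext[OF W(2) l] by auto
  show cs: "cells [a, b, c]" "cells [c, a, e]"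
    using W4 dd by (simp_all add: cells3)
  have c4: "cells [a, b, c, e]" using W4 dd by (simp add: cells_iff)
  have cu: "x \<in> cone m p \<longleftrightarrow> x \<in> cone m a \<or> x \<in> cone m c" "x \<in> cone m q \<longleftrightarrow> x \<in> cone m b \<or> x \<in> cone m e" for x
    using cone_split[OF W(1) l] cone_split[OF W(2) l] by (auto simp: a_def b_def c_def e_def)
  have 1: "cone_swap p q = cell_perm [a, b, c, e] rot22"
    by (rule cell_perm_rot22I[OF c4])
      (use cone_swap_pre[OF W d] W cu in \<open>auto simp: a_def b_def c_def e_def intro!: replaces_append cone_swap_off\<close>)
  note t1 = cone_cycle_pre[OF cs(1)] and t2 = cone_cycle_pre[OF cs(2)]
  have t3: "replaces (cone_cycle a b c) e e" "replaces (cone_cycle c a e) b b" using dd by (auto intro: cone_cycle_pre_off)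
  have 2: "cone_cycle c a e \<circ> cone_cycle a b c = cell_perm [a, b, c, e] rot22"
    by (rule cell_perm_rot22I[OF c4])
      (use replaces_comp[OF t1(1) t3(2)] replaces_comp[OF t1(2) t2(1)] replaces_comp[OF t1(3) t2(2)]
        replaces_comp[OF t3(1) t2(3)] W4 in \<open>auto simp: cone_cycle_off\<close>)
  have s1: "replaces (cone_swap a b) a b" "replaces (cone_swap a b) b a" "replaces (cone_swap a b) c c" "replaces (cone_swap a b) e e"
    using cone_swap_pre[of a b] W4 dd by (auto intro: cone_swap_pre_off)
  have s2: "replaces (cone_swap c e) c e" "replaces (cone_swap c e) e c" "replaces (cone_swap c e) a a" "replaces (cone_swap c e) b b"
    using cone_swap_pre[of c e] W4 dd by (auto intro: cone_swap_pre_off)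
  have 3: "cone_swap c e \<circ> cone_swap a b = cell_perm [a, b, c, e] rot22"
    by (rule cell_perm_rot22I[OF c4])
      (use replaces_comp[OF s1(1) s2(4)] replaces_comp[OF s1(2) s2(3)] replaces_comp[OF s1(3) s2(1)]
        replaces_comp[OF s1(4) s2(2)] W4 in \<open>auto simp: cone_swap_off\<close>)
  show "cone_swap p q = cone_cycle c a e \<circ> cone_cycle a b c" "cone_swap p q = cone_swap c e \<circ> cone_swap a b"
    using 1 2 3 by simp_all
qed

end

lemma fresh:
  assumes "card F < N" "finite F"
  obtains i where "i < N" "i \<notin> (F :: nat set)"
proof -
  have "\<not> {..<N} \<subseteq> F" using assms by (metis card_lessThan card_mono leD)
  then show ?thesis using that by blast
qed

lemma fresh_list:
  assumes "length xs < N"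
  obtains i where "i < N" "i \<notin> set (xs :: nat list)"
  by (rule fresh[of "set xs" N]) (use assms card_length[of xs] in auto)

lemma card_insert_le_Suc: "card (insert a F) \<le> Suc (card F)"
  by (cases "finite F") (auto simp: card_insert_if)

section \<open>Conjugating three-cycles within a subgroup\<close>

context cantor_subgroup
begin

lemma cone_cycle_transport:
  assumes "cells [p, q, r]" "cells [p', q', r']" "f \<in> K" "replaces f p p'" "replaces f q q'" "replaces f r r'"
  shows "cone_cycle p q r \<in> K \<longleftrightarrow> cone_cycle p' q' r' \<in> K"
proof -
  have "bij f" using carrier_bij[OF subgroup_carrier[OF K assms(3)]] .
  from cone_cycle_conj[OF assms(1,2) this assms(4-6)] show ?thesis
    using subgroup_conj[OF K assms(3), of "cone_cycle p q r"] subgroup_conj'[OF K assms(3), of "cone_cycle p q r"] by metis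
qed

text \<open>Conjugation by the cycle of \<open>p\<close>, \<open>p'\<close> and the auxiliary cone
  \<open>s\<close> replaces \<open>p\<close> by \<open>p'\<close> and leaves \<open>q\<close> and
  \<open>r\<close> alone.\<close>

lemma cone_cycle_move:
  assumes c: "cells [p, q, r]" and t: "cells [p, p', s]" "cone_cycle p p' s \<in> K"
    and d: "disj p' q" "disj p' r" "disj s q" "disj s r"
  shows "cone_cycle p q r \<in> K \<longleftrightarrow> cone_cycle p' q r \<in> K"
proof (rule cone_cycle_transport[OF c _ t(2)])
  show "cells [p', q, r]" using c t d by (auto simp: cells3)
  show "replaces (cone_cycle p p' s) p p'" by (rule cone_cycle_pre[OF t(1)])
  show "replaces (cone_cycle p p' s) q q" "replaces (cone_cycle p p' s) r r"
    using c d by (auto simp: cells3 intro: cone_cycle_pre_off)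
qed

text \<open>Within \<open>S\<close> a swap is a product of two three-cycles of halves. Otherwise one
  of the cones is shorter than \<open>L\<close> in some coordinate, and halving both there reduces
  the total deficit.\<close>

lemma swaps_in:
  assumes S: "\<And>p x. p \<in> S \<Longrightarrow> x \<in> W \<Longrightarrow> p \<odot> x \<in> S"
    and deep: "\<And>p. p \<in> W \<Longrightarrow> (\<And>l. l < m \<Longrightarrow> L \<le> length (p ! l)) \<Longrightarrow> p \<in> S"
    and cone_cycle: "\<And>p q r. p \<in> S \<Longrightarrow> q \<in> S \<Longrightarrow> r \<in> S \<Longrightarrow> cells [p, q, r] \<Longrightarrow> cone_cycle p q r \<in> K"
    and pq: "p \<in> W" "q \<in> W" "disj p q"
  shows "cone_swap p q \<in> K"
  using pq
proof (induction "\<Sum>l<m. (L - length (p ! l)) + (L - length (q ! l))" arbitrary: p q rule: less_induct)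
  case less
  show ?case
  proof (cases "p \<in> S \<and> q \<in> S")
    case True
    note s = cone_swap_split_tri[OF less(2-4) m_pos]
    have "ext p 0 b \<in> S" "ext q 0 b \<in> S" for b using True S by auto
    then have "cone_cycle (ext p 0 True) (ext p 0 False) (ext q 0 True) \<in> K"
      "cone_cycle (ext p 0 False) (ext q 0 False) (ext p 0 True) \<in> K" using s(1,2) by (auto intro: cone_cycle)
    then show ?thesis unfolding s(3) by (rule subgroup_comp[OF K])
  next
    case False
    then obtain l where l: "l < m" "length (p ! l) < L \<or> length (q ! l) < L"
      using deep less by (metis not_less)
    note s = cone_swap_split_tri[OF less(2-4) l(1)]
    have "(\<Sum>k<m. (L - length (ext p l b ! k)) + (L - length (ext q l b ! k))) <
        (\<Sum>k<m. (L - length (p ! k)) + (L - length (q ! k)))" for b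
      by (rule sum_strict_mono_ex1) (use l less(2,3) in \<open>auto simp: nth_tuple_append nth_letter intro!: bexI[of _ l] add_mono\<close>)
    then have "cone_swap (ext p l b) (ext q l b) \<in> K" for b
      using less disj_extend by auto
    then show ?thesis unfolding s(4) by (intro subgroup_comp[OF K])
  qed
qed

end

text \<open>Ten cells are enough for all choices of fresh indices: the largest demand, in
  \<open>all_tris_in\<close>, has to avoid six excluded indices and three already chosen.\<close>

locale cycle_subgroup = cantor_subgroup +
  fixes cs
  assumes cs: "cells cs" and N: "10 \<le> length cs"
begin

abbreviation "N \<equiv> length cs"

lemma word_cs: "i < N \<Longrightarrow> cs ! i \<in> W" using cellsD[OF cs] .
lemma disj_cs: "i < N \<Longrightarrow> j < N \<Longrightarrow> i \<noteq> j \<Longrightarrow> disj (cs ! i) (cs ! j)" using cells_disj[OF cs] .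

text \<open>The cones \<open>p\<close> and \<open>q\<close> are exchanged in turn for fresh cells
  \<open>i\<close> and \<open>j\<close>, with cell \<open>z\<close> as the third member of the
  conjugating cycles and rotations bringing the next cone to the front. The remaining cycle of
  \<open>r\<close> and two cells is in \<open>K\<close> by assumption.\<close>

lemma all_tris_in:
  assumes ct: "\<And>i j k. i < N \<Longrightarrow> j < N \<Longrightarrow> k < N \<Longrightarrow> distinct [i, j, k] \<Longrightarrow> cone_cycle (cs ! i) (cs ! j) (cs ! k) \<in> K"
    and S: "\<And>p. p \<in> S \<Longrightarrow> \<exists>F. finite F \<and> card F \<le> 2 \<and> (\<forall>i<N. i \<notin> F \<longrightarrow> disj p (cs ! i)) \<and>
      (\<forall>i<N. \<forall>j<N. i \<noteq> j \<longrightarrow> i \<notin> F \<longrightarrow> j \<notin> F \<longrightarrow> cone_cycle p (cs ! i) (cs ! j) \<in> K)"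
    and pqr: "p \<in> S" "q \<in> S" "r \<in> S" and c: "cells [p, q, r]"
  shows "cone_cycle p q r \<in> K"
proof -
  note [[linarith_neq_limit = 0]]
  obtain F1 where F1: "finite F1" "card F1 \<le> 2" "\<And>i. i < N \<Longrightarrow> i \<notin> F1 \<Longrightarrow> disj p (cs ! i)"
    "\<And>i j. i < N \<Longrightarrow> j < N \<Longrightarrow> i \<noteq> j \<Longrightarrow> i \<notin> F1 \<Longrightarrow> j \<notin> F1 \<Longrightarrow> cone_cycle p (cs ! i) (cs ! j) \<in> K"
    using S[OF pqr(1)] by auto
  obtain F2 where F2: "finite F2" "card F2 \<le> 2" "\<And>i. i < N \<Longrightarrow> i \<notin> F2 \<Longrightarrow> disj q (cs ! i)"
    "\<And>i j. i < N \<Longrightarrow> j < N \<Longrightarrow> i \<noteq> j \<Longrightarrow> i \<notin> F2 \<Longrightarrow> j \<notin> F2 \<Longrightarrow> cone_cycle q (cs ! i) (cs ! j) \<in> K"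
    using S[OF pqr(2)] by auto
  obtain F3 where F3: "finite F3" "card F3 \<le> 2" "\<And>i. i < N \<Longrightarrow> i \<notin> F3 \<Longrightarrow> disj r (cs ! i)"
    "\<And>i j. i < N \<Longrightarrow> j < N \<Longrightarrow> i \<noteq> j \<Longrightarrow> i \<notin> F3 \<Longrightarrow> j \<notin> F3 \<Longrightarrow> cone_cycle r (cs ! i) (cs ! j) \<in> K"
    using S[OF pqr(3)] by auto
  define F where "F = F1 \<union> F2 \<union> F3"
  have fin: "finite F" using F1 F2 F3 by (simp add: F_def)
  have "card F \<le> card F1 + card F2 + card F3"
    unfolding F_def by (metis card_Un_le add_le_mono1 order_trans)
  then have card: "card F \<le> 6" using F1 F2 F3 by linarith
  obtain i where i: "i < N" "i \<notin> F" by (rule fresh[of F N]) (use card fin N in auto)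
  obtain j where j: "j < N" "j \<notin> insert i F"
    by (rule fresh[of "insert i F" N]) (use card card_insert_le_Suc[of i F] fin N in auto)
  obtain k where k: "k < N" "k \<notin> insert j (insert i F)"
    by (rule fresh[of "insert j (insert i F)" N])
      (use card card_insert_le_Suc[of i F] card_insert_le_Suc[of j "insert i F"] fin N in auto)
  obtain z where z: "z < N" "z \<notin> insert k (insert j (insert i F))"
    by (rule fresh[of "insert k (insert j (insert i F))" N])
      (use card card_insert_le_Suc[of i F] card_insert_le_Suc[of j "insert i F"]
        card_insert_le_Suc[of k "insert j (insert i F)"] fin N in auto)
  have notin: "x \<notin> F1" "x \<notin> F2" "x \<notin> F3" if "x \<in> {i, j, k, z}" for x
    using that i j k z by (auto simp: F_def)
  have ne: "i \<noteq> j" "i \<noteq> k" "i \<noteq> z" "j \<noteq> k" "j \<noteq> z" "k \<noteq> z" using j k z by auto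
  have W: "p \<in> W" "q \<in> W" "r \<in> W" and pd: "disj p q" "disj p r" "disj q r"
    using c by (auto simp: cells3)
  have dF: "disj p (cs ! x)" "disj q (cs ! x)" "disj r (cs ! x)" "cs ! x \<in> W" "x < N" if "x \<in> {i, j, k, z}" for x
    using that notin[OF that] F1(3) F2(3) F3(3) i j k z word_cs by auto
  have dF': "disj (cs ! x) p" "disj (cs ! x) q" "disj (cs ! x) r" if "x \<in> {i, j, k, z}" for x
    using dF[OF that] disj_sym by blast+
  have "cone_cycle p q r \<in> K \<longleftrightarrow> cone_cycle (cs ! i) q r \<in> K"
    by (rule cone_cycle_move[OF c, of _ "cs ! z"])
      (use F1(4)[of i z] notin dF dF' disj_cs ne W in \<open>auto simp: cells3\<close>)
  also have "\<dots> \<longleftrightarrow> cone_cycle q r (cs ! i) \<in> K"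
    using cone_cycle_rotate[of "cs ! i" q r] dF' pd W dF by (simp add: cells3)
  also have "\<dots> \<longleftrightarrow> cone_cycle (cs ! j) r (cs ! i) \<in> K"
    by (rule cone_cycle_move[of _ _ _ _ "cs ! z"])
      (use F2(4)[of j z] notin dF dF' disj_cs ne W pd in \<open>auto simp: cells3\<close>)
  also have "\<dots> \<longleftrightarrow> cone_cycle r (cs ! i) (cs ! j) \<in> K"
    using cone_cycle_rotate[of "cs ! j" r "cs ! i"] dF' dF disj_cs ne W by (simp add: cells3)
  also have "\<dots>" using F3(4)[of i j] notin dF ne by auto
  finally show ?thesis .
qed

text \<open>Conjugating by the rotation gives all cycles of three consecutive indices. Further
  conjugations give (0 1 k), then the cycles containing 0 or 1, and finally those avoiding
  both.\<close>

lemma alternating: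
  assumes t0: "cone_cycle (cs ! 0) (cs ! 1) (cs ! 2) \<in> K" and b: "cell_perm cs (\<lambda>i. Suc i mod N) \<in> K"
    and ijk: "i < N" "j < N" "k < N" "distinct [i, j, k]"
  shows "cone_cycle (cs ! i) (cs ! j) (cs ! k) \<in> K"
proof -
  have [simp]: "cs \<noteq> []" using N by auto
  define Q where "Q i j k \<longleftrightarrow> cone_cycle (cs ! i) (cs ! j) (cs ! k) \<in> K" for i j k
  have c3: "cells [cs ! i, cs ! j, cs ! k]" if "i < N" "j < N" "k < N" "distinct [i, j, k]" for i j k
    using that word_cs disj_cs by (auto simp: cells3)
  have rot: "Q j k i" if "Q i j k" "i < N" "j < N" "k < N" "distinct [i, j, k]" for i j k
    using that cone_cycle_rotate[OF c3[OF that(2-5)]] by (simp add: Q_def)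
  have flip: "Q i k j" if "Q i j k" "i < N" "j < N" "k < N" "distinct [i, j, k]" for i j k
    using that cone_cycle_inv[OF c3[OF that(2-5)]] subgroup_pinv[OF K] by (simp add: Q_def)
  have conj: "Q (f i) (f j) (f k)"
    if ijk: "Q i j k" "i < N" "j < N" "k < N" "distinct [i, j, k]"
      and xyz: "Q x y z" "x < N" "y < N" "z < N" "distinct [x, y, z]"
      and f: "f = (\<lambda>n. if n = x then y else if n = y then z else if n = z then x else n)" for f i j k x y z
  proof -
    let ?t = "cone_cycle (cs ! x) (cs ! y) (cs ! z)"
    have p: "replaces ?t (cs ! n) (cs ! f n)" if n: "n < N" for n
    proof -
      consider "n = x" | "n = y" | "n = z" | "n \<notin> {x, y, z}" by blast
      then show ?thesis
        using cone_cycle_pre[OF c3[OF xyz(2-5)]] xyz(2-5) n disj_cs by cases (auto simp: f intro: cone_cycle_pre_off)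
    qed
    have fN: "f n < N" if "n < N" for n using that xyz by (simp add: f)
    have "n = n'" if "f n = f n'" for n n' using that xyz(5) by (simp add: f split: if_splits)
    then have d: "distinct [f i, f j, f k]" using ijk(5) by auto
    have t: "?t \<in> K" using xyz(1) by (simp add: Q_def)
    show ?thesis
      using cone_cycle_transport[OF c3[OF ijk(2-5)] c3[OF fN fN fN d] t p p p] ijk by (simp add: Q_def)
  qed
  note conj = conj[OF _ _ _ _ _ _ _ _ _ _ refl]
  have cons: "i + 2 < N \<Longrightarrow> Q i (Suc i) (i + 2)" for i
  proof (induction i)
    case 0
    then show ?case using t0 by (simp add: Q_def numeral_2_eq_2)
  next
    case (Suc i)
    \<comment> \<open>Below the last index the rotation does not wrap around, so it shifts the cycle
      by one.\<close>
    have p: "replaces (cell_perm cs (\<lambda>i. Suc i mod N)) (cs ! n) (cs ! Suc n)" if "Suc n < N" for n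
      using cell_perm_pre[OF cs, of n "\<lambda>i. Suc i mod N"] that by simp
    show ?case
      using cone_cycle_transport[OF c3 c3 b p p p, of i "Suc i" "i + 2"] Suc by (simp add: Q_def)
  qed
  have A: "2 \<le> k \<Longrightarrow> k < N \<Longrightarrow> Q 0 1 k" for k
  proof (induction k rule: dec_induct)
    case base
    then show ?case using cons[of 0] by (simp add: numeral_2_eq_2)
  next
    case (step k)
    show ?case
    proof (cases "k = 2")
      case True
      \<comment> \<open>Later steps conjugate by (k-1 k k+1) to turn \<open>k\<close> into
        \<open>k + 1\<close>. For \<open>k = 2\<close> this cycle would move 1, so (2 3 4) takes its
        place.\<close>
      have "Q 2 3 4" using cons[of 2] N by (simp add: numeral_eq_Suc)
      then show ?thesis using conj[of 0 1 k 2 3 4] step True N by simp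
    next
      case False
      define q where "q = k - 3"
      have k: "k = Suc (Suc (Suc q))" using False step by (simp add: q_def)
      then have "Q (Suc (Suc q)) (Suc (Suc (Suc q))) (Suc (Suc (Suc (Suc q))))"
        using cons[of "Suc (Suc q)"] step by simp
      then show ?thesis using conj[of 0 1 k "Suc (Suc q)" k "Suc k"] step k by simp
    qed
  qed
  have B: "Q 1 j k" "Q 0 j k" if "2 \<le> j" "j < N" "2 \<le> k" "k < N" "j \<noteq> k" for j k
  proof -
    show "Q 1 j k" using conj[OF A[OF that(3,4)] _ _ _ _ A[OF that(1,2)]] that by simp
    have "Q 1 0 j" using flip[OF rot[OF A[OF that(1,2)]]] that by auto
    then have "Q j 0 k" using conj[OF A[OF that(3,4)], of 1 0 j] that by simp
    then show "Q 0 j k" using flip[OF rot] that by auto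
  qed
  have D: "Q i j k" if "2 \<le> i" "i < N" "2 \<le> j" "j < N" "2 \<le> k" "k < N" "distinct [i, j, k]" for i j k
  proof -
    have "Q 0 i 1" using flip[OF A[OF that(1,2)]] that by auto
    then show ?thesis using conj[OF B(2)[OF that(3-6)], of 0 i 1] that by auto
  qed
  have Q0: "Q 0 j k" if "j < N" "k < N" "distinct [0, j, k]" for j k
  proof -
    have "j = 1 \<or> k = 1 \<or> 2 \<le> j \<and> 2 \<le> k" using that by auto
    then consider "j = 1" | "k = 1" | "2 \<le> j" "2 \<le> k" by blast
    then show ?thesis
      using A[of k] flip[OF A[of j]] B(2)[of j k] that by cases auto
  qed
  have Q1: "Q 1 j k" if "j < N" "k < N" "distinct [1, j, k]" for j k
  proof -
    have "j = 0 \<or> k = 0 \<or> 2 \<le> j \<and> 2 \<le> k" using that by auto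
    then consider "j = 0" | "k = 0" | "2 \<le> j" "2 \<le> k" by blast
    then show ?thesis
    proof cases
      case 1
      then show ?thesis using flip[OF rot[OF A[of k]]] that by auto
    next
      case 2
      then show ?thesis using rot[OF A[of j]] that by auto
    qed (use B(1) that in auto)
  qed
  have "i = 0 \<or> j = 0 \<or> k = 0 \<or> i = 1 \<or> j = 1 \<or> k = 1 \<or> 2 \<le> i \<and> 2 \<le> j \<and> 2 \<le> k" by arith
  then consider "i = 0" | "j = 0" | "k = 0" | "i = 1" | "j = 1" | "k = 1" | "2 \<le> i" "2 \<le> j" "2 \<le> k"
    by blast
  then have "Q i j k"
  proof cases
    case 2
    then show ?thesis using rot[OF rot[OF Q0[of k i]]] ijk by auto
  next
    case 3
    then show ?thesis using rot[OF Q0[of i j]] ijk by auto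
  next
    case 5
    then show ?thesis using rot[OF rot[OF Q1[of k i]]] ijk by auto
  next
    case 6
    then show ?thesis using rot[OF Q1[of i j]] ijk by auto
  qed (use Q0 Q1 D ijk in auto)
  then show ?thesis by (simp add: Q_def)
qed

text \<open>Passing through three fresh indices \<open>x\<close>, \<open>y\<close>, \<open>z\<close>
  keeps the triple distinct while each entry is replaced in turn.\<close>

lemma move_all:
  assumes R: "\<And>i j k x. i < N \<Longrightarrow> j < N \<Longrightarrow> k < N \<Longrightarrow> x < N \<Longrightarrow> distinct [i, j, k, x] \<Longrightarrow> R i j k \<Longrightarrow>
      R x j k \<and> R i x k \<and> R i j x"
    and a: "a < N" "b < N" "c < N" "distinct [a, b, c]" "R a b c"
    and i: "i < N" "j < N" "k < N" "distinct [i, j, k]"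
  shows "R i j k"
proof -
  note [[linarith_neq_limit = 0]]
  obtain x where x: "x < N" "x \<notin> {a, b, c, i, j, k}"
    by (rule fresh_list[of "[a, b, c, i, j, k]" N]) (use N in auto)
  obtain y where y: "y < N" "y \<notin> {a, b, c, i, j, k, x}"
    by (rule fresh_list[of "[a, b, c, i, j, k, x]" N]) (use N in auto)
  obtain z where z: "z < N" "z \<notin> {a, b, c, i, j, k, x, y}"
    by (rule fresh_list[of "[a, b, c, i, j, k, x, y]" N]) (use N in auto)
  have "R x b c" using R[of a b c x] a x by auto
  then have "R x y c" using R[of x b c y] a x y by auto
  then have "R x y z" using R[of x y c z] a x y z by auto
  then have "R i y z" using R[of x y z i] i x y z by auto
  then have "R i j z" using R[of i y z j] i x y z by auto
  then show "R i j k" using R[of i j z k] i x y z by auto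
qed

text \<open>A cycle of whole cells moves a subcell in the same way as its cell, so a single cycle
  involving the suffix \<open>t\<close> can be carried to all triples of indices.\<close>

lemma cone_cycle_shift_all:
  assumes ct: "\<And>i j k. i < N \<Longrightarrow> j < N \<Longrightarrow> k < N \<Longrightarrow> distinct [i, j, k] \<Longrightarrow> cone_cycle (cs ! i) (cs ! j) (cs ! k) \<in> K"
    and a: "a < N" "b < N" "c < N" "distinct [a, b, c]" "cone_cycle (cs ! a) (cs ! b \<odot> t) (cs ! c \<odot> t) \<in> K"
    and i: "i < N" "j < N" "k < N" "distinct [i, j, k]" and t: "t \<in> W"
  shows "cone_cycle (cs ! i) (cs ! j \<odot> t) (cs ! k \<odot> t) \<in> K"
proof (rule move_all[of "\<lambda>i j k. cone_cycle (cs ! i) (cs ! j \<odot> t) (cs ! k \<odot> t) \<in> K", OF _ a i])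
  fix i j k x assume *: "i < N" "j < N" "k < N" "x < N" "distinct [i, j, k, x]"
    "cone_cycle (cs ! i) (cs ! j \<odot> t) (cs ! k \<odot> t) \<in> K"
  obtain z where z: "z < N" "z \<notin> {i, j, k, x}"
    by (rule fresh_list[of "[i, j, k, x]" N]) (use N in auto)
  have c3: "cells [cs ! i, cs ! j \<odot> t, cs ! k \<odot> t]" if "i < N" "j < N" "k < N" "distinct [i, j, k]" for i j k
    using that word_cs disj_cs t by (auto simp: cells3 disj_extend disj_extend_r)
  have f: "cone_cycle (cs ! n) (cs ! x) (cs ! z) \<in> K"
    "replaces (cone_cycle (cs ! n) (cs ! x) (cs ! z)) (cs ! n) (cs ! x)"
    "\<And>y. y < N \<Longrightarrow> y \<notin> {n, x, z} \<Longrightarrow> replaces (cone_cycle (cs ! n) (cs ! x) (cs ! z)) (cs ! y) (cs ! y)"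
    if "n \<in> {i, j, k}" for n
  proof -
    have n: "n < N" "distinct [n, x, z]" using that * z by auto
    then show "cone_cycle (cs ! n) (cs ! x) (cs ! z) \<in> K" using ct * z by blast
    have "cells [cs ! n, cs ! x, cs ! z]" using n * z word_cs disj_cs by (auto simp: cells3)
    then show "replaces (cone_cycle (cs ! n) (cs ! x) (cs ! z)) (cs ! n) (cs ! x)" by (rule cone_cycle_pre)
    show "replaces (cone_cycle (cs ! n) (cs ! x) (cs ! z)) (cs ! y) (cs ! y)" if "y < N" "y \<notin> {n, x, z}" for y
      using that n * z disj_cs by (auto intro: cone_cycle_pre_off)
  qed
  have "cone_cycle (cs ! x) (cs ! j \<odot> t) (cs ! k \<odot> t) \<in> K"
    using cone_cycle_transport[OF c3[of i j k] c3[of x j k] f(1)[of i] f(2)[of i] replaces_append[OF f(3)] replaces_append[OF f(3)]]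
      * z t word_cs by auto
  moreover have "cone_cycle (cs ! i) (cs ! x \<odot> t) (cs ! k \<odot> t) \<in> K"
    using cone_cycle_transport[OF c3[of i j k] c3[of i x k] f(1)[of j] f(3)[of j] replaces_append[OF f(2)] replaces_append[OF f(3)]]
      * z t word_cs by auto
  moreover have "cone_cycle (cs ! i) (cs ! j \<odot> t) (cs ! x \<odot> t) \<in> K"
    using cone_cycle_transport[OF c3[of i j k] c3[of i j x] f(1)[of k] f(3)[of k] replaces_append[OF f(3)] replaces_append[OF f(2)]]
      * z t word_cs by auto
  ultimately show "cone_cycle (cs ! x) (cs ! j \<odot> t) (cs ! k \<odot> t) \<in> K \<and> cone_cycle (cs ! i) (cs ! x \<odot> t) (cs ! k \<odot> t) \<in> K \<and>
    cone_cycle (cs ! i) (cs ! j \<odot> t) (cs ! x \<odot> t) \<in> K" by blast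
qed

lemma first_letter:
  assumes "u \<in> W" "l < m" "u ! l \<noteq> []"
  obtains b y where "y \<in> W" "u = letter l b \<odot> y" "(\<Sum>k<m. length (u ! k)) = Suc (\<Sum>k<m. length (y ! k))"
proof -
  define y where "y = u[l := tl (u ! l)]"
  have y: "y \<in> W" using assms by (simp add: y_def W_iff)
  have yl: "y ! k = (if k = l then tl (u ! l) else u ! k)" if "k < m" for k
    using that assms by (simp add: y_def W_iff)
  have "u = letter l (hd (u ! l)) \<odot> y"
    by (intro W_eqI) (use assms y yl in \<open>auto simp: nth_tuple_append nth_letter\<close>)
  moreover have "(\<Sum>k<m. length (u ! k)) = length (u ! l) + (\<Sum>k\<in>{..<m} - {l}. length (u ! k))"
    using assms by (simp add: sum.remove)
  moreover have "(\<Sum>k<m. length (y ! k)) = length (y ! l) + (\<Sum>k\<in>{..<m} - {l}. length (y ! k))"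
    using assms by (simp add: sum.remove)
  moreover have "(\<Sum>k\<in>{..<m} - {l}. length (y ! k)) = (\<Sum>k\<in>{..<m} - {l}. length (u ! k))"
    by (rule sum.cong) (auto simp: yl)
  moreover have "length (u ! l) = Suc (length (y ! l))" using assms by (simp add: yl)
  ultimately show ?thesis using that y by simp
qed

text \<open>Induction on the total length of the three suffixes: conjugating by a cycle that takes a
  one-letter extension of a cell to a whole cell strips off one letter.\<close>

lemma cone_cycle_deep:
  assumes ct: "\<And>i j k. i < N \<Longrightarrow> j < N \<Longrightarrow> k < N \<Longrightarrow> distinct [i, j, k] \<Longrightarrow> cone_cycle (cs ! i) (cs ! j) (cs ! k) \<in> K"
    and sh: "\<And>i j k l b. i < N \<Longrightarrow> j < N \<Longrightarrow> k < N \<Longrightarrow> distinct [i, j, k] \<Longrightarrow> l < m \<Longrightarrow>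
      cone_cycle (cs ! i) (ext (cs ! j) l b) (ext (cs ! k) l b) \<in> K"
    and i: "i < N" "j < N" "k < N" "distinct [i, j, k]" and W: "u \<in> W" "v \<in> W" "w \<in> W"
  shows "cone_cycle (cs ! i \<odot> u) (cs ! j \<odot> v) (cs ! k \<odot> w) \<in> K"
  using i W
proof (induction "(\<Sum>l<m. length (u ! l)) + (\<Sum>l<m. length (v ! l)) + (\<Sum>l<m. length (w ! l))"
    arbitrary: i j k u v w)
  case 0
  have "u = eps" "v = eps" "w = eps" using 0 by (auto intro!: W_eqI)
  then show ?case using ct 0 word_cs by simp
next
  case (Suc n)
  have c3: "cells [cs ! i \<odot> u, cs ! j \<odot> v, cs ! k \<odot> w]"
    if "i < N" "j < N" "k < N" "distinct [i, j, k]" "u \<in> W" "v \<in> W" "w \<in> W" for i j k u v w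
    using that word_cs disj_cs by (auto simp: cells3 disj_extend)
  have step: "cone_cycle (cs ! i \<odot> u) (cs ! j \<odot> v) (cs ! k \<odot> w) \<in> K"
    if "Suc n = (\<Sum>l<m. length (u ! l)) + (\<Sum>l<m. length (v ! l)) + (\<Sum>l<m. length (w ! l))"
      "i < N" "j < N" "k < N" "distinct [i, j, k]" "u \<in> W" "v \<in> W" "w \<in> W"
      "l < m" "u ! l \<noteq> []" for i j k u v w l
  proof -
    obtain b y where y: "y \<in> W" "u = letter l b \<odot> y" "(\<Sum>k<m. length (u ! k)) = Suc (\<Sum>k<m. length (y ! k))"
      using first_letter[OF \<open>u \<in> W\<close> \<open>l < m\<close> \<open>u ! l \<noteq> []\<close>] by blast
    obtain x where x: "x < N" "x \<notin> {i, j, k}"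
      by (rule fresh_list[of "[i, j, k]" N]) (use N in auto)
    obtain z where z: "z < N" "z \<notin> {i, j, k, x}"
      by (rule fresh_list[of "[i, j, k, x]" N]) (use N in auto)
    \<comment> \<open>This cycle carries the extension of cell \<open>i\<close> by the letter to the
      whole fresh cell \<open>x\<close>. It thereby shortens \<open>u\<close> to \<open>y\<close>
      and fixes cells \<open>j\<close> and \<open>k\<close>.\<close>
    let ?f = "cone_cycle (cs ! x) (ext (cs ! z) l b) (ext (cs ! i) l b)"
    have f: "?f \<in> K" using sh[of x z i l b] x z that by auto
    have cf: "cells [cs ! x, ext (cs ! z) l b, ext (cs ! i) l b]"
      using c3[of x z i eps "letter l b" "letter l b"] x z that word_cs by auto
    have pi: "replaces ?f (cs ! i \<odot> u) (cs ! x \<odot> y)"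
      using replaces_append[OF cone_cycle_pre(3)[OF cf] _ _ y(1)] y that x word_cs by (simp add: tuple_append_assoc)
    have pf: "replaces ?f (cs ! n \<odot> v) (cs ! n \<odot> v)" if "n < N" "n \<notin> {i, x, z}" "v \<in> W" for n v
      using that x z \<open>i < N\<close> disj_cs word_cs
      by (intro cone_cycle_pre_off disj_extend disj_extend_r) auto
    have "cone_cycle (cs ! x \<odot> y) (cs ! j \<odot> v) (cs ! k \<odot> w) \<in> K"
      by (rule Suc(1)) (use y that x in auto)
    then show ?thesis
      using cone_cycle_transport[OF c3[of i j k u v w] c3[of x j k y v w] f pi pf pf] x y z that by auto
  qed
  note S = Suc(2-)
  have "\<exists>l<m. u ! l \<noteq> [] \<or> v ! l \<noteq> [] \<or> w ! l \<noteq> []"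
  proof (rule ccontr)
    assume "\<not> ?thesis"
    then have "(\<Sum>l<m. length (u ! l)) + (\<Sum>l<m. length (v ! l)) + (\<Sum>l<m. length (w ! l)) = 0" by simp
    then show False using S(1) by simp
  qed
  then obtain l where "l < m" "u ! l \<noteq> [] \<or> v ! l \<noteq> [] \<or> w ! l \<noteq> []" by blast
  then consider "u ! l \<noteq> []" | "v ! l \<noteq> []" | "w ! l \<noteq> []" by blast
  then show ?case
  proof cases
    case 1
    then show ?thesis using step S \<open>l < m\<close> by blast
  next
    case 2
    have "cone_cycle (cs ! j \<odot> v) (cs ! k \<odot> w) (cs ! i \<odot> u) \<in> K"
      by (rule step[OF _ _ _ _ _ _ _ _ \<open>l < m\<close> 2]) (use S in auto)
    then show ?thesis using cone_cycle_rotate[OF c3[OF S(2-8)]] by simp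
  next
    case 3
    have "cone_cycle (cs ! k \<odot> w) (cs ! i \<odot> u) (cs ! j \<odot> v) \<in> K"
      by (rule step[OF _ _ _ _ _ _ _ _ \<open>l < m\<close> 3]) (use S in auto)
    moreover have "cells [cs ! k \<odot> w, cs ! i \<odot> u, cs ! j \<odot> v]" by (rule c3) (use S in auto)
    ultimately show ?thesis using cone_cycle_rotate by metis
  qed
qed

end

section \<open>The second generator\<close>

context cantor
begin

lemma cells_append:
  "cells (as @ bs) \<longleftrightarrow> cells as \<and> cells bs \<and> (\<forall>a\<in>set as. \<forall>b\<in>set bs. disj a b)"
  by (auto simp: cells_iff sorted_wrt_append)

lemma cells_Cons: "cells (a # bs) \<longleftrightarrow> a \<in> W \<and> cells bs \<and> (\<forall>b\<in>set bs. disj a b)"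
  by (auto simp: cells_iff)

lemma cells_map:
  assumes "u \<in> W" "cells xs"
  shows "cells (map (\<lambda>x. u \<odot> x) xs)"
  using assms by (auto simp: cells_def disj_append)

text \<open>The words 1, 01, 001 and so on in coordinate 0, ending with a word of zeros only:
  \<open>k + 1\<close> cells obtained by cutting off one half \<open>k\<close> times.\<close>

fun comb :: "nat \<Rightarrow> bool list list list" where
  "comb 0 = [eps]"
| "comb (Suc k) = letter 0 True # map (\<lambda>x. letter 0 False \<odot> x) (comb k)"

lemma length_comb [simp]: "length (comb k) = Suc k"
  by (induction k) auto

lemma cells_comb:
  assumes m: "0 < m"
  shows "cells (comb k)"
proof (induction k)
  case 0
  then show ?case by (simp add: cells_iff)
next
  case (Suc k)
  have "disj (letter 0 True) (letter 0 False \<odot> x)" if "x \<in> set (comb k)" for x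
    using disj_letter[OF m, of True False] that Suc by (intro disj_extend_r) (auto simp: cells_iff)
  then show ?case using cells_map[OF letter_W Suc] by (auto simp: cells_Cons)
qed

lemma cone_comb:
  assumes m: "0 < m" and u: "u \<in> W"
  shows "cone m u = (\<Union>x\<in>set (comb k). cone m (u \<odot> x))"
  using u
proof (induction k arbitrary: u)
  case 0
  then show ?case by simp
next
  case (Suc k)
  have W: "set (comb k) \<subseteq> W" using cells_comb[OF m] cells_iff by blast
  have "cone m u = cone m (ext u 0 False) \<union> cone m (ext u 0 True)" using cone_split[OF Suc(2) m] .
  also have "cone m (ext u 0 False) = (\<Union>x\<in>set (comb k). cone m (ext u 0 False \<odot> x))"
    by (rule Suc(1)) (use Suc(2) in simp)
  also have "\<dots> = (\<Union>x\<in>set (comb k). cone m (u \<odot> letter 0 False \<odot> x))"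
    using W Suc(2) by (intro SUP_cong) (auto simp: tuple_append_assoc)
  finally show ?case by auto
qed

definition cover :: "bool list list list \<Rightarrow> bool" where
  "cover es \<longleftrightarrow> C \<subseteq> (\<Union>u\<in>set es. cone m u)"

text \<open>The grid cells that miss both cones fill the complement, because a grid cell at least as
  deep as \<open>u\<close> and \<open>v\<close> that meets one of them lies inside it.\<close>

lemma complement_cells:
  assumes "u \<in> W" "v \<in> W" "disj u v"
  obtains os where "cells (u # v # os)" "cover (u # v # os)"
proof -
  obtain n where n: "\<And>w l. w \<in> {u, v} \<Longrightarrow> l < m \<Longrightarrow> length (w ! l) \<le> n"
    using finite_lengths[of "{u, v}"] by blast
  define D where "D = {d \<in> grid n. disj u d \<and> disj v d}"
  have "finite D" using finite_grid by (simp add: D_def)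
  then obtain os where os: "set os = D" "distinct os" using finite_distinct_list by blast
  have "cells os"
    unfolding cells_def
  proof (intro conjI allI impI)
    fix i assume "i < length os"
    then have "os ! i \<in> D" using os(1) nth_mem by blast
    then show "os ! i \<in> W" using grid_W unfolding D_def by blast
  next
    fix i j assume ij: "i < length os" "j < length os" "i \<noteq> j"
    then have "os ! i \<in> D" "os ! j \<in> D" using os(1) nth_mem by blast+
    moreover have "os ! i \<noteq> os ! j" using ij os(2) by (simp add: nth_eq_iff_index_eq)
    ultimately show "disj (os ! i) (os ! j)" using grid_disj[of "os ! i" n "os ! j"] by (simp add: D_def)
  qed
  then have 1: "cells (u # v # os)"
    using assms os by (simp add: cells_Cons D_def)
  have "x \<in> (\<Union>w\<in>set (u # v # os). cone m w)" if x: "x \<in> C" for x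
  proof -
    let ?d = "trunc n x"
    have d: "?d \<in> grid n" "x \<in> cone m ?d" using trunc_grid trunc_cone x by auto
    have "x \<in> cone m w" if w: "w \<in> {u, v}" "\<not> disj w ?d" for w
    proof -
      have "w \<in> W" using w assms by auto
      moreover have "\<not> disj ?d w" using w disj_sym by blast
      moreover have "length (w ! l) \<le> length (?d ! l)" if "l < m" for l
        using n[OF w(1) that] d(1) that by (simp add: grid_def)
      ultimately obtain y where y: "y \<in> W" "?d = w \<odot> y" using deep_cone grid_W[OF d(1)] by metis
      then show ?thesis using d(2) subsetD[OF cone_append_sub[OF \<open>w \<in> W\<close> y(1)]] by simp
    qed
    then show ?thesis using d os(1) by (cases "?d \<in> D") (auto simp: D_def)
  qed
  then have "cover (u # v # os)" by (auto simp: cover_def)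
  with 1 show ?thesis by (rule that)
qed

text \<open>A moved point and its image differ within the first \<open>N\<close> digits of some
  coordinate, so a cell of that depth around the point is disjoint from its image cell.\<close>

lemma moved_cone:
  assumes m: "0 < m" and g: "g \<in> carrier G" "g \<noteq> id"
  obtains u v os where "u \<in> W" "v \<in> W" "replaces g u v" "cells (u # v # os)" "cover (u # v # os)" "os \<noteq> []"
proof -
  have p: "g permutes C" using carrierD(1)[OF g(1)] .
  obtain x where x: "g x \<noteq> x" using g(2) by (metis eq_id_iff)
  then have xC: "x \<in> C" "g x \<in> C" using p permutes_not_in permutes_in_image by metis+
  obtain l where l: "l < m" "g x ! l \<noteq> x ! l" using x xC C_eqI by blast
  obtain N where N: "stake N (g x ! l) \<noteq> stake N (x ! l)"
  proof -
    have "snth (g x ! l) \<noteq> snth (x ! l)" using l(2) by (metis stream_smap_nats)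
    then obtain k where "g x ! l !! k \<noteq> x ! l !! k" by blast
    then have "stake (Suc k) (g x ! l) \<noteq> stake (Suc k) (x ! l)" by (metis lessI stake_nth)
    then show ?thesis by (rule that)
  qed
  obtain n where n: "\<And>u. u \<in> W \<Longrightarrow> (\<And>l. l < m \<Longrightarrow> n \<le> length (u ! l)) \<Longrightarrow> \<exists>v\<in>W. replaces g u v"
    using carrier_deep[OF g(1)] by blast
  let ?a = "trunc n x" and ?d = "trunc (n + N) x"
  have a: "?a \<in> W" "\<And>l. l < m \<Longrightarrow> length (?a ! l) = n" using trunc_grid[OF xC(1), of n] by (auto simp: grid_def)
  have d: "?d \<in> W" "\<And>l. l < m \<Longrightarrow> length (?d ! l) = n + N"
    using trunc_grid[OF xC(1), of "n + N"] by (auto simp: grid_def)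
  obtain b where b: "b \<in> W" "replaces g ?a b" using n a by (metis order_refl)
  have "\<not> disj ?d ?a" using trunc_cone[OF xC(1)] by (auto simp: disj_def)
  then obtain y where y: "y \<in> W" "?d = ?a \<odot> y" "\<And>l. l < m \<Longrightarrow> length (y ! l) = N"
    using deep_cone[OF a(1) d(1)] a(2) d(2) by (metis add_diff_cancel_left' le_add1)
  let ?e = "b \<odot> y"
  have e: "?e \<in> W" "replaces g ?d ?e" using b y replaces_append a by auto
  have xe: "x \<in> cone m ?d" "g x \<in> cone m ?e"
    using trunc_cone[OF xC(1)] replaces_image[OF e(2)] by auto
  have de: "disj ?d ?e"
  proof (rule ccontr)
    assume "\<not> disj ?d ?e"
    then obtain z where z: "z \<in> cone m ?d" "z \<in> cone m ?e" by (auto simp: disj_def)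
    have st: "stake N (s ! l) = stake N (t ! l)" if "s \<in> cone m w" "t \<in> cone m w" "w \<in> W" "N \<le> length (w ! l)" for s t w
    proof -
      have "stake (length (w ! l)) (s ! l) = stake (length (w ! l)) (t ! l)"
        using that l by (simp add: mem_cone_iff)
      then show ?thesis using that(4) by (metis min.absorb1 take_stake)
    qed
    have "N \<le> length (?d ! l)" "N \<le> length (?e ! l)" using d l y b by (auto simp: nth_tuple_append)
    then have "stake N (g x ! l) = stake N (x ! l)"
      using st[OF xe(1) z(1) d(1)] st[OF xe(2) z(2) e(1)] by simp
    then show False using N by simp
  qed
  \<comment> \<open>Only one half of each cell is kept. The discarded half of \<open>?d\<close>
    shows that the two cones do not cover the space.\<close>
  let ?u = "ext ?d 0 False" and ?v = "ext ?e 0 False" and ?w = "ext ?d 0 True"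
  have W: "?u \<in> W" "?v \<in> W" "?w \<in> W" using d e by auto
  have uv: "disj ?u ?v" using disj_extend[OF de] d e by auto
  obtain os where os: "cells (?u # ?v # os)" "cover (?u # ?v # os)"
    using complement_cells[OF W(1,2) uv] by blast
  have "os \<noteq> []"
  proof
    assume "os = []"
    obtain z where z: "z \<in> cone m ?w" using cone_ne by blast
    then have "z \<in> C" using cone_C W by blast
    then have "z \<in> cone m ?u \<or> z \<in> cone m ?v" using os(2) \<open>os = []\<close> by (auto simp: cover_def)
    moreover have "disj ?w ?u" "disj ?w ?v" using disj_ext d m disj_extend[OF de] e by auto
    ultimately show False using z by (auto simp: disj_def)
  qed
  moreover have "replaces g ?u ?v" using replaces_append e d by blast
  ultimately show ?thesis using that W os by blast
qed

lemma cell_perm_pre_off: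
  assumes "\<And>i. i < length es \<Longrightarrow> disj (es ! i) r"
  shows "replaces (cell_perm es \<pi>) r r"
  unfolding replaces_def
proof (intro ballI cell_perm_off)
  fix w assume "w \<in> C"
  then show "off es (r \<frown> w)" using assms disj_off by (simp add: off_def)
qed

text \<open>The supports are disjoint; both products equal one permutation of the concatenated list
  of cells.\<close>

lemma cell_perm_commute:
  assumes c: "cells (es @ fs)"
    and p: "\<And>i. i < length es \<Longrightarrow> \<pi> i < length es" and r: "\<And>i. i < length fs \<Longrightarrow> \<rho> i < length fs"
  shows "cell_perm es \<pi> \<circ> cell_perm fs \<rho> = cell_perm fs \<rho> \<circ> cell_perm es \<pi>"
proof -
  let ?n = "length es"
  let ?s = "\<lambda>i. if i < ?n then \<pi> i else ?n + \<rho> (i - ?n)"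
  have ce: "cells es" "cells fs" "\<And>a b. a \<in> set es \<Longrightarrow> b \<in> set fs \<Longrightarrow> disj a b"
    using c by (auto simp: cells_append)
  have e: "replaces (cell_perm fs \<rho>) (es ! i) (es ! i)" if "i < ?n" for i
    using that ce(3) by (intro cell_perm_pre_off) (auto intro: disj_sym)
  have f: "replaces (cell_perm es \<pi>) (fs ! i) (fs ! i)" if "i < length fs" for i
    using that ce(3) by (intro cell_perm_pre_off) auto
  have off: "off es x \<and> off fs x" if "off (es @ fs) x" for x
    unfolding off_def
  proof (intro conjI allI impI)
    fix i
    show "x \<notin> cone m (es ! i)" if "i < length es" 
      using \<open>off (es @ fs) x\<close>[unfolded off_def, rule_format, of i] that by (simp add: List.nth_append)
    show "x \<notin> cone m (fs ! i)" if "i < length fs" 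
      using \<open>off (es @ fs) x\<close>[unfolded off_def, rule_format, of "?n + i"] that by (simp add: List.nth_append)
  qed
  have W: "es ! i \<in> W" if "i < ?n" for i using cellsD ce that by blast
  have W': "fs ! i \<in> W" if "i < length fs" for i using cellsD ce that by blast
  have "cell_perm es \<pi> \<circ> cell_perm fs \<rho> = cell_perm (es @ fs) ?s"
  proof (rule cell_perm_eqI[OF c])
    fix i assume i: "i < length (es @ fs)"
    show "replaces (cell_perm es \<pi> \<circ> cell_perm fs \<rho>) ((es @ fs) ! i) ((es @ fs) ! ?s i)"
    proof (cases "i < ?n")
      case True
      then show ?thesis using replaces_comp[OF e cell_perm_pre[OF ce(1), of i \<pi>]] W p by (simp add: List.nth_append)
    next
      case False
      then have "i - ?n < length fs" using i by auto
      then show ?thesis using replaces_comp[OF cell_perm_pre[OF ce(2), of "i - ?n" \<rho>] f] W' r False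
        by (simp add: List.nth_append)
    qed
  next
    fix x assume "off (es @ fs) x"
    then show "(cell_perm es \<pi> \<circ> cell_perm fs \<rho>) x = x" using off by (simp add: cell_perm_off)
  qed
  moreover have "cell_perm fs \<rho> \<circ> cell_perm es \<pi> = cell_perm (es @ fs) ?s"
  proof (rule cell_perm_eqI[OF c])
    fix i assume i: "i < length (es @ fs)"
    show "replaces (cell_perm fs \<rho> \<circ> cell_perm es \<pi>) ((es @ fs) ! i) ((es @ fs) ! ?s i)"
    proof (cases "i < ?n")
      case True
      then show ?thesis using replaces_comp[OF cell_perm_pre[OF ce(1), of i \<pi>] e] W p by (simp add: List.nth_append)
    next
      case False
      then have "i - ?n < length fs" using i by auto
      then show ?thesis using replaces_comp[OF f cell_perm_pre[OF ce(2), of "i - ?n" \<rho>]] W' r False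
        by (simp add: List.nth_append)
    qed
  next
    fix x assume "off (es @ fs) x"
    then show "(cell_perm fs \<rho> \<circ> cell_perm es \<pi>) x = x" using off by (simp add: cell_perm_off)
  qed
  ultimately show ?thesis by simp
qed

text \<open>The product of the three-cycle (0 1 2) and the transpositions (3 4), (5 6) and so on.
  Its third power keeps only the transpositions and its fourth power only the three-cycle. Below an
  odd bound of at least 3, all pairs are complete.\<close>

definition order_six :: "nat \<Rightarrow> nat" where
  "order_six i = (if i < 3 then rot3 i else if odd i then Suc i else i - 1)"

lemma order_six_odd: "order_six (3 + 2 * q) = 4 + 2 * q" and order_six_even: "order_six (4 + 2 * q) = 3 + 2 * q"
  by (simp_all add: order_six_def)

lemma order_six_cases:
  obtains "i < 3" "order_six i = rot3 i" | q where "i = 3 + 2 * q" | q where "i = 4 + 2 * q"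
proof -
  have "i < 3 \<or> (\<exists>q. i = 3 + 2 * q) \<or> (\<exists>q. i = 4 + 2 * q)" by presburger
  then show ?thesis using that by (auto simp: order_six_def)
qed

lemma order_six_lt:
  assumes "odd M" "3 \<le> M" "i < M"
  shows "order_six i < M"
proof (cases i rule: order_six_cases)
  case (2 q)
  then have "4 + 2 * q \<noteq> M" using assms(1) by auto
  then show ?thesis using assms 2 by (simp add: order_six_odd)
qed (use assms in \<open>auto simp: rot3_def order_six_even\<close>)

lemma order_six_six: "3 \<le> i \<Longrightarrow> order_six (order_six i) = i"
  by (cases i rule: order_six_cases) (simp_all add: order_six_odd order_six_even)

lemma order_six_ge: "3 \<le> i \<Longrightarrow> 3 \<le> order_six i"
  by (cases i rule: order_six_cases) (simp_all add: order_six_odd order_six_even)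

lemma order_six_pow3: "(order_six ^^ 3) i = (if i < 3 then i else order_six i)"
proof (cases "i < 3")
  case True
  then have "i = 0 \<or> i = 1 \<or> i = 2" by auto
  then show ?thesis by (auto simp: order_six_def numeral_3_eq_3)
next
  case False
  then show ?thesis using order_six_six[of i] by (simp add: numeral_3_eq_3)
qed

lemma order_six_pow6: "(order_six ^^ 6) i = i"
proof -
  have "(order_six ^^ 6) i = (order_six ^^ 3) ((order_six ^^ 3) i)" by (simp flip: funpow_add comp_apply[of "order_six ^^ 3"])
  also have "\<dots> = i" unfolding order_six_pow3 using order_six_six order_six_ge by (simp add: not_less)
  finally show ?thesis .
qed

lemma order_six_pow4: "(order_six ^^ 4) i = (if i < 3 then rot3 i else i)"
proof -
  have "(order_six ^^ 4) i = order_six ((order_six ^^ 3) i)" by (simp add: numeral_eq_Suc)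
  then show ?thesis using order_six_six[of i] by (simp add: order_six_pow3 not_less) (simp add: order_six_def)
qed

lemma order_six_bij:
  assumes "odd M" "3 \<le> M"
  shows "bij_betw order_six {..<M} {..<M}"
proof -
  have six5: "order_six ((order_six ^^ 5) i) = i" for i using order_six_pow6[of i] by (simp add: numeral_eq_Suc)
  have five6: "(order_six ^^ 5) (order_six i) = i" for i using order_six_pow6[of i] by (simp add: numeral_eq_Suc)
  have "(order_six ^^ n) i < M" if "i < M" for i n
    using that order_six_lt[OF assms] by (induction n) auto
  then show ?thesis using order_six_lt[OF assms]
    by (intro bij_betw_byWitness[where f' = "order_six ^^ 5"]) (auto simp: six5 five6)
qed

lemma rotate_pow: "i < N \<Longrightarrow> ((\<lambda>i. Suc i mod N) ^^ k) i = (i + k) mod N"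
  by (induction k) (auto simp: mod_Suc_eq)

lemma rotate_bij:
  assumes "0 < N"
  shows "bij_betw (\<lambda>i. Suc i mod N) {..<N} {..<N}"
proof -
  have "inj_on (\<lambda>i. Suc i mod N) {..<N}"
    by (auto simp: inj_on_def mod_Suc split: if_splits)
  moreover have "(\<lambda>i. Suc i mod N) ` {..<N} \<subseteq> {..<N}" using assms by auto
  ultimately show ?thesis
    by (simp add: bij_betw_def endo_inj_surj)
qed

end

lemma funpow_comp_commute:
  assumes "f \<circ> g = g \<circ> f"
  shows "(f \<circ> g) ^^ n = f ^^ n \<circ> g ^^ n"
proof
  fix x
  have "g (f y) = f (g y)" for y using assms by (metis comp_apply)
  then have "g ((f ^^ k) y) = (f ^^ k) (g y)" for k y by (induction k) simp_all
  then show "((f \<circ> g) ^^ n) x = (f ^^ n \<circ> g ^^ n) x" by (induction n arbitrary: x) simp_all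
qed

section \<open>Construction of \<open>h\<close> from a cone moved by \<open>g\<close>\<close>

locale mixing = cantor +
  fixes g u v p os
  assumes m_pos: "0 < m"
    and g: "g \<in> carrier (brin_thompson m)"
    and uv: "replaces g u v"
    and uvp: "cells (u # v # p # os)" "cover (u # v # p # os)"
begin

text \<open>Three cells for the three-cycle and two for each of the \<open>2 m\<close> pairs of a
  coordinate and a digit.\<close>

definition M where "M = 4 * m + 3"
definition xs where "xs = comb (4 * m + 2)"
text \<open>The number of cells of \<open>cs\<close> outside \<open>p\<close>; dividing
  \<open>p\<close> suitably then adjusts the total number.\<close>

definition r where "r = M + length os"

text \<open>The constant \<open>5 r + 6\<close> gives \<open>cs\<close> the length \<open>6 r + 7\<close>, which is 1 modulo the order of \<open>a\<close>.\<close>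

definition cs where
  "cs = map (\<lambda>x. v \<odot> x) xs @ map (\<lambda>x. p \<odot> x) (comb (5 * r + 6)) @ os"

text \<open>
  The words at the even indices \<open>4 + 2 t\<close> carry an additional letter, where \<open>t\<close> runs through
  all pairs of a coordinate and a digit.
\<close>

definition ys where
  "ys = map (\<lambda>i. if i < 3 \<or> odd i then xs ! i
     else ext (xs ! i) ((i - 4) div 4) (odd ((i - 4) div 2))) [0..<M]"

definition fs where "fs = map (\<lambda>x. u \<odot> x) ys"
definition ds where "ds = map (\<lambda>x. v \<odot> x) ys"
definition a where "a = cell_perm fs order_six"
definition b where "b = cell_perm cs (\<lambda>i. Suc i mod length cs)"
definition h where "h = a \<circ> b"

lemma W: "u \<in> W" "v \<in> W" "p \<in> W" "set os \<subseteq> W"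
  using uvp(1) by (auto simp: cells_iff)

lemma length_cs: "length cs = 6 * r + 7"
  by (simp add: cs_def xs_def r_def M_def)

lemma M_le: "M \<le> r" by (simp add: r_def)

lemma length_xs: "length xs = M" by (simp add: xs_def M_def)
lemma length_ys: "length ys = M" by (simp add: ys_def)
lemma length_fs: "length fs = M" by (simp add: fs_def length_ys)
lemma length_ds: "length ds = M" by (simp add: ds_def length_ys)

lemma cells_xs: "cells xs" unfolding xs_def by (rule cells_comb[OF m_pos])

lemma xs_W: "i < M \<Longrightarrow> xs ! i \<in> W" using cellsD[OF cells_xs] by (simp add: length_xs)

lemma cs_v: "i < M \<Longrightarrow> cs ! i = v \<odot> xs ! i"
  by (simp add: cs_def List.nth_append length_xs)

lemma cells_comb_W: "x \<in> set (comb k) \<Longrightarrow> x \<in> W"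
  using cells_comb[OF m_pos, of k] by (auto simp: cells_iff)

lemma set_cs: "c \<in> set cs \<Longrightarrow> (\<exists>x\<in>set xs. c = v \<odot> x) \<or> (\<exists>x\<in>W. c = p \<odot> x) \<or> c \<in> set os"
  using cells_comb_W by (auto simp: cs_def)

lemma cells_cs: "cells cs"
proof -
  have d: "disj v p" "\<And>o'. o' \<in> set os \<Longrightarrow> disj v o'" "\<And>o'. o' \<in> set os \<Longrightarrow> disj p o'" "cells os"
    using uvp(1) by (auto simp: cells_Cons)
  have xW: "x \<in> W" if "x \<in> set xs" for x using that cells_comb_W unfolding xs_def by blast
  show ?thesis
    unfolding cs_def cells_append
    using cells_map[OF W(2) cells_xs] cells_map[OF W(3) cells_comb[OF m_pos]] d W xW cells_comb_W
    by (auto intro: disj_extend disj_extend_l)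
qed

lemma cs_W: "i < length cs \<Longrightarrow> cs ! i \<in> W" using cellsD[OF cells_cs] .

lemma disj_u_cs: "c \<in> set cs \<Longrightarrow> disj u c"
proof -
  assume c: "c \<in> set cs"
  have "disj u v" "disj u p" "\<And>o'. o' \<in> set os \<Longrightarrow> disj u o'" using uvp(1) by (auto simp: cells_Cons)
  then show ?thesis
    using set_cs[OF c] W xs_W cells_comb_W by (auto intro!: disj_extend_r simp: xs_def)
qed

lemma disj_v_cs:
  assumes "M \<le> i" "i < length cs"
  shows "disj v (cs ! i)"
proof -
  have d: "disj v p" "\<And>o'. o' \<in> set os \<Longrightarrow> disj v o'" using uvp(1) by (auto simp: cells_Cons)
  have "cs ! i = (map (\<lambda>x. p \<odot> x) (comb (5 * r + 6)) @ os) ! (i - M)"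
    using assms by (simp add: cs_def List.nth_append length_xs)
  moreover have "i - M < length (map (\<lambda>x. p \<odot> x) (comb (5 * r + 6)) @ os)"
    using assms by (simp add: cs_def length_xs)
  ultimately have "cs ! i \<in> set (map (\<lambda>x. p \<odot> x) (comb (5 * r + 6)) @ os)"
    by (metis nth_mem)
  then show ?thesis using d cells_comb_W W by (auto intro!: disj_extend_r)
qed

lemma cover_cs: "C \<subseteq> (\<Union>c\<in>set cs \<union> (\<lambda>x. u \<odot> x) ` set xs. cone m c)"
proof
  fix x assume "x \<in> C"
  then have "x \<in> cone m u \<or> x \<in> cone m v \<or> x \<in> cone m p \<or> (\<exists>c\<in>set os. x \<in> cone m c)"
    using uvp(2) by (auto simp: cover_def)
  then show "x \<in> (\<Union>c\<in>set cs \<union> (\<lambda>x. u \<odot> x) ` set xs. cone m c)"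
    using cone_comb[OF m_pos W(1), of "4 * m + 2"] cone_comb[OF m_pos W(2), of "4 * m + 2"]
      cone_comb[OF m_pos W(3), of "5 * r + 6"] by (auto simp: cs_def xs_def)
qed

lemma ys_nth: "i < M \<Longrightarrow> ys ! i = (if i < 3 \<or> odd i then xs ! i
     else ext (xs ! i) ((i - 4) div 4) (odd ((i - 4) div 2)))"
  by (simp add: ys_def)

lemma cells_ys: "cells ys"
proof -
  have "ys ! i \<in> W" if "i < M" for i using that xs_W by (simp add: ys_nth)
  moreover have "disj (ys ! i) (ys ! j)" if "i < M" "j < M" "i \<noteq> j" for i j
  proof -
    have "disj (xs ! i) (xs ! j)" using cells_disj[OF cells_xs] that by (simp add: length_xs)
    then show ?thesis using that xs_W by (simp add: ys_nth disj_extend disj_extend_l disj_extend_r)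
  qed
  ultimately show ?thesis by (simp add: cells_def length_ys)
qed

lemma ys_W: "i < M \<Longrightarrow> ys ! i \<in> W" using cellsD[OF cells_ys] by (simp add: length_ys)

lemma cells_fs: "cells fs" unfolding fs_def by (rule cells_map[OF W(1) cells_ys])
lemma cells_ds: "cells ds" unfolding ds_def by (rule cells_map[OF W(2) cells_ys])

lemma ds_odd: "i < M \<Longrightarrow> i < 3 \<or> odd i \<Longrightarrow> ds ! i = cs ! i"
  by (simp add: ds_def length_ys ys_nth cs_v)

lemma ds_even: "4 + 2 * t < M \<Longrightarrow> ds ! (4 + 2 * t) = ext (cs ! (4 + 2 * t)) (t div 2) (odd t)"
  using xs_W W by (simp add: ds_def length_ys ys_nth cs_v tuple_append_assoc)

lemma ds_extends: "i < M \<Longrightarrow> \<exists>x\<in>W. ds ! i = cs ! i \<odot> x"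
proof (cases "i < 3 \<or> odd i")
  case True
  assume "i < M"
  then show ?thesis using ds_odd True cs_W M_le length_cs by (intro bexI[of _ eps]) auto
next
  case False
  assume i: "i < M"
  have "\<exists>t. i = 4 + 2 * t" using False by presburger
  then show ?thesis using ds_even i by blast
qed

lemma M_odd: "odd M" "3 \<le> M" by (simp_all add: M_def)

lemma M_less: "M + 1 < length cs" using M_le length_cs by simp

lemma order_six_fs: "bij_betw order_six {..<length fs} {..<length fs}"
  using order_six_bij[OF M_odd] by (simp add: length_fs)

lemma rotate_cs: "bij_betw (\<lambda>i. Suc i mod length cs) {..<length cs} {..<length cs}"
  by (rule rotate_bij) (simp add: length_cs)

lemma h_carrier: "h \<in> carrier G"
  unfolding h_def a_def b_def
  by (intro comp_carrier cell_perm_carrier cells_fs cells_cs order_six_fs rotate_cs)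

lemma order_six_pow: "order_six ^^ (6 * n + 1) = order_six"
proof -
  have "(order_six ^^ (6 * n)) = id"
  proof (induction n)
    case (Suc n)
    have "order_six ^^ (6 * Suc n) = order_six ^^ 6 \<circ> order_six ^^ (6 * n)" by (simp flip: funpow_add)
    then show ?case using Suc order_six_pow6 by (auto simp: fun_eq_iff)
  qed simp
  then show ?thesis by simp
qed

text \<open>The cells moved by \<open>a\<close> lie in \<open>u\<close> and those moved by
  \<open>b\<close> lie outside it, so the two commute. The exponent is the order of the rotation
  \<open>b\<close> and is 1 modulo 6, so only \<open>a\<close> remains.\<close>

lemma h_pow: "h ^^ length cs = a"
proof -
  have "disj x c" if x: "x \<in> set fs" and c: "c \<in> set cs" for x c
  proof -
    obtain y where "y \<in> W" "x = u \<odot> y" using x cells_ys by (auto simp: fs_def cells_iff)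
    then show ?thesis using disj_extend_l[OF disj_u_cs[OF c]] W by simp
  qed
  then have "cells (fs @ cs)" using cells_fs cells_cs by (simp add: cells_append)
  then have comm: "a \<circ> b = b \<circ> a"
    unfolding a_def b_def
    by (rule cell_perm_commute) (auto simp: length_fs length_cs order_six_lt[OF M_odd])
  have "h ^^ length cs = a ^^ length cs \<circ> b ^^ length cs"
    unfolding h_def by (rule funpow_comp_commute[OF comm])
  also have "b ^^ length cs = id"
    unfolding b_def using rotate_pow[of _ "length cs" "length cs"]
    by (subst cell_perm_funpow[OF cells_cs]) (auto intro!: cell_perm_id[OF cells_cs] simp: length_cs)
  also have "a ^^ length cs = a"
  proof -
    have "length cs = 6 * (r + 1) + 1" by (simp add: length_cs)
    then have "order_six ^^ length cs = order_six" using order_six_pow by metis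
    then show ?thesis unfolding a_def using cell_perm_funpow[OF cells_fs, of order_six] order_six_lt[OF M_odd] length_fs by simp
  qed
  finally show ?thesis by simp
qed

lemma conj_a: "g \<circ> a \<circ> pinv g = cell_perm ds order_six"
  unfolding a_def
proof (rule cell_perm_conj[OF cells_fs cells_ds _ order_six_fs carrier_bij[OF g]])
  show "length ds = length fs" by (simp add: length_fs length_ds)
  fix i assume "i < length fs"
  then show "replaces g (fs ! i) (ds ! i)"
    using replaces_append[OF uv W(1,2) ys_W] by (simp add: fs_def ds_def length_ys)
qed

section \<open>The subgroup generated by \<open>g\<close> and \<open>h\<close>\<close>

definition K where "K = generate G {g, h}"

lemma gh: "{g, h} \<subseteq> carrier G" using g h_carrier by simp

lemma subgroup_K: "subgroup K G"
  unfolding K_def by (rule group.generate_is_subgroup[OF group_G gh])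

lemma K_gens: "g \<in> K" "h \<in> K" unfolding K_def by (auto intro: generate.incl)

sublocale cycle_subgroup m K cs
  by (intro cycle_subgroup.intro cantor_subgroup.intro cycle_subgroup_axioms.intro)
    (use subgroup_K cells_cs length_cs M_le M_def m_pos in simp_all)

lemma a_K: "a \<in> K" using subgroup_funpow[OF subgroup_K K_gens(2)] h_pow by metis

lemma b_K: "b \<in> K"
proof -
  have "inj a" using a_K subgroup_carrier[OF subgroup_K] carrier_bij bij_is_inj by blast
  then have "b = pinv a \<circ> h" by (simp add: h_def comp_assoc[symmetric])
  then show ?thesis using subgroup_comp[OF subgroup_K subgroup_pinv[OF subgroup_K a_K] K_gens(2)] by simp
qed

lemma ds_six_K: "cell_perm ds order_six \<in> K"
  using subgroup_conj[OF subgroup_K K_gens(1) a_K] conj_a by simp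

lemma order_six_pow_ds: "cell_perm ds order_six ^^ n = cell_perm ds (order_six ^^ n)"
  by (rule cell_perm_funpow[OF cells_ds]) (simp add: length_ds order_six_lt[OF M_odd])

text \<open>The fourth power of the conjugate of \<open>a\<close> is this cycle, as the first three
  cells of \<open>ds\<close> and \<open>cs\<close> agree.\<close>

lemma cone_cycle_012: "cone_cycle (cs ! 0) (cs ! 1) (cs ! 2) \<in> K"
proof -
  have "cone_cycle (cs ! 0) (cs ! 1) (cs ! 2) = cell_perm ds (order_six ^^ 4)"
  proof (rule cell_perm_eqI[OF cells_ds])
    have ds3: "ds ! 0 = cs ! 0" "ds ! 1 = cs ! 1" "ds ! 2 = cs ! 2"
      using ds_odd M_odd by auto
    have c3: "cells [cs ! 0, cs ! 1, cs ! 2]"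
      using cs_W cells_disj[OF cells_cs] length_cs by (simp add: cells3)
    fix i assume i: "i < length ds"
    consider "i = 0" | "i = 1" | "i = 2" | "3 \<le> i" by linarith
    then show "replaces (cone_cycle (cs ! 0) (cs ! 1) (cs ! 2)) (ds ! i) (ds ! (order_six ^^ 4) i)"
    proof cases
      case 4
      have "disj (cs ! j) (ds ! i)" if "j < 3" for j
        using that 4 cells_disj[OF cells_ds, of j i] i ds_odd[of j] length_ds by simp
      then show ?thesis using 4 by (auto simp: order_six_pow4 intro!: cone_cycle_pre_off)
    qed (use cone_cycle_pre[OF c3] ds3 in \<open>simp_all add: order_six_pow4\<close>)
  next
    fix x assume x: "off ds x"
    have "x \<notin> cone m (cs ! j)" if "j < 3" for j
    proof -
      have "j < M" using that M_odd by simp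
      then have "x \<notin> cone m (ds ! j)" using x by (simp add: off_def length_ds)
      then show ?thesis using ds_odd[OF \<open>j < M\<close>] that by simp
    qed
    then show "cone_cycle (cs ! 0) (cs ! 1) (cs ! 2) x = x" by (intro cone_cycle_off) auto
  qed
  then show ?thesis using subgroup_funpow[OF subgroup_K ds_six_K, of 4] by (simp add: order_six_pow_ds)
qed

lemma cone_cycle_cs:
  assumes "i < length cs" "j < length cs" "k < length cs" "distinct [i, j, k]"
  shows "cone_cycle (cs ! i) (cs ! j) (cs ! k) \<in> K"
  by (rule alternating[OF cone_cycle_012 b_K[unfolded b_def] assms])

text \<open>The third power of the conjugate of \<open>a\<close> is a product of disjoint
  transpositions. A conjugate that differs from it in one cell, multiplied with it, cancels all
  other pairs; two transpositions with a common cell remain, whose product is a three-cycle.\<close>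

lemma cone_cycle_letter:
  assumes l: "l < m"
  shows "\<exists>i j k. i < length cs \<and> j < length cs \<and> k < length cs \<and> distinct [i, j, k] \<and>
    cone_cycle (cs ! i) (ext (cs ! j) l c) (ext (cs ! k) l c) \<in> K"
proof -
  \<comment> \<open>The number of the pair of \<open>l\<close> and \<open>c\<close> in
    \<open>ys\<close>: the coordinate is \<open>t div 2\<close> and the digit is the parity. Its
    transposition exchanges the indices \<open>i\<close> and \<open>k\<close>.\<close>
  define t where "t = 2 * l + (if c then 1 else 0)"
  define i where "i = 3 + 2 * t"
  define k where "k = 4 + 2 * t"
  have t: "t div 2 = l" "odd t \<longleftrightarrow> c" by (auto simp: t_def)
  have ik: "i < M" "k < M" "i \<noteq> k" using l by (auto simp: i_def k_def t_def M_def)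
  have lt: "i < length cs" "k < length cs" "M < length cs" using ik M_less by auto
  \<comment> \<open>Cells \<open>M\<close> and \<open>M + 1\<close> are not among the first
    \<open>M\<close> cells, which contain those of \<open>ds\<close>. So among the cells of
    \<open>ds\<close> only the one with index \<open>k\<close> is moved.\<close>
  define y where "y = cone_cycle (cs ! k) (cs ! M) (cs ! (M + 1))"
  have ck: "cells [cs ! k, cs ! M, cs ! (M + 1)]"
    using cs_W cells_disj[OF cells_cs] lt ik M_less by (simp add: cells3)
  have y: "y \<in> K" "bij y" "replaces y (cs ! k) (cs ! M)"
  proof -
    show "y \<in> K" unfolding y_def using lt ik M_less by (intro cone_cycle_cs) auto
    then show "bij y" using subgroup_carrier[OF subgroup_K] carrier_bij by blast
    show "replaces y (cs ! k) (cs ! M)" unfolding y_def by (rule cone_cycle_pre[OF ck])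
  qed
  define e where "e = cs ! i"
  define d where "d = ext (cs ! k) l c"
  define f where "f = ext (cs ! M) l c"
  have dsi: "ds ! i = e" using ds_odd ik by (simp add: e_def i_def)
  have dsk: "ds ! k = d" using ds_even[of t] ik t by (simp add: d_def k_def)
  have eW: "e \<in> W" "d \<in> W" "f \<in> W" using cs_W lt by (auto simp: e_def d_def f_def)
  have dsd: "disj (ds ! j) (ds ! j')" if "j < M" "j' < M" "j \<noteq> j'" for j j'
    using cells_disj[OF cells_ds] that by (simp add: length_ds)
  have dsc: "disj (ds ! j) (cs ! j')" if jj: "j < M" "j' < length cs" "j \<noteq> j'" for j j'
  proof -
    obtain x where "x \<in> W" "ds ! j = cs ! j \<odot> x" using ds_extends jj by blast
    then show ?thesis using disj_extend_l cells_disj[OF cells_cs, of j j'] cs_W jj M_less by auto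
  qed
  have dsf: "disj (ds ! j) f" if "j < M" for j
    unfolding f_def using dsc[OF that lt(3)] cs_W lt that by (intro disj_extend_r) auto
  define ds' where "ds' = ds[k := f]"
  have ds': "ds' ! j = (if j = k then f else ds ! j)" if "j < M" for j
    using that by (simp add: ds'_def length_ds)
  have len': "length ds' = M" by (simp add: ds'_def length_ds)
  have c': "cells ds'"
    unfolding cells_def len'
  proof (intro conjI allI impI)
    show "ds' ! j \<in> W" if "j < M" for j
      using that cellsD[OF cells_ds] eW by (simp add: ds' length_ds)
    show "disj (ds' ! j) (ds' ! j')" if "j < M" "j' < M" "j \<noteq> j'" for j j'
      using that dsd dsf disj_sym[OF dsf] by (simp add: ds')
  qed
  let ?q = "order_six ^^ 3"
  have q: "?q j < M" if "j < M" for j using that order_six_lt[OF M_odd] by (simp add: order_six_pow3)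
  have qq: "?q (?q j) = j" for j using order_six_pow6[of j] by (simp flip: funpow_add comp_apply[of ?q])
  have qb: "bij_betw ?q {..<M} {..<M}"
    by (rule bij_betw_byWitness[where f' = ?q]) (auto simp: q qq)
  have qi: "?q i = k" "?q k = i" by (simp_all add: order_six_pow3 i_def k_def order_six_odd order_six_even)
  have conj: "y \<circ> cell_perm ds ?q \<circ> pinv y = cell_perm ds' ?q"
  proof (rule cell_perm_conj[OF cells_ds c' _ _ y(2)])
    fix j assume "j < length ds"
    then have j: "j < M" by (simp add: length_ds)
    show "replaces y (ds ! j) (ds' ! j)"
    proof (cases "j = k")
      case True
      then show ?thesis using replaces_append[OF y(3), of "letter l c"] cs_W lt j
        by (simp add: ds' dsk d_def f_def)
    next
      case False
      then show ?thesis unfolding y_def using j ik M_less dsc[OF j] lt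
        by (auto simp: ds' intro!: cone_cycle_pre_off disj_sym[OF dsc])
    qed
  qed (simp_all add: length_ds len' qb)
  have sK: "cell_perm ds ?q \<in> K" using subgroup_funpow[OF subgroup_K ds_six_K, of 3] by (simp add: order_six_pow_ds)
  have "cell_perm ds ?q \<circ> cell_perm ds' ?q \<in> K"
    using subgroup_comp[OF subgroup_K sK subgroup_conj[OF subgroup_K y(1) sK]] conj by simp
  moreover have "cell_perm ds ?q \<circ> cell_perm ds' ?q = cone_cycle e f d"
    unfolding cone_cycle_def
  proof (rule cell_perm_eqI)
    have s: "replaces (cell_perm ds ?q) e d" "replaces (cell_perm ds ?q) d e"
      using cell_perm_pre[OF cells_ds, of i ?q] cell_perm_pre[OF cells_ds, of k ?q] ik
      by (simp_all add: length_ds qi dsi dsk)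
    have sf: "replaces (cell_perm ds ?q) f f" using dsf by (intro cell_perm_pre_off) (simp add: length_ds)
    have s': "replaces (cell_perm ds' ?q) e f" "replaces (cell_perm ds' ?q) f e"
      using cell_perm_pre[OF c', of i ?q] cell_perm_pre[OF c', of k ?q] ik
      by (simp_all add: len' qi ds' dsi)
    have sd: "replaces (cell_perm ds' ?q) d d"
      using dsd[of _ k] ik disj_sym[OF dsf[of k]]
      by (intro cell_perm_pre_off) (auto simp: len' ds' simp flip: dsk)
    show "cells [e, f, d]"
      using eW dsf[of i] disj_sym[OF dsf[of k]] dsd[of i k] ik by (simp add: cells3 dsi dsk)
    fix j assume "j < length [e, f, d]"
    then consider "j = 0" | "j = 1" | "j = 2" by fastforce
    then show "replaces (cell_perm ds ?q \<circ> cell_perm ds' ?q) ([e, f, d] ! j) ([e, f, d] ! rot3 j)"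
      using replaces_comp[OF s'(1) sf] replaces_comp[OF s'(2) s(1)] replaces_comp[OF sd s(2)] eW
      by cases simp_all
  next
    fix x assume "off [e, f, d] x"
    then have "x \<notin> cone m ([e, f, d] ! 0)" "x \<notin> cone m ([e, f, d] ! 1)" "x \<notin> cone m ([e, f, d] ! 2)"
      unfolding off_def by fastforce+
    then have x: "x \<notin> cone m e" "x \<notin> cone m f" "x \<notin> cone m d" by simp_all
    show "(cell_perm ds ?q \<circ> cell_perm ds' ?q) x = x"
    proof (cases x rule: on_or_off[of ds'])
      \<comment> \<open>Such a point lies in a pair other than that of \<open>i\<close> and
        \<open>k\<close>; both factors exchange this pair in the same way, so the point
        returns.\<close>
      case (on j w)
      then have j: "j < M" by (simp add: len')
      have jk: "j \<noteq> k" using on x(2) by (auto simp: ds' j)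
      then have xj: "x = ds ! j \<frown> w" using on j by (simp add: ds')
      have ji: "j \<noteq> i" using xj on x(1) dsi by auto
      have "?q j \<noteq> k" using ji qq[of j] qi by metis
      then have "cell_perm ds' ?q x = ds ! ?q j \<frown> w"
        using preD[OF cell_perm_pre[OF c' on(1), of ?q] on(2)] on(3) q[OF j] by (simp add: ds')
      moreover have "cell_perm ds ?q (ds ! ?q j \<frown> w) = ds ! j \<frown> w"
        using preD[OF cell_perm_pre[OF cells_ds, of "?q j" ?q] on(2)] q[OF j] qq[of j] by (simp add: length_ds)
      ultimately show ?thesis using xj by simp
    next
      case off
      have "off ds x"
        unfolding off_def
      proof (intro allI impI)
        fix j assume "j < length ds"
        then show "x \<notin> cone m (ds ! j)"
          using off x(3) dsk by (cases "j = k") (auto simp: off_def len' ds' length_ds)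
      qed
      then show ?thesis using off by (simp add: cell_perm_off)
    qed
  qed
  ultimately have "cone_cycle (cs ! i) (ext (cs ! M) l c) (ext (cs ! k) l c) \<in> K"
    by (simp add: e_def d_def f_def)
  moreover have "distinct [i, M, k]" using ik by auto
  ultimately show ?thesis using lt by blast
qed

lemma cone_cycle_cs_deep:
  assumes "i < length cs" "j < length cs" "k < length cs" "distinct [i, j, k]" "x \<in> W" "y \<in> W" "z \<in> W"
  shows "cone_cycle (cs ! i \<odot> x) (cs ! j \<odot> y) (cs ! k \<odot> z) \<in> K"
proof (rule cone_cycle_deep[OF _ _ assms])
  fix i j k assume "i < length cs" "j < length cs" "k < length cs" "distinct [i, j, k]"
  then show "cone_cycle (cs ! i) (cs ! j) (cs ! k) \<in> K" by (rule cone_cycle_cs)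
next
  fix i j k l c
  assume *: "i < length cs" "j < length cs" "k < length cs" "distinct [i, j, k]" "l < m"
  obtain i' j' k' where i': "i' < length cs" "j' < length cs" "k' < length cs" "distinct [i', j', k']"
    "cone_cycle (cs ! i') (ext (cs ! j') l c) (ext (cs ! k') l c) \<in> K"
    using cone_cycle_letter[OF *(5)] by blast
  show "cone_cycle (cs ! i) (ext (cs ! j) l c) (ext (cs ! k) l c) \<in> K"
    by (rule cone_cycle_shift_all[OF _ i' *(1-4) letter_W]) (rule cone_cycle_cs)
qed

text \<open>The cones inside a cell of \<open>cs\<close> or of a division of \<open>u\<close>.
  Dividing \<open>u\<close> by the same words \<open>xs\<close> as \<open>v\<close> ensures that
  \<open>g\<close> takes each cell in \<open>u\<close> to a cell of \<open>cs\<close>.\<close>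

definition S where
  "S = {c \<odot> x | c x. c \<in> set cs \<union> (\<lambda>x. u \<odot> x) ` set xs \<and> x \<in> W}"

lemma S_cells_W: "set cs \<union> (\<lambda>x. u \<odot> x) ` set xs \<subseteq> W"
  using cells_cs cells_xs W by (auto simp: cells_iff)

lemma S_append: "q \<in> S \<Longrightarrow> x \<in> W \<Longrightarrow> q \<odot> x \<in> S"
proof -
  assume "q \<in> S" "x \<in> W"
  then obtain c y where c: "c \<in> set cs \<union> (\<lambda>x. u \<odot> x) ` set xs" "y \<in> W" "q = c \<odot> y" by (auto simp: S_def)
  then have "c \<in> W" using S_cells_W by blast
  then have "q \<odot> x = c \<odot> (y \<odot> x)" using c \<open>x \<in> W\<close> tuple_append_assoc by simp
  then show "q \<odot> x \<in> S" using c \<open>x \<in> W\<close> unfolding S_def by blast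
qed

lemma S_deep: "\<exists>L. \<forall>q\<in>W. (\<forall>l<m. L \<le> length (q ! l)) \<longrightarrow> q \<in> S"
proof -
  let ?A = "set cs \<union> (\<lambda>x. u \<odot> x) ` set xs"
  obtain L where L: "\<And>c l. c \<in> ?A \<Longrightarrow> l < m \<Longrightarrow> length (c ! l) \<le> L"
    using finite_lengths[of ?A] by blast
  have "q \<in> S" if q: "q \<in> W" "\<And>l. l < m \<Longrightarrow> L \<le> length (q ! l)" for q
  proof -
    have "length (c ! l) \<le> length (q ! l)" if "c \<in> ?A" "l < m" for c l
      using order_trans[OF L[OF that] q(2)[OF that(2)]] .
    then obtain c y where "c \<in> ?A" "y \<in> W" "q = c \<odot> y"
      using deep_cover[OF cover_cs S_cells_W q(1)] by metis
    then show ?thesis unfolding S_def by blast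
  qed
  then show ?thesis by blast
qed

lemma S_disj_u:
  assumes "q \<in> S" "disj q u"
  obtains i x where "i < length cs" "x \<in> W" "q = cs ! i \<odot> x"
proof -
  obtain c x where c: "c \<in> set cs \<union> (\<lambda>x. u \<odot> x) ` set xs" "x \<in> W" "q = c \<odot> x"
    using assms(1) by (auto simp: S_def)
  have "c \<in> set cs"
  proof (rule ccontr)
    assume "c \<notin> set cs"
    then obtain y where y: "y \<in> set xs" "c = u \<odot> y" using c by blast
    then have "y \<in> W" using cells_xs by (auto simp: cells_iff)
    then have "cone m q \<subseteq> cone m u"
      using c y W cone_append_sub[of u "y \<odot> x"] by (simp add: tuple_append_assoc)
    then show False using assms(2) cone_ne[of q] by (auto simp: disj_def)
  qed
  then show ?thesis using that c by (auto simp: in_set_conv_nth)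
qed

text \<open>
  A cone inside \<open>u\<close> is moved by \<open>g\<close> into \<open>v\<close>, where three-cycles are already available; their
  remaining two cones are chosen outside \<open>v\<close> so that \<open>g\<^sup>-\<^sup>1\<close> does not move them into \<open>u\<close>.
\<close>

lemma cone_cycle_u:
  assumes x: "x \<in> set xs" and y: "y \<in> W"
  defines "q \<equiv> (u \<odot> x) \<odot> y"
  shows "\<exists>F. finite F \<and> card F \<le> 2 \<and> (\<forall>i<length cs. i \<notin> F \<longrightarrow> disj q (cs ! i)) \<and>
      (\<forall>i<length cs. \<forall>j<length cs. i \<noteq> j \<longrightarrow> i \<notin> F \<longrightarrow> j \<notin> F \<longrightarrow> cone_cycle q (cs ! i) (cs ! j) \<in> K)"
proof -
  have xW: "x \<in> W" using x cells_xs by (auto simp: cells_iff)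
  have q: "q \<in> W" "q = u \<odot> x \<odot> y" using xW y W by (auto simp: q_def tuple_append_assoc)
  have qcs: "disj q c" if "c \<in> set cs" for c
    using disj_extend_l[OF disj_u_cs[OF that]] q(2) xW y W by simp
  obtain i0 where i0: "i0 < M" "x = xs ! i0" using x by (auto simp: in_set_conv_nth length_xs)
  define q' where "q' = cs ! i0 \<odot> y"
  have q': "replaces g q q'"
  proof -
    have "q' = v \<odot> x \<odot> y" using i0 cs_v xW y W by (simp add: q'_def tuple_append_assoc)
    then show ?thesis using replaces_append[OF uv] q(2) xW y W by simp
  qed
  have ginj: "inj g" using g carrier_bij bij_is_inj by blast
  have gi: "pinv g \<in> carrier G" using inv_carrier[OF g] .
  obtain n where n: "\<And>w. w \<in> W \<Longrightarrow> (\<And>l. l < m \<Longrightarrow> n \<le> length (w ! l)) \<Longrightarrow> \<exists>w'\<in>W. replaces (pinv g) w w'"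
    using carrier_deep[OF gi] by blast
  obtain L where L: "\<And>w. w \<in> W \<Longrightarrow> (\<And>l. l < m \<Longrightarrow> L \<le> length (w ! l)) \<Longrightarrow> w \<in> S" using S_deep by blast
  \<comment> \<open>A suffix of length \<open>k\<close> in every coordinate; the digit chosen is
    arbitrary.\<close>
  define z where "z k = replicate m (replicate k True)" for k
  have z: "z k \<in> W" "\<And>l. l < m \<Longrightarrow> length (z k ! l) = k" for k by (auto simp: z_def W_iff)
  \<comment> \<open>Cells with index at least \<open>M\<close> lie outside \<open>v\<close>, so
    their preimages under \<open>g\<close> lie outside \<open>u\<close>. The suffix
    \<open>z n\<close> makes the inverse of \<open>g\<close> act by prefix replacement, and
    \<open>z L\<close> makes the result deep enough to lie in a single cell of
    \<open>cs\<close>.\<close>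
  have preimage: "\<exists>w\<in>W. \<exists>j k x. w \<in> W \<and> j < length cs \<and> x \<in> W \<and> w = cs ! j \<odot> x \<and> replaces (pinv g) (cs ! i \<odot> (z n \<odot> z L)) w"
    if i: "M \<le> i" "i < length cs" for i
  proof -
    have iW: "cs ! i \<in> W" using cs_W i by blast
    obtain w where w: "w \<in> W" "replaces (pinv g) (cs ! i \<odot> z n) w"
      using n[of "cs ! i \<odot> z n"] iW z by (auto simp: nth_tuple_append)
    have pw: "replaces (pinv g) (cs ! i \<odot> (z n \<odot> z L)) (w \<odot> z L)"
      using replaces_append[OF w(2) _ w(1) z(1)] iW z by (simp add: tuple_append_assoc)
    have "w \<odot> z L \<in> S" by (rule L) (use w z in \<open>auto simp: nth_tuple_append\<close>)
    moreover have "disj (w \<odot> z L) u"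
    proof -
      have "disj (cs ! i \<odot> (z n \<odot> z L)) v"
        using disj_extend_l[OF disj_sym[OF disj_v_cs[OF i]]] iW z by simp
      moreover have "inj (pinv g)" using gi carrier_bij bij_is_inj by blast
      ultimately show ?thesis using replaces_disj[OF _ pw replaces_inv[OF ginj uv]] by simp
    qed
    ultimately obtain j x where "j < length cs" "x \<in> W" "w \<odot> z L = cs ! j \<odot> x" by (rule S_disj_u)
    then show ?thesis using pw w(1) z(1) append_W by metis
  qed
  obtain s i1 x1 where s: "s \<in> W" "i1 < length cs" "x1 \<in> W" "s = cs ! i1 \<odot> x1"
    "replaces (pinv g) (cs ! M \<odot> (z n \<odot> z L)) s"
    using preimage[of M] M_less by auto
  obtain t i2 x2 where t: "t \<in> W" "i2 < length cs" "x2 \<in> W" "t = cs ! i2 \<odot> x2"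
    "replaces (pinv g) (cs ! (M + 1) \<odot> (z n \<odot> z L)) t"
    using preimage[of "M + 1"] M_less by auto
  let ?s = "cs ! M \<odot> (z n \<odot> z L)" and ?t = "cs ! (M + 1) \<odot> (z n \<odot> z L)"
  have lt: "i0 < length cs" "M < length cs" "M + 1 < length cs" using i0 M_less by auto
  have zW: "z n \<odot> z L \<in> W" using z by auto
  have gK: "pinv g \<in> K" using subgroup_pinv[OF subgroup_K K_gens(1)] .
  have c': "cells [q', ?s, ?t]"
    using cs_W lt zW y i0 cells_disj[OF cells_cs] by (auto simp: cells3 q'_def intro!: disj_extend)
  have t': "cone_cycle q' ?s ?t \<in> K"
    unfolding q'_def by (rule cone_cycle_cs_deep) (use lt i0 y zW in auto)
  have pq: "replaces (pinv g) q' q" using replaces_inv[OF ginj q'] .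
  have ipi: "inj (pinv g)" using gi carrier_bij bij_is_inj by blast
  have c: "cells [q, s, t]"
    using c' q(1) s(1) t(1) replaces_disj[OF ipi pq s(5)] replaces_disj[OF ipi pq t(5)] replaces_disj[OF ipi s(5) t(5)]
    by (simp add: cells3)
  have qst: "cone_cycle q s t \<in> K"
    using cone_cycle_transport[OF c' c gK pq s(5) t(5)] t' by blast
  \<comment> \<open>\<open>s\<close> is exchanged for cell \<open>i\<close> and \<open>t\<close> for
    cell \<open>j\<close>, with cell \<open>k\<close> as the third member of the conjugating cycles.
    The cells \<open>i1\<close> and \<open>i2\<close>, which contain \<open>s\<close> and
    \<open>t\<close>, must be avoided; they form the exceptional set.\<close>
  have "cone_cycle q (cs ! i) (cs ! j) \<in> K" if ij: "i < length cs" "j < length cs" "i \<noteq> j" "i \<notin> {i1, i2}" "j \<notin> {i1, i2}" for i j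
  proof -
    obtain k where k: "k < length cs" "k \<notin> set [i, j, i1, i2]"
      by (rule fresh_list[of "[i, j, i1, i2]" "length cs"]) (use N in auto)
    have word_cs: "cs ! i \<in> W" "cs ! j \<in> W" "cs ! k \<in> W" using cs_W ij k by auto
    have disj_cs: "disj (cs ! x) (cs ! y)" if "x < length cs" "y < length cs" "x \<noteq> y" for x y
      using cells_disj[OF cells_cs] that .
    have sd: "disj s (cs ! x)" if "x < length cs" "x \<noteq> i1" for x
      using disj_extend_l[OF disj_cs[OF s(2) that(1)]] that s cs_W by auto
    have td: "disj t (cs ! x)" if "x < length cs" "x \<noteq> i2" for x
      using disj_extend_l[OF disj_cs[OF t(2) that(1)]] that t cs_W by auto
    have qd: "disj q (cs ! x)" if "x < length cs" for x using qcs that by simp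
    have st: "disj q s" "disj q t" "disj s t" using c by (auto simp: cells3)
    have "cone_cycle s (cs ! i) (cs ! k) \<in> K"
      using cone_cycle_cs_deep[of i1 i k x1 eps eps] s ij k word_cs by auto
    moreover have "cells [s, cs ! i, cs ! k]" using s(1) word_cs sd ij k disj_cs by (auto simp: cells3)
    moreover have "cells [s, t, q]" using st s(1) t(1) q(1) by (auto simp: cells3 intro: disj_sym)
    ultimately have "cone_cycle s t q \<in> K \<longleftrightarrow> cone_cycle (cs ! i) t q \<in> K"
      by (intro cone_cycle_move) (use ij k td qd in \<open>auto intro: disj_sym\<close>)
    then have itq: "cone_cycle (cs ! i) t q \<in> K" using cone_cycle_rotate[OF c] qst by simp
    have c1: "cells [cs ! i, t, q]" using st word_cs t(1) q(1) td qd ij by (auto simp: cells3 intro: disj_sym)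
    then have c2: "cells [t, q, cs ! i]" by (auto simp: cells3 intro: disj_sym)
    have "cone_cycle t (cs ! j) (cs ! k) \<in> K"
      using cone_cycle_cs_deep[of i2 j k x2 eps eps] t ij k word_cs by auto
    moreover have "cells [t, cs ! j, cs ! k]" using t(1) word_cs td ij k disj_cs by (auto simp: cells3)
    ultimately have "cone_cycle t q (cs ! i) \<in> K \<longleftrightarrow> cone_cycle (cs ! j) q (cs ! i) \<in> K"
      by (intro cone_cycle_move[OF c2]) (use ij k disj_cs qd in \<open>auto intro: disj_sym\<close>)
    then have "cone_cycle (cs ! j) q (cs ! i) \<in> K" using cone_cycle_rotate[OF c1] itq by simp
    moreover have "cells [cs ! j, q, cs ! i]" using word_cs q(1) qd disj_cs ij by (auto simp: cells3 intro: disj_sym)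
    ultimately show ?thesis using cone_cycle_rotate by metis
  qed
  then show ?thesis
    by (intro exI[of _ "{i1, i2}"]) (use qcs in \<open>auto simp: card_insert_if\<close>)
qed

text \<open>Each cone in \<open>S\<close> forms cycles in \<open>K\<close> with all but at most two
  cells, so \<open>all_tris_in\<close> gives all three-cycles within \<open>S\<close>. These yield
  all swaps, and the swaps yield the group.\<close>

lemma generates: "K = carrier G"
proof
  show "K \<subseteq> carrier G" using subgroup_K subgroup.subset by blast
  obtain L where L: "\<And>w. w \<in> W \<Longrightarrow> (\<And>l. l < m \<Longrightarrow> L \<le> length (w ! l)) \<Longrightarrow> w \<in> S" using S_deep by blast
  have reach: "\<exists>F. finite F \<and> card F \<le> 2 \<and> (\<forall>i<length cs. i \<notin> F \<longrightarrow> disj q (cs ! i)) \<and>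
      (\<forall>i<length cs. \<forall>j<length cs. i \<noteq> j \<longrightarrow> i \<notin> F \<longrightarrow> j \<notin> F \<longrightarrow> cone_cycle q (cs ! i) (cs ! j) \<in> K)"
    if "q \<in> S" for q
  proof -
    obtain c y where c: "c \<in> set cs \<union> (\<lambda>x. u \<odot> x) ` set xs" "y \<in> W" "q = c \<odot> y"
      using \<open>q \<in> S\<close> by (auto simp: S_def)
    show ?thesis
    proof (cases "c \<in> set cs")
      case True
      then obtain i0 where i0: "i0 < length cs" "q = cs ! i0 \<odot> y" using c(3) by (auto simp: in_set_conv_nth)
      have "disj q (cs ! i)" if "i < length cs" "i \<noteq> i0" for i
        using disj_extend_l[OF cells_disj[OF cells_cs i0(1) that(1)]] that i0 cs_W c(2) by auto
      moreover have "cone_cycle q (cs ! i) (cs ! j) \<in> K"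
        if "i < length cs" "j < length cs" "i \<noteq> j" "i \<noteq> i0" "j \<noteq> i0" for i j
        using cone_cycle_cs_deep[of i0 i j y eps eps] that i0 c(2) cs_W by auto
      ultimately show ?thesis by (intro exI[of _ "{i0}"]) auto
    next
      case False
      then obtain x where "x \<in> set xs" "q = (u \<odot> x) \<odot> y" using c by blast
      then show ?thesis using cone_cycle_u c(2) by blast
    qed
  qed
  have tris: "cone_cycle q s t \<in> K" if "q \<in> S" "s \<in> S" "t \<in> S" "cells [q, s, t]" for q s t
    by (rule all_tris_in[OF cone_cycle_cs reach that])
  interpret swap_subgroup m K
    by unfold_locales (rule swaps_in[of S L, OF S_append L tris])
  show "carrier G \<subseteq> K" by (rule carrier_subset)
qed

end

section \<open>Completing a nontrivial element to a generating pair\<close>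

context cantor
begin

lemma complete_generating_pair:
  assumes "0 < m" "g \<in> carrier G" "g \<noteq> id"
  shows "\<exists>h\<in>carrier G. generate G {g, h} = carrier G"
proof -
  obtain u v os where o: "u \<in> W" "v \<in> W" "replaces g u v" "cells (u # v # os)" "cover (u # v # os)" "os \<noteq> []"
    using moved_cone[OF assms] by blast
  obtain p os' where os: "os = p # os'" using o(6) by (cases os) auto
  interpret mixing m g u v p os'
    by unfold_locales (use assms o os in auto)
  show ?thesis using h_carrier generates unfolding K_def by blast
qed

end

theorem theorem2:
  fixes m :: nat
  assumes "m \<ge> 1"
  shows "three_halves_generated (brin_thompson m)"
proof -
  interpret cantor m .
  have m: "0 < m" using assms by simp
  \<comment> \<open>A nontrivial element is exhibited, so that the existence of two generators also
    follows from \<open>complete_generating_pair\<close>.\<close>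
  let ?s = "cone_swap (letter 0 False) (letter 0 True)"
  have d: "disj (letter 0 False) (letter 0 True)" by (simp add: disj_letter m)
  have s: "?s \<in> carrier G" using cone_swap_carrier[OF _ _ d] by simp
  have "?s \<noteq> id"
  proof
    assume "?s = id"
    then have "cone m (letter 0 False) = cone m (letter 0 True)"
      using replaces_image[OF cone_swap_pre(1)[OF _ _ d]] by simp
    then show False using d cone_ne by (auto simp: disj_def)
  qed
  then have "\<exists>a\<in>carrier G. \<exists>b\<in>carrier G. generate G {a, b} = carrier G"
    using complete_generating_pair[OF m s] s by blast
  then show ?thesis
    unfolding three_halves_generated_def using group_G complete_generating_pair[OF m] by simp
qed

end
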